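(* Let $\mathbb{M}\in\{\mathbb{E}^d,\mathbb{H}^d\}$, $d\ge 2$, let $B\subset\mathbb{M}$ be a ball, and let $P\subset\mathbb{M}$ be a convex polytope containing $B$ with at most $d+2$ vertices. Then $\mathrm{vol}_d(P)\ge\mathrm{vol}_d(Q)$ for some convex polytope $Q=\mathrm{conv}(S_1\cup S_2)$ containing $B$, where $S_1,S_2$ are regular simplices with $\dim S_1=k$, $\dim S_2=d-k$ for some integer $1\le k\le d/2$, contained in mutually orthogonal subspaces of $\mathbb{M}$ intersecting at the center of $B$. Furthermore, for every $d$ there is $\varepsilon>0$ such that if $\mathbb{M}=\mathbb{E}^d$ or the radius of $B$ is at most $\varepsilon$, then $Q$ can be chosen with $k=\lfloor d/2\rfloor$, or with $d=4$ and $k=1$.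
   Context: A regular simplex has all edges of equal length. Subspaces of $\mathbb{M}$ are totally geodesic submanifolds. Convexity in $\mathbb{H}^d$ is with respect to hyperbolic geodesic segments; $\mathrm{vol}_d$ is $d$-dimensional (Euclidean or hyperbolic) volume. *)

theory Defs
  imports "HOL-Analysis.Analysis"
begin

text \<open>The model space M is encoded by a flag hyp: hyp = False is Euclidean
space E^d = 'a (d = DIM('a)); hyp = True is hyperbolic space H^d in the
Beltrami--Klein model on the open unit ball of 'a (curvature -1).
In the Klein model geodesics are Euclidean chords, so hyperbolic convex hulls
are Euclidean convex hulls and totally geodesic subspaces are intersections
of affine subspaces with the ball.\<close>

definition Mpts :: "bool \<Rightarrow> 'a::euclidean_space set" where
  "Mpts hyp = (if hyp then {x. norm x < 1} else UNIV)"

definition mdist :: "bool \<Rightarrow> 'a::euclidean_space \<Rightarrow> 'a \<Rightarrow> real" where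
  "mdist hyp x y = (if hyp then
      arcosh ((1 - x \<bullet> y) / sqrt ((1 - (norm x)\<^sup>2) * (1 - (norm y)\<^sup>2)))
    else dist x y)"

text \<open>d-dimensional volume: Lebesgue measure, resp. the hyperbolic volume
density (1 - |x|^2)^(-(d+1)/2) of the Klein model.\<close>
definition mvol :: "bool \<Rightarrow> 'a::euclidean_space set \<Rightarrow> real" where
  "mvol hyp S = integral S (\<lambda>x::'a. if hyp
      then (1 - (norm x)\<^sup>2) powr (- (real DIM('a) + 1) / 2) else 1)"

text \<open>Riemannian orthogonality of tangent vectors u, v at the point c
(Klein metric: g_c(u,v) proportional to (1-|c|^2) u.v + (c.u)(c.v)).\<close>
definition morth :: "bool \<Rightarrow> 'a::euclidean_space \<Rightarrow> 'a \<Rightarrow> 'a \<Rightarrow> bool" where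
  "morth hyp c u v = (if hyp then (1 - (norm c)\<^sup>2) * (u \<bullet> v) + (c \<bullet> u) * (c \<bullet> v) = 0
                      else u \<bullet> v = 0)"

definition mball :: "bool \<Rightarrow> 'a::euclidean_space \<Rightarrow> real \<Rightarrow> 'a set" where
  "mball hyp c r = {x \<in> Mpts hyp. mdist hyp c x \<le> r}"

definition regular_simplex :: "bool \<Rightarrow> nat \<Rightarrow> 'a::euclidean_space set \<Rightarrow> bool" where
  "regular_simplex hyp m A \<longleftrightarrow> finite A \<and> card A = m + 1 \<and> \<not> affine_dependent A \<and>
     A \<subseteq> Mpts hyp \<and> (\<exists>e. \<forall>x\<in>A. \<forall>y\<in>A. x \<noteq> y \<longrightarrow> mdist hyp x y = e)"

definition orth_simplex_config ::
  "bool \<Rightarrow> 'a::euclidean_space \<Rightarrow> real \<Rightarrow> nat \<Rightarrow> 'a set \<Rightarrow> 'a set \<Rightarrow> bool" where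
  "orth_simplex_config hyp c r k A1 A2 \<longleftrightarrow>
     (\<exists>V1 V2. subspace V1 \<and> subspace V2 \<and> dim V1 = k \<and> dim V2 = DIM('a) - k \<and>
        (\<forall>u\<in>V1. \<forall>v\<in>V2. morth hyp c u v) \<and>
        A1 \<subseteq> (\<lambda>v. c + v) ` V1 \<and> A2 \<subseteq> (\<lambda>v. c + v) ` V2) \<and>
     regular_simplex hyp k A1 \<and> regular_simplex hyp (DIM('a) - k) A2 \<and>
     mball hyp c r \<subseteq> convex hull (A1 \<union> A2)"

end

theory Submission
  imports Defs
begin

text \<open>
  Let the ball be centred at \<open>0\<close> and let \<open>P\<close> be the convex hull of \<open>d + 2\<close> points, split into two
  classes of at least two points whose convex hulls meet. For two points \<open>a, b\<close> of the same class, Steiner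
  symmetrization of \<open>P\<close> along \<open>a - b\<close> yields a polytope of the same kind: since the affine relation between
  the \<open>d + 2\<close> points is unique, each fibre of \<open>P\<close> in this direction is obtained by shifting weight between \<open>a\<close>
  and \<open>b\<close> only. Symmetrization keeps the ball inside and does not increase the integral of a radially
  nondecreasing density, such as the Euclidean one or the hyperbolic one in the Klein model. It strictly
  decreases the sum of the squared norms of the points unless the configuration is already symmetric, so by
  compactness all symmetrizations have a common fixed point, and this is a pair of regular simplices
  centred at \<open>0\<close> in orthogonal subspaces.

  A hyperbolic reflection moves an arbitrary centre to \<open>0\<close>; it preserves volume because
  it is induced by a Lorentz reflection, a rank-one perturbation of the identity with determinant \<open>-1\<close>.

  In the Euclidean case the smallest volume for dimensions \<open>k\<close> and \<open>d - k\<close> is proportional to the square root of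
  \<open>(k + 1) ^ (k + 1) * (d - k + 1) ^ (d - k + 1)\<close>, which decreases strictly for
  \<open>k \<le> d / 2\<close>. Since the inequality is strict, it survives a density close to \<open>1\<close>, that is,
  a small hyperbolic ball.
\<close>

section \<open>Integration along a direction\<close>

text \<open>The ball survives symmetrization because the weights representing a point can be moved
  along the affine relation until one of them vanishes in the class not containing \<open>i\<close>
  and \<open>j\<close>; the weights so chosen for a point and for its mirror image can differ only
  at \<open>i\<close> and \<open>j\<close>. A configuration is a family over a fixed index set
  rather than a set of points, since projections and limits may merge points; this also allows a
  polytope with fewer vertices to be padded by repetition. Volume is not minimized: it is only kept
  below that of \<open>P\<close>, a closed condition by Fatou's lemma, while compactness is applied
  to the moment of inertia. No volume of a simplex is evaluated either. The final polytope is cut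
  into simplices of equal volume with apex \<open>0\<close>, each of which is carried by rank-one
  maps to the corner of an orthonormal basis; the volume of that corner cancels, because the
  competitor with other dimensions is built on the same basis.\<close>

abbreviation mass :: "('a::euclidean_space \<Rightarrow> ennreal) \<Rightarrow> 'a set \<Rightarrow> ennreal" where
  "mass W S \<equiv> (\<integral>\<^sup>+x. W x * indicator S x \<partial>lborel)"

lemma nn_integral_lborel_translate:
  fixes f :: "'a::euclidean_space \<Rightarrow> ennreal"
  assumes [measurable]: "f \<in> borel_measurable borel"
  shows "(\<integral>\<^sup>+x. f (t + x) \<partial>lborel) = (\<integral>\<^sup>+x. f x \<partial>lborel)"
proof -
  have "(\<integral>\<^sup>+x. f x \<partial>lborel) = (\<integral>\<^sup>+x. f x \<partial>distr lborel borel ((+) t))"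
    by (simp add: lborel_distr_plus)
  also have "\<dots> = (\<integral>\<^sup>+x. f (t + x) \<partial>lborel)"
    by (rule nn_integral_distr) auto
  finally show ?thesis ..
qed

text \<open>Every line in direction \<open>e\<close> meets the half-open slab in a segment of parameter length one,
  so averaging over the slab gives Fubini along \<open>e\<close> without a change of basis.\<close>

lemma nn_integral_lborel_slab:
  fixes f :: "'a::euclidean_space \<Rightarrow> ennreal"
  assumes [measurable]: "f \<in> borel_measurable borel" and e: "e \<noteq> 0"
  shows "(\<integral>\<^sup>+x. f x \<partial>lborel)
    = (\<integral>\<^sup>+x. indicator {x. 0 \<le> x \<bullet> e \<and> x \<bullet> e < e \<bullet> e} x * (\<integral>\<^sup>+s. f (x + s *\<^sub>R e) \<partial>lborel) \<partial>lborel)"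
proof -
  define S where "S = {x. 0 \<le> x \<bullet> e \<and> x \<bullet> e < e \<bullet> e}"
  have [measurable]: "S \<in> sets borel" unfolding S_def by measurable
  have ee: "e \<bullet> e > 0" using e by simp
  have one: "(\<integral>\<^sup>+s. indicator S (y - s *\<^sub>R e) \<partial>lborel) = (1::ennreal)" for y
  proof -
    have "(\<integral>\<^sup>+s. indicator S (y - s *\<^sub>R e) \<partial>lborel)
      = (\<integral>\<^sup>+s. indicator {y \<bullet> e / (e \<bullet> e) - 1 <.. y \<bullet> e / (e \<bullet> e)} s \<partial>lborel)"
      using ee by (intro nn_integral_cong)
        (auto simp: S_def indicator_def inner_diff_left field_simps)
    also have "\<dots> = 1" by simp
    finally show ?thesis .
  qed
  have "(\<integral>\<^sup>+x. indicator S x * (\<integral>\<^sup>+s. f (x + s *\<^sub>R e) \<partial>lborel) \<partial>lborel)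
      = (\<integral>\<^sup>+x. (\<integral>\<^sup>+s. indicator S x * f (x + s *\<^sub>R e) \<partial>lborel) \<partial>lborel)"
    by (intro nn_integral_cong nn_integral_cmult[symmetric]) measurable
  also have "\<dots> = (\<integral>\<^sup>+s. (\<integral>\<^sup>+x. indicator S x * f (x + s *\<^sub>R e) \<partial>lborel) \<partial>lborel)"
    by (rule lborel_pair.Fubini') measurable
  also have "\<dots> = (\<integral>\<^sup>+s. (\<integral>\<^sup>+x. indicator S (x - s *\<^sub>R e) * f x \<partial>lborel) \<partial>lborel)"
  proof (rule nn_integral_cong)
    fix s :: real
    show "(\<integral>\<^sup>+x. indicator S x * f (x + s *\<^sub>R e) \<partial>lborel) = (\<integral>\<^sup>+x. indicator S (x - s *\<^sub>R e) * f x \<partial>lborel)"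
      using nn_integral_lborel_translate[of "\<lambda>x. indicator S (x - s *\<^sub>R e) * f x" "s *\<^sub>R e"]
      by (simp add: add.commute)
  qed
  also have "\<dots> = (\<integral>\<^sup>+x. (\<integral>\<^sup>+s. indicator S (x - s *\<^sub>R e) * f x \<partial>lborel) \<partial>lborel)"
    by (rule lborel_pair.Fubini') measurable
  also have "\<dots> = (\<integral>\<^sup>+x. (\<integral>\<^sup>+s. indicator S (x - s *\<^sub>R e) \<partial>lborel) * f x \<partial>lborel)"
    by (intro nn_integral_cong nn_integral_multc) measurable
  also have "\<dots> = (\<integral>\<^sup>+x. f x \<partial>lborel)" by (simp add: one)
  finally show ?thesis by (simp add: S_def)
qed

text \<open>On \<open>Y - X\<close> the density is at most \<open>c\<close>, on \<open>X - Y\<close>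
  at least \<open>c\<close>, and cancelling the common part, which has finite measure, shows that
  \<open>X - Y\<close> is at least as large as \<open>Y - X\<close>. So a set cut out by a level of
  \<open>W\<close> is the cheapest one of its measure.\<close>

lemma nn_integral_bathtub:
  fixes W :: "'b \<Rightarrow> ennreal"
  assumes [measurable]: "W \<in> borel_measurable M" "X \<in> sets M" "Y \<in> sets M"
    and le: "emeasure M Y \<le> emeasure M X" and fin: "emeasure M Y < \<infinity>"
    and Y: "\<And>x. x \<in> Y \<Longrightarrow> W x \<le> c" and nY: "\<And>x. x \<notin> Y \<Longrightarrow> c \<le> W x"
  shows "(\<integral>\<^sup>+x. W x * indicator Y x \<partial>M) \<le> (\<integral>\<^sup>+x. W x * indicator X x \<partial>M)"
proof -
  have split: "(\<integral>\<^sup>+x. W x * indicator A x \<partial>M) = (\<integral>\<^sup>+x. W x * indicator (X \<inter> Y) x \<partial>M)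
      + (\<integral>\<^sup>+x. W x * indicator (A - X \<inter> Y) x \<partial>M)"
    if [measurable]: "A \<in> sets M" and "X \<inter> Y \<subseteq> A" for A
  proof -
    have "(\<integral>\<^sup>+x. W x * indicator A x \<partial>M)
      = (\<integral>\<^sup>+x. W x * indicator (X \<inter> Y) x + W x * indicator (A - X \<inter> Y) x \<partial>M)"
      using that by (intro nn_integral_cong) (auto simp: indicator_def)
    also have "\<dots> = (\<integral>\<^sup>+x. W x * indicator (X \<inter> Y) x \<partial>M)
      + (\<integral>\<^sup>+x. W x * indicator (A - X \<inter> Y) x \<partial>M)"
      by (rule nn_integral_add) measurable
    finally show ?thesis .
  qed
  have finI: "emeasure M (X \<inter> Y) \<noteq> \<infinity>"
    using fin emeasure_mono[of "X \<inter> Y" Y M] by (auto simp: top_unique)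
  have "(\<integral>\<^sup>+x. W x * indicator (Y - X \<inter> Y) x \<partial>M) \<le> (\<integral>\<^sup>+x. c * indicator (Y - X \<inter> Y) x \<partial>M)"
    by (intro nn_integral_mono) (auto simp: indicator_def Y)
  also have "\<dots> = c * emeasure M (Y - X \<inter> Y)" by (rule nn_integral_cmult_indicator) measurable
  also have "\<dots> \<le> c * emeasure M (X - X \<inter> Y)"
  proof (rule mult_left_mono)
    have "emeasure M (Y - X \<inter> Y) = emeasure M Y - emeasure M (X \<inter> Y)"
      using finI by (intro emeasure_Diff) auto
    also have "\<dots> \<le> emeasure M X - emeasure M (X \<inter> Y)"
      by (intro ennreal_minus_mono le order_refl)
    also have "\<dots> = emeasure M (X - X \<inter> Y)"
      using finI by (intro emeasure_Diff[symmetric]) auto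
    finally show "emeasure M (Y - X \<inter> Y) \<le> emeasure M (X - X \<inter> Y)" .
  qed simp
  also have "\<dots> = (\<integral>\<^sup>+x. c * indicator (X - X \<inter> Y) x \<partial>M)"
    by (rule nn_integral_cmult_indicator[symmetric]) measurable
  also have "\<dots> \<le> (\<integral>\<^sup>+x. W x * indicator (X - X \<inter> Y) x \<partial>M)"
    by (intro nn_integral_mono) (auto simp: indicator_def nY)
  finally show ?thesis by (auto simp: split[of X] split[of Y] intro: add_left_mono)
qed

section \<open>Volume under rank-one perturbations of the identity\<close>

text \<open>The map preserves every line in direction \<open>e\<close> and acts on it affinely with
  slope \<open>1 + u \<bullet> e\<close>, which is also its determinant. Fubini along
  \<open>e\<close> therefore gives the volume factor without any matrix.\<close>

lemma emeasure_rank_one_image: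
  fixes e u :: "'a::euclidean_space"
  assumes [measurable]: "S \<in> sets borel" and D: "1 + u \<bullet> e \<noteq> 0"
  shows "emeasure lborel ((\<lambda>x. x + (u \<bullet> x) *\<^sub>R e) ` S) = ennreal \<bar>1 + u \<bullet> e\<bar> * emeasure lborel S"
proof (cases "e = 0")
  case True
  then show ?thesis by simp
next
  case e: False
  define D where "D = 1 + u \<bullet> e"
  have D0: "D \<noteq> 0" using D D_def by simp
  define f where "f = (\<lambda>x. x + (u \<bullet> x) *\<^sub>R e)"
  \<comment> \<open>The Sherman-Morrison inverse of \<open>f\<close>.\<close>
  define g where "g = (\<lambda>x. x - ((u \<bullet> x) / D) *\<^sub>R e)"
  have fg: "f (g x) = x" for x
  proof -
    have "f (g x) = x + (u \<bullet> x - (u \<bullet> x) / D - (u \<bullet> x) / D * (u \<bullet> e)) *\<^sub>R e"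
      by (simp add: f_def g_def inner_diff_right algebra_simps)
    also have "u \<bullet> x - (u \<bullet> x) / D - (u \<bullet> x) / D * (u \<bullet> e) = 0"
      using D0 by (simp add: D_def field_simps)
    finally show ?thesis by simp
  qed
  have gf: "g (f x) = x" for x
  proof -
    have "g (f x) = x + (u \<bullet> x - (u \<bullet> x + (u \<bullet> x) * (u \<bullet> e)) / D) *\<^sub>R e"
      by (simp add: f_def g_def inner_add_right algebra_simps)
    also have "u \<bullet> x - (u \<bullet> x + (u \<bullet> x) * (u \<bullet> e)) / D = 0"
      using D0 by (simp add: D_def field_simps)
    finally show ?thesis by simp
  qed
  have [measurable]: "g \<in> borel_measurable borel" unfolding g_def by measurable
  have im: "x \<in> f ` S \<longleftrightarrow> g x \<in> S" for x using fg gf by (metis imageE image_eqI)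
  have fS: "f ` S = g -` S \<inter> space borel" using im by auto
  have [measurable]: "f ` S \<in> sets borel" unfolding fS by measurable
  \<comment> \<open>On each line \<open>g\<close> is an affine change of parameter with slope
    \<open>1/D\<close>, so one-dimensional substitution applies.\<close>
  have line: "g (x + s *\<^sub>R e) = x + (- (u \<bullet> x) / D + (1/D) * s) *\<^sub>R e" for x s
  proof -
    have "g (x + s *\<^sub>R e) = x + (s - (u \<bullet> x + s * (u \<bullet> e)) / D) *\<^sub>R e"
      by (simp add: g_def inner_add_right algebra_simps)
    also have "s - (u \<bullet> x + s * (u \<bullet> e)) / D = - (u \<bullet> x) / D + (1/D) * s"
    proof -
      have "s * (u \<bullet> e) = s * D - s" by (simp add: D_def algebra_simps)
      then show ?thesis using D0 by (simp add: field_simps)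
    qed
    finally show ?thesis .
  qed
  have inner: "(\<integral>\<^sup>+s. indicator (f ` S) (x + s *\<^sub>R e) \<partial>lborel)
      = ennreal \<bar>D\<bar> * (\<integral>\<^sup>+s. indicator S (x + s *\<^sub>R e) \<partial>lborel)" for x
  proof -
    have "(\<integral>\<^sup>+s. indicator S (x + s *\<^sub>R e) \<partial>lborel)
      = ennreal \<bar>1/D\<bar> * (\<integral>\<^sup>+s. indicator S (x + (- (u \<bullet> x) / D + (1/D) * s) *\<^sub>R e) \<partial>lborel)"
      using D0 by (intro nn_integral_real_affine) auto
    also have "(\<integral>\<^sup>+s. indicator S (x + (- (u \<bullet> x) / D + (1/D) * s) *\<^sub>R e) \<partial>lborel)
       = (\<integral>\<^sup>+s. indicator (f ` S) (x + s *\<^sub>R e) \<partial>lborel)"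
      by (intro nn_integral_cong) (simp add: indicator_def im line)
    finally have "ennreal \<bar>D\<bar> * (\<integral>\<^sup>+s. indicator S (x + s *\<^sub>R e) \<partial>lborel)
       = (ennreal \<bar>D\<bar> * ennreal \<bar>1/D\<bar>) * (\<integral>\<^sup>+s. indicator (f ` S) (x + s *\<^sub>R e) \<partial>lborel)"
      by (simp add: mult.assoc)
    also have "ennreal \<bar>D\<bar> * ennreal \<bar>1/D\<bar> = 1"
      using D0 by (simp flip: ennreal_mult add: abs_mult[symmetric])
    finally show ?thesis by simp
  qed
  have "emeasure lborel (f ` S) = (\<integral>\<^sup>+x. indicator (f ` S) x \<partial>lborel)" by simp
  also have "\<dots> = ennreal \<bar>D\<bar> * (\<integral>\<^sup>+x. indicator S x \<partial>lborel)"
    unfolding nn_integral_lborel_slab[OF borel_measurable_indicator[OF \<open>f ` S \<in> sets borel\<close>] e]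
      nn_integral_lborel_slab[OF borel_measurable_indicator[OF assms(1)] e] inner
    by (subst nn_integral_cmult[symmetric]) (auto simp: mult_ac)
  finally show ?thesis by (simp add: f_def D_def)
qed

section \<open>Steiner symmetrization of the hull of finitely many points\<close>

text \<open>Weights belong to indices instead of points, so a family may repeat a point while each
  member keeps its own weight. Shifting weight between two named members is meaningful only in this
  form.\<close>

lemma convex_hull_family:
  assumes N: "finite N"
  shows "convex hull (a ` N) = {x. \<exists>s. (\<forall>v\<in>N. 0 \<le> s v) \<and> sum s N = 1 \<and> (\<Sum>v\<in>N. s v *\<^sub>R a v) = x}"
    (is "_ = ?H")
proof
  show "convex hull (a ` N) \<subseteq> ?H"
  proof (rule hull_minimal)
    show "a ` N \<subseteq> ?H"
    proof clarify
      fix v assume v: "v \<in> N"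
      have "(\<Sum>w\<in>N. (if w = v then 1 else 0) *\<^sub>R a w) = (\<Sum>w\<in>N. if w = v then a w else 0)"
        by (rule sum.cong) auto
      also have "\<dots> = a v" using v N by simp
      finally show "\<exists>s. (\<forall>v\<in>N. 0 \<le> s v) \<and> sum s N = 1 \<and> (\<Sum>w\<in>N. s w *\<^sub>R a w) = a v"
        using v N by (intro exI[of _ "\<lambda>w. if w = v then 1 else 0"]) auto
    qed
    show "convex ?H"
    proof (rule convexI)
      fix x y and p q :: real
      assume "x \<in> ?H" "y \<in> ?H" and pq: "0 \<le> p" "0 \<le> q" "p + q = 1"
      then obtain s t where "\<forall>v\<in>N. 0 \<le> s v" "sum s N = 1" "(\<Sum>v\<in>N. s v *\<^sub>R a v) = x"
        "\<forall>v\<in>N. 0 \<le> t v" "sum t N = 1" "(\<Sum>v\<in>N. t v *\<^sub>R a v) = y"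
        by auto
      then show "p *\<^sub>R x + q *\<^sub>R y \<in> ?H"
        using pq
        by (intro CollectI exI[of _ "\<lambda>v. p * s v + q * t v"])
          (auto simp: sum.distrib scaleR_left_distrib scaleR_right.sum simp flip: sum_distrib_left scaleR_scaleR)
    qed
  qed
  show "?H \<subseteq> convex hull (a ` N)"
  proof clarify
    fix s :: "_ \<Rightarrow> real" assume "\<forall>v\<in>N. 0 \<le> s v" "sum s N = 1"
    then show "(\<Sum>v\<in>N. s v *\<^sub>R a v) \<in> convex hull (a ` N)"
      using N by (intro convex_sum convex_convex_hull) (auto intro: hull_inc)
  qed
qed

lemma convex_hull_familyI:
  assumes "finite N" "\<And>v. v \<in> N \<Longrightarrow> 0 \<le> s v" "sum s N = 1" "(\<Sum>v\<in>N. s v *\<^sub>R a v) = x"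
  shows "x \<in> convex hull (a ` N)"
  using assms unfolding convex_hull_family[OF assms(1)] by blast

lemma compact_convex_hull_family:
  fixes a :: "'i \<Rightarrow> 'a::euclidean_space"
  shows "finite N \<Longrightarrow> compact (convex hull (a ` N))"
  by (intro compact_convex_hull finite_imp_compact) simp

definition orth_proj :: "'a::euclidean_space \<Rightarrow> 'a \<Rightarrow> 'a" where
  "orth_proj e x = x - ((x \<bullet> e) / (e \<bullet> e)) *\<^sub>R e"

lemma linear_orth_proj: "linear (orth_proj e)"
  by (rule linearI) (auto simp: orth_proj_def inner_add_left add_divide_distrib algebra_simps)

lemma orth_proj_add_scaleR:
  assumes "e \<noteq> 0" shows "orth_proj e (x + s *\<^sub>R e) = orth_proj e x"
  using assms by (simp add: orth_proj_def inner_add_left add_divide_distrib algebra_simps)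

lemma inner_orth_proj: "e \<noteq> 0 \<Longrightarrow> orth_proj e x \<bullet> e = 0"
  by (simp add: orth_proj_def inner_diff_left)

lemma norm_orth_proj_add_scaleR:
  assumes "e \<noteq> 0" shows "(norm (orth_proj e x + s *\<^sub>R e))\<^sup>2 = (norm (orth_proj e x))\<^sup>2 + s\<^sup>2 * (norm e)\<^sup>2"
proof -
  have "(norm (orth_proj e x + s *\<^sub>R e))\<^sup>2 = (norm (orth_proj e x))\<^sup>2 + (norm (s *\<^sub>R e))\<^sup>2"
    by (rule norm_add_Pythagorean) (simp add: orthogonal_def inner_orth_proj[OF assms])
  then show ?thesis by (simp add: power_mult_distrib)
qed

text \<open>The symmetral as a set is never formed. Its vertices are written down directly: every
  member is projected to the hyperplane orthogonal to \<open>e = a i - a j\<close>, and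
  \<open>i\<close> and \<open>j\<close> are put at heights \<open>+1/2\<close> and
  \<open>-1/2\<close> in units of \<open>e\<close>.\<close>

definition steiner :: "('i \<Rightarrow> 'a::euclidean_space) \<Rightarrow> 'i \<Rightarrow> 'i \<Rightarrow> 'i \<Rightarrow> 'a" where
  "steiner a i j v = orth_proj (a i - a j) (a v)
     + (if v = i then 1/2 else if v = j then - 1/2 else 0) *\<^sub>R (a i - a j)"

lemma sum_remove2:
  fixes f :: "'i \<Rightarrow> 'b::ab_group_add"
  assumes "finite N" "i \<in> N" "j \<in> N" "i \<noteq> j"
  shows "sum f N = f i + f j + sum f (N - {i, j})"
proof -
  have "N = insert i (insert j (N - {i, j}))" using assms by auto
  then have "sum f N = sum f (insert i (insert j (N - {i, j})))" by simp
  also have "\<dots> = f i + f j + sum f (N - {i, j})" using assms by simp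
  finally show ?thesis .
qed

text \<open>Linearity of the projection settles the component in the hyperplane; the height over it
  depends on the weights of \<open>i\<close> and \<open>j\<close> alone, which is what allows fibres
  to be compared.\<close>

lemma steiner_sum:
  assumes N: "finite N" "i \<in> N" "j \<in> N" "i \<noteq> j"
  shows "(\<Sum>v\<in>N. t v *\<^sub>R steiner a i j v)
    = orth_proj (a i - a j) (\<Sum>v\<in>N. t v *\<^sub>R a v) + ((t i - t j) / 2) *\<^sub>R (a i - a j)"
proof -
  define e where "e = a i - a j"
  have "(\<Sum>v\<in>N. t v *\<^sub>R steiner a i j v) = (\<Sum>v\<in>N. t v *\<^sub>R orth_proj e (a v))
      + (\<Sum>v\<in>N. (t v * (if v = i then 1/2 else if v = j then - 1/2 else 0)) *\<^sub>R e)"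
    by (simp add: steiner_def e_def[symmetric] scaleR_right_distrib sum.distrib)
  also have "(\<Sum>v\<in>N. t v *\<^sub>R orth_proj e (a v)) = orth_proj e (\<Sum>v\<in>N. t v *\<^sub>R a v)"
    by (simp add: linear_sum[OF linear_orth_proj] linear_scale[OF linear_orth_proj])
  also have "(\<Sum>v\<in>N. (t v * (if v = i then 1/2 else if v = j then - 1/2 else 0)) *\<^sub>R e) = ((t i - t j) / 2) *\<^sub>R e"
    by (subst sum_remove2[OF N]) (use N(4) in \<open>auto simp: algebra_simps diff_divide_distrib intro!: sum.neutral\<close>)
  finally show ?thesis by (simp add: e_def)
qed

text \<open>On each line in direction \<open>e\<close> the new fibre lies in an interval of radius
  \<open>h\<close> around the point nearest to \<open>0\<close>, and the old fibre contains an
  interval of length at least \<open>2 * h\<close>, swept out by moving weight between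
  \<open>i\<close> and \<open>j\<close>. For a radially nondecreasing density the centred interval
  is the cheapest of its length.\<close>

lemma nn_integral_steiner_le:
  fixes a :: "'i \<Rightarrow> 'a::euclidean_space" and W :: "'a \<Rightarrow> ennreal"
  assumes N: "finite N" "i \<in> N" "j \<in> N" "i \<noteq> j" and ne: "a i \<noteq> a j"
    and W[measurable]: "W \<in> borel_measurable borel"
    and mono: "\<And>x y. norm x \<le> norm y \<Longrightarrow> W x \<le> W y"
  shows "mass W (convex hull (steiner a i j ` N))
    \<le> mass W (convex hull (a ` N))"
proof -
  define P where "P = convex hull (a ` N)"
  define P' where "P' = convex hull (steiner a i j ` N)"
  define e where "e = a i - a j"
  have e0: "e \<noteq> 0" using ne by (simp add: e_def)
  have cP: "compact P" "compact P'" unfolding P_def P'_def by (intro compact_convex_hull_family N)+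
  have [measurable]: "P \<in> sets borel" "P' \<in> sets borel" using cP by (auto intro: borel_compact)
  have line: "(\<integral>\<^sup>+s. W (x + s *\<^sub>R e) * indicator P' (x + s *\<^sub>R e) \<partial>lborel)
    \<le> (\<integral>\<^sup>+s. W (x + s *\<^sub>R e) * indicator P (x + s *\<^sub>R e) \<partial>lborel)" for x
  proof (cases "\<exists>s. x + s *\<^sub>R e \<in> P'")
    case False
    then show ?thesis by (simp add: indicator_def)
  next
    case True
    \<comment> \<open>The parameter of the foot of the perpendicular from \<open>0\<close>; along
      the line the norm grows with the distance of \<open>s\<close> from \<open>s0\<close>.\<close>
    define s0 where "s0 = - ((x \<bullet> e) / (e \<bullet> e))"
    have dec: "x + s *\<^sub>R e = orth_proj e x + (s - s0) *\<^sub>R e" for s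
      by (simp add: orth_proj_def s0_def algebra_simps)
    define X' where "X' = (\<lambda>s. x + s *\<^sub>R e) -` P'"
    define X where "X = (\<lambda>s. x + s *\<^sub>R e) -` P"
    have [measurable]: "X \<in> sets borel" "X' \<in> sets borel"
      unfolding X_def X'_def by (auto intro!: measurable_sets_borel[where M=borel])
    have "closed X'" unfolding X'_def
      by (intro continuous_closed_vimage compact_imp_closed cP) (auto intro!: continuous_intros)
    moreover have "bounded X'"
    proof -
      obtain B where B: "\<And>y. y \<in> P' \<Longrightarrow> norm y \<le> B"
        using compact_imp_bounded[OF cP(2)] by (auto simp: bounded_iff)
      have "norm s \<le> (B + norm x) / norm e" if "s \<in> X'" for s
      proof -
        have "norm (s *\<^sub>R e) \<le> norm (x + s *\<^sub>R e) + norm x"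
          using norm_triangle_ineq4[of "x + s *\<^sub>R e" x] by simp
        also have "\<dots> \<le> B + norm x" using B that by (simp add: X'_def)
        finally show ?thesis using e0 by (simp add: field_simps)
      qed
      then show ?thesis by (auto simp: bounded_iff)
    qed
    ultimately have "compact X'" by (simp add: compact_eq_bounded_closed)
    moreover have "X' \<noteq> {}" using True by (auto simp: X'_def)
    moreover have "continuous_on X' (\<lambda>s. \<bar>s - s0\<bar>)" by (intro continuous_intros)
    \<comment> \<open>The point of the new fibre farthest from the foot determines a centred
      interval \<open>Y\<close> containing the whole fibre, so the weights of this one point suffice
      for the comparison.\<close>
    ultimately obtain s1 where s1: "s1 \<in> X'" "\<And>s. s \<in> X' \<Longrightarrow> \<bar>s - s0\<bar> \<le> \<bar>s1 - s0\<bar>"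
      using continuous_attains_sup[of X' "\<lambda>s. \<bar>s - s0\<bar>"] by blast
    define h where "h = \<bar>s1 - s0\<bar>"
    define Y where "Y = {s0 - h .. s0 + h}"
    have X'Y: "X' \<subseteq> Y" using s1(2) by (force simp: Y_def h_def abs_le_iff)
    have "x + s1 *\<^sub>R e \<in> P'" using s1(1) by (simp add: X'_def)
    then obtain t where t: "\<And>v. v \<in> N \<Longrightarrow> 0 \<le> t v" "sum t N = 1"
      "(\<Sum>v\<in>N. t v *\<^sub>R steiner a i j v) = x + s1 *\<^sub>R e"
      unfolding P'_def convex_hull_family[OF N(1)] by auto
    have eq: "orth_proj e (\<Sum>v\<in>N. t v *\<^sub>R a v) + ((t i - t j) / 2) *\<^sub>R e = orth_proj e x + (s1 - s0) *\<^sub>R e"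
      using t(3) unfolding steiner_sum[OF N] e_def[symmetric] dec .
    from arg_cong[OF this, of "\<lambda>y. y \<bullet> e"] have s1t: "s1 - s0 = (t i - t j) / 2"
      using e0 by (simp add: inner_add_left inner_orth_proj)
    have px: "orth_proj e (\<Sum>v\<in>N. t v *\<^sub>R a v) = orth_proj e x"
      using eq unfolding s1t by simp
    define w where "w = t i + t j"
    have hw: "2 * h \<le> w" using t(1)[OF N(2)] t(1)[OF N(3)] by (auto simp: h_def s1t w_def)
    \<comment> \<open>All of the joint weight \<open>w\<close> of \<open>i\<close> and
      \<open>j\<close> is put on \<open>j\<close>. Moving it over to \<open>i\<close> sweeps a
      segment of parameter length \<open>w\<close> inside the old fibre, starting at the parameter
      \<open>q\<close> of \<open>z\<close>.\<close>
    define z where "z = (\<Sum>v\<in>N. t v *\<^sub>R a v) - t i *\<^sub>R e"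
    define q where "q = ((z - x) \<bullet> e) / (e \<bullet> e)"
    have zq: "z = x + q *\<^sub>R e"
    proof -
      have "orth_proj e z = orth_proj e x"
        using px orth_proj_add_scaleR[OF e0, of _ "- t i"] by (simp add: z_def)
      then show ?thesis
        by (simp add: orth_proj_def q_def inner_diff_left diff_divide_distrib algebra_simps)
    qed
    have "{q .. q + w} \<subseteq> X"
    proof
      fix s assume s: "s \<in> {q .. q + w}"
      define r where "r v = (if v = i then s - q else if v = j then w - (s - q) else t v)" for v
      have r0: "0 \<le> r v" if "v \<in> N" for v using t(1)[OF that] s by (auto simp: r_def)
      have "sum r N = 1" using t(2) N(4) unfolding sum_remove2[OF N] by (simp add: r_def w_def)
      moreover have "(\<Sum>v\<in>N. r v *\<^sub>R a v) = x + s *\<^sub>R e"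
      proof -
        have "(\<Sum>v\<in>N. r v *\<^sub>R a v) = (\<Sum>v\<in>N. t v *\<^sub>R a v) + (s - q - t i) *\<^sub>R e"
          using N(4) unfolding sum_remove2[OF N] by (simp add: r_def w_def e_def algebra_simps)
        also have "\<dots> = z + (s - q) *\<^sub>R e" by (simp add: z_def algebra_simps)
        also have "\<dots> = x + s *\<^sub>R e" by (simp add: zq algebra_simps)
        finally show ?thesis .
      qed
      ultimately show "s \<in> X" unfolding X_def P_def
        using convex_hull_familyI[OF N(1) r0] by simp
    qed
    then have "emeasure lborel {q .. q + w} \<le> emeasure lborel X" by (intro emeasure_mono) auto
    moreover have h0: "h \<ge> 0" by (simp add: h_def)
    moreover have "w \<ge> 0" using hw h0 by linarith
    ultimately have le: "emeasure lborel Y \<le> emeasure lborel X"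
      using hw by (simp add: Y_def) (meson ennreal_leI order_trans)
    have nrm: "norm (x + s *\<^sub>R e) \<le> norm (x + s' *\<^sub>R e)" if "\<bar>s - s0\<bar> \<le> \<bar>s' - s0\<bar>" for s s'
    proof -
      have "(s - s0)\<^sup>2 \<le> (s' - s0)\<^sup>2" using that by (simp add: abs_le_square_iff)
      then have "(norm (x + s *\<^sub>R e))\<^sup>2 \<le> (norm (x + s' *\<^sub>R e))\<^sup>2"
        unfolding dec norm_orth_proj_add_scaleR[OF e0] by (simp add: mult_right_mono)
      then show ?thesis by (rule power2_le_imp_le) simp
    qed
    have "(\<integral>\<^sup>+s. W (x + s *\<^sub>R e) * indicator P' (x + s *\<^sub>R e) \<partial>lborel)
      \<le> (\<integral>\<^sup>+s. W (x + s *\<^sub>R e) * indicator Y s \<partial>lborel)"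
      using X'Y by (intro nn_integral_mono) (auto simp: X'_def indicator_def)
    also have "\<dots> \<le> (\<integral>\<^sup>+s. W (x + s *\<^sub>R e) * indicator X s \<partial>lborel)"
    proof (rule nn_integral_bathtub[OF _ _ _ le, where c = "W (x + (s0 + h) *\<^sub>R e)"])
      show "emeasure lborel Y < \<infinity>" using h0 by (simp add: Y_def del: emeasure_lborel_Icc) (simp add: emeasure_lborel_Icc_eq)
      show "W (x + s *\<^sub>R e) \<le> W (x + (s0 + h) *\<^sub>R e)" if "s \<in> Y" for s
        using that h0 by (intro mono nrm) (auto simp: Y_def)
      show "W (x + (s0 + h) *\<^sub>R e) \<le> W (x + s *\<^sub>R e)" if "s \<notin> Y" for s
        using that h0 by (intro mono nrm) (auto simp: Y_def)
    qed (auto simp: Y_def)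
    also have "\<dots> = (\<integral>\<^sup>+s. W (x + s *\<^sub>R e) * indicator P (x + s *\<^sub>R e) \<partial>lborel)"
      by (intro nn_integral_cong) (auto simp: X_def indicator_def)
    finally show ?thesis .
  qed
  show ?thesis
    unfolding P_def[symmetric] P'_def[symmetric]
    by (subst (1 2) nn_integral_lborel_slab[OF _ e0]; measurable?)
      (intro nn_integral_mono mult_left_mono line; simp)
qed

section \<open>Affine relations among \<open>d + 2\<close> points whose hull contains a ball\<close>

text \<open>A functional constant on the vertices is constant on the ball, hence zero. This replaces
  the statement that the points affinely span the space.\<close>

lemma const_inner_on_cball_imp_zero:
  fixes u :: "'a::euclidean_space"
  assumes "R > 0" "cball 0 R \<subseteq> convex hull (a ` N)" "\<And>v. v \<in> N \<Longrightarrow> u \<bullet> a v = c"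
  shows "u = 0" "c = 0"
proof -
  have "a ` N \<subseteq> {x. u \<bullet> x = c}" using assms(3) by auto
  then have "convex hull (a ` N) \<subseteq> {x. u \<bullet> x = c}" by (intro hull_minimal convex_hyperplane)
  then have *: "u \<bullet> x = c" if "norm x \<le> R" for x using assms(2) that by auto
  show c: "c = 0" using *[of 0] assms(1) by simp
  show "u = 0"
  proof (rule ccontr)
    assume u: "u \<noteq> 0"
    have "u \<bullet> ((R / norm u) *\<^sub>R u) = 0" using *[of "(R / norm u) *\<^sub>R u"] assms(1) c u by simp
    then show False using assms(1) u by simp
  qed
qed

text \<open>The differences from one chosen member are fewer than the dimension, so some nonzero
  vector is orthogonal to all of them.\<close>

lemma exists_const_inner:
  fixes a :: "'i \<Rightarrow> 'a::euclidean_space"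
  assumes N: "finite N" "card N \<le> DIM('a)"
  obtains u c where "u \<noteq> 0" "\<And>v. v \<in> N \<Longrightarrow> u \<bullet> a v = c"
proof (cases "N = {}")
  case True
  have "(SOME b. b \<in> Basis :: 'a) \<noteq> 0" by (rule nonzero_Basis[OF SOME_Basis])
  then show ?thesis using True that by blast
next
  case False
  then obtain k where k: "k \<in> N" by auto
  define S where "S = (\<lambda>v. a v - a k) ` (N - {k})"
  have "dim S \<le> card S" unfolding S_def using N by (intro dim_le_card') auto
  also have "\<dots> \<le> card (N - {k})" unfolding S_def using N by (intro card_image_le) auto
  also have "\<dots> < DIM('a)" using N k by (metis card_Diff1_less le_less_trans less_le_trans)
  finally have "dim S < DIM('a)" .
  then obtain u where u: "u \<noteq> 0" "\<And>y. y \<in> span S \<Longrightarrow> orthogonal u y"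
    using orthogonal_to_subspace_exists[of S] by metis
  have "u \<bullet> a v = u \<bullet> a k" if "v \<in> N" for v
  proof (cases "v = k")
    case False
    then have "a v - a k \<in> span S" using that by (intro span_base) (auto simp: S_def)
    then show ?thesis using u(2)[of "a v - a k"] by (simp add: orthogonal_def inner_diff_right)
  qed simp
  then show ?thesis using u(1) that by blast
qed

text \<open>A member with nonzero coefficient is an affine combination of the rest of the support of
  the relation, so a hyperplane through the rest contains it as well.\<close>

lemma affine_relation_extend_inner:
  fixes a :: "'i \<Rightarrow> 'a::euclidean_space"
  assumes N: "finite N" "k \<in> N" and d: "sum d N = 0" "(\<Sum>v\<in>N. d v *\<^sub>R a v) = 0" "d k \<noteq> 0"
    and u: "\<And>v. v \<in> N \<Longrightarrow> v \<noteq> k \<Longrightarrow> d v \<noteq> 0 \<Longrightarrow> u \<bullet> a v = c"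
  shows "u \<bullet> a k = c"
proof -
  have "(\<Sum>v\<in>N. d v * (u \<bullet> a v - c)) = u \<bullet> (\<Sum>v\<in>N. d v *\<^sub>R a v) - c * sum d N"
    by (simp add: inner_sum_right sum_distrib_left sum_subtractf algebra_simps)
  also have "\<dots> = 0" using d by simp
  finally have "(\<Sum>v\<in>N. d v * (u \<bullet> a v - c)) = 0" .
  moreover have "(\<Sum>v\<in>N. d v * (u \<bullet> a v - c)) = d k * (u \<bullet> a k - c)"
  proof -
    have "(\<Sum>v\<in>N - {k}. d v * (u \<bullet> a v - c)) = 0"
    proof (intro sum.neutral ballI)
      fix v assume "v \<in> N - {k}"
      then show "d v * (u \<bullet> a v - c) = 0" using u[of v] by (cases "d v = 0") auto
    qed
    then show ?thesis unfolding sum.remove[OF N] by simp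
  qed
  ultimately show ?thesis using d(3) by simp
qed

text \<open>Subtracting a multiple of \<open>c\<close> makes the relation vanish at
  \<open>m\<close>. If it did not vanish at some \<open>k\<close>, take a hyperplane through the
  other \<open>d\<close> points: the difference forces \<open>a k\<close> into it, then
  \<open>c\<close> forces \<open>a m\<close> into it, and no hyperplane contains all the points when
  their hull contains a ball.\<close>

lemma affine_relation_unique:
  fixes a :: "'i \<Rightarrow> 'a::euclidean_space"
  assumes N: "finite N" "card N = DIM('a) + 2" and R: "R > 0" "cball 0 R \<subseteq> convex hull (a ` N)"
    and c: "sum c N = 0" "(\<Sum>v\<in>N. c v *\<^sub>R a v) = 0" "m \<in> N" "c m \<noteq> 0"
    and d: "sum d N = 0" "(\<Sum>v\<in>N. d v *\<^sub>R a v) = 0"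
  obtains \<kappa> where "\<And>v. v \<in> N \<Longrightarrow> d v = \<kappa> * c v"
proof -
  define d' where "d' v = d v - d m / c m * c v" for v
  have d'm: "d' m = 0" using c(4) by (simp add: d'_def)
  have d's: "sum d' N = 0"
  proof -
    have "sum d' N = sum d N - (d m / c m) * sum c N"
      by (simp add: d'_def sum_subtractf sum_distrib_left)
    then show ?thesis using c d by simp
  qed
  have d'a: "(\<Sum>v\<in>N. d' v *\<^sub>R a v) = 0"
  proof -
    have "(\<Sum>v\<in>N. d' v *\<^sub>R a v) = (\<Sum>v\<in>N. d v *\<^sub>R a v) - (d m / c m) *\<^sub>R (\<Sum>v\<in>N. c v *\<^sub>R a v)"
      by (simp add: d'_def sum_subtractf scaleR_left_diff_distrib scaleR_right.sum)
    then show ?thesis using c d by simp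
  qed
  have "d' k = 0" if k: "k \<in> N" for k
  proof (rule ccontr)
    assume d'k: "d' k \<noteq> 0"
    then have km: "k \<noteq> m" using d'm by auto
    have "card (N - {k, m}) \<le> DIM('a)" using N k c(3) km by (simp add: card_Diff_subset)
    then obtain u b where u: "u \<noteq> 0" "\<And>v. v \<in> N - {k, m} \<Longrightarrow> u \<bullet> a v = b"
      using exists_const_inner[of "N - {k, m}" a] N by blast
    have uk: "u \<bullet> a k = b"
      by (rule affine_relation_extend_inner[OF N(1) k d's d'a d'k]) (use u(2) d'm in auto)
    have um: "u \<bullet> a m = b"
      by (rule affine_relation_extend_inner[OF N(1) c(3,1,2,4)]) (use u(2) uk in auto)
    have "u \<bullet> a v = b" if "v \<in> N" for v using u(2) uk um that by blast
    then show False using const_inner_on_cball_imp_zero(1)[OF R] u(1) by blast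
  qed
  then have "\<And>v. v \<in> N \<Longrightarrow> d v = (d m / c m) * c v" by (simp add: d'_def)
  then show ?thesis by (rule that)
qed

text \<open>Among all weights representing a point, those that vanish somewhere on the negative side of
  the affine relation are canonical; they are reached by adding multiples of the relation.\<close>

lemma push_along_relation:
  fixes a :: "'i \<Rightarrow> 'a::euclidean_space"
  assumes N: "finite N" and c: "sum c N = 0" "(\<Sum>v\<in>N. c v *\<^sub>R a v) = 0" "\<exists>v\<in>N. c v < 0"
    and x: "x \<in> convex hull (a ` N)"
  shows "\<exists>s. (\<forall>v\<in>N. 0 \<le> s v) \<and> sum s N = 1 \<and> (\<Sum>v\<in>N. s v *\<^sub>R a v) = x \<and>
    (\<exists>v\<in>N. c v < 0 \<and> s v = 0)"
proof -
  obtain t where t: "\<And>v. v \<in> N \<Longrightarrow> 0 \<le> t v" "sum t N = 1" "(\<Sum>v\<in>N. t v *\<^sub>R a v) = x"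
    using x unfolding convex_hull_family[OF N] by auto
  \<comment> \<open>The ratio test of the simplex method: the least quotient is the largest multiple
    of \<open>c\<close> that keeps all weights nonnegative, and a member attaining it reaches weight
    \<open>0\<close>.\<close>
  define T where "T = (\<lambda>v. t v / (- c v)) ` {v\<in>N. c v < 0}"
  have T: "finite T" "T \<noteq> {}" unfolding T_def using N c(3) by auto
  define \<tau> where "\<tau> = Min T"
  have \<tau>T: "\<tau> \<in> T" unfolding \<tau>_def using T by (rule Min_in)
  have \<tau>0: "\<tau> \<ge> 0" using \<tau>T t(1) unfolding T_def by (auto intro!: divide_nonneg_neg)
  have \<tau>le: "\<tau> \<le> t v / (- c v)" if "v \<in> N" "c v < 0" for v
    unfolding \<tau>_def using T(1) by (rule Min_le) (use that in \<open>auto simp: T_def\<close>)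
  define s where "s v = t v + \<tau> * c v" for v
  show ?thesis
  proof (intro exI[of _ s] conjI ballI)
    show "0 \<le> s v" if "v \<in> N" for v
    proof (cases "c v < 0")
      case True
      then show ?thesis using \<tau>le[OF that True] by (simp add: s_def field_simps)
    qed (use \<tau>0 t(1)[OF that] in \<open>simp add: s_def\<close>)
    show "sum s N = 1" using t c by (simp add: s_def sum.distrib flip: sum_distrib_left)
    show "(\<Sum>v\<in>N. s v *\<^sub>R a v) = x"
    proof -
      have "(\<Sum>v\<in>N. s v *\<^sub>R a v) = (\<Sum>v\<in>N. t v *\<^sub>R a v) + \<tau> *\<^sub>R (\<Sum>v\<in>N. c v *\<^sub>R a v)"
        by (simp add: s_def sum.distrib scaleR_left_distrib scaleR_right.sum)
      then show ?thesis using t c by simp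
    qed
    from \<tau>T obtain v where v: "v \<in> N" "c v < 0" "\<tau> = t v / (- c v)" unfolding T_def by auto
    then have "s v = 0" by (simp add: s_def)
    then show "\<exists>v\<in>N. c v < 0 \<and> s v = 0" using v by blast
  qed
qed

lemma norm_reflection:
  "norm (x - (2 * ((x \<bullet> e) / (e \<bullet> e))) *\<^sub>R e) = norm (x::'a::euclidean_space)"
proof (cases "e = 0")
  case False
  define \<tau> where "\<tau> = (x \<bullet> e) / (e \<bullet> e)"
  have "x = orth_proj e x + \<tau> *\<^sub>R e" "x - (2 * \<tau>) *\<^sub>R e = orth_proj e x + (- \<tau>) *\<^sub>R e"
    by (simp_all add: orth_proj_def \<tau>_def algebra_simps flip: scaleR_add_left)
  then have "(norm (x - (2 * \<tau>) *\<^sub>R e))\<^sup>2 = (norm x)\<^sup>2"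
    using norm_orth_proj_add_scaleR[OF False, of x \<tau>] norm_orth_proj_add_scaleR[OF False, of x "- \<tau>"]
    by simp
  then show ?thesis by (simp add: \<tau>_def)
qed simp

text \<open>The mirror image \<open>y\<close> of \<open>x\<close> also lies in the ball, so both
  have canonical weights. By uniqueness of the relation these agree except at \<open>i\<close> and
  \<open>j\<close>, where they differ by \<open>2 * \<tau>\<close>; hence \<open>i\<close> and
  \<open>j\<close> jointly carry enough weight for the symmetrized fibre to reach the height
  \<open>\<tau>\<close> of \<open>x\<close>.\<close>

lemma cball_subset_steiner:
  fixes a :: "'i \<Rightarrow> 'a::euclidean_space"
  assumes N: "finite N" "card N = DIM('a) + 2" and R: "R > 0" "cball 0 R \<subseteq> convex hull (a ` N)"
    and c: "sum c N = 0" "(\<Sum>v\<in>N. c v *\<^sub>R a v) = 0" "\<exists>v\<in>N. c v < 0"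
    and ij: "i \<in> N" "j \<in> N" "i \<noteq> j" "0 \<le> c i" "0 \<le> c j" and ne: "a i \<noteq> a j"
  shows "cball 0 R \<subseteq> convex hull (steiner a i j ` N)"
proof
  fix x :: 'a assume x: "x \<in> cball 0 R"
  define e where "e = a i - a j"
  have e0: "e \<noteq> 0" using ne by (simp add: e_def)
  define \<tau> where "\<tau> = (x \<bullet> e) / (e \<bullet> e)"
  define y where "y = x - (2 * \<tau>) *\<^sub>R e"
  have "y \<in> cball 0 R" using x norm_reflection[of x e] by (simp add: y_def \<tau>_def)
  with x R(2) have xy: "x \<in> convex hull (a ` N)" "y \<in> convex hull (a ` N)" by auto
  obtain s where s: "\<And>v. v \<in> N \<Longrightarrow> 0 \<le> s v" "sum s N = 1" "(\<Sum>v\<in>N. s v *\<^sub>R a v) = x"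
      "\<exists>v\<in>N. c v < 0 \<and> s v = 0"
    using push_along_relation[OF N(1) c xy(1)] by blast
  obtain s' where s': "\<And>v. v \<in> N \<Longrightarrow> 0 \<le> s' v" "sum s' N = 1" "(\<Sum>v\<in>N. s' v *\<^sub>R a v) = y"
      "\<exists>v\<in>N. c v < 0 \<and> s' v = 0"
    using push_along_relation[OF N(1) c xy(2)] by blast
  obtain m where m: "m \<in> N" "c m < 0" "s m = 0" using s(4) by auto
  obtain n where n: "n \<in> N" "c n < 0" "s' n = 0" using s'(4) by auto
  \<comment> \<open>The difference of the two weight vectors, corrected by the transfer of
    \<open>2 * \<tau>\<close> from \<open>j\<close> to \<open>i\<close> that moves \<open>y\<close>
    to \<open>x\<close>; what remains is an affine relation.\<close>
  define d where "d v = s v - s' v - (if v = i then 2 * \<tau> else if v = j then - 2 * \<tau> else 0)" for v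
  have "sum d N = sum s N - sum s' N"
    unfolding sum_remove2[OF N(1) ij(1-3)] using ij(3) by (auto simp: d_def sum_subtractf intro!: sum.cong)
  then have d1: "sum d N = 0" using s s' by simp
  have "(\<Sum>v\<in>N. d v *\<^sub>R a v) = (\<Sum>v\<in>N. s v *\<^sub>R a v) - (\<Sum>v\<in>N. s' v *\<^sub>R a v) - (2 * \<tau>) *\<^sub>R e"
    unfolding sum_remove2[OF N(1) ij(1-3)] using ij(3)
    by (simp add: d_def e_def sum_subtractf algebra_simps)
  then have d2: "(\<Sum>v\<in>N. d v *\<^sub>R a v) = 0" using s s' by (simp add: y_def)
  obtain \<kappa> where \<kappa>: "\<And>v. v \<in> N \<Longrightarrow> d v = \<kappa> * c v"
    using affine_relation_unique[OF N R c(1,2) m(1) _ d1 d2] m(2) by auto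
  \<comment> \<open>Neither \<open>m\<close> nor \<open>n\<close> is \<open>i\<close> or
    \<open>j\<close>, since \<open>c\<close> is negative only at the former. The multiple
    \<open>\<kappa> * c\<close> is at most \<open>0\<close> at \<open>m\<close> and at least
    \<open>0\<close> at \<open>n\<close>, while \<open>c\<close> is negative at both, so
    \<open>\<kappa> = 0\<close>.\<close>
  have "d m = - s' m" "d n = s n" using m n ij by (auto simp: d_def)
  then have "\<kappa> * c m \<le> 0" "\<kappa> * c n \<ge> 0" using \<kappa>[OF m(1)] \<kappa>[OF n(1)] s(1)[OF n(1)] s'(1)[OF m(1)] by auto
  then have "\<kappa> = 0" using m(2) n(2) by (simp add: mult_le_0_iff zero_le_mult_iff)
  then have dz: "d v = 0" if "v \<in> N" for v using \<kappa>[OF that] by simp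
  have si: "s i - s' i = 2 * \<tau>" "s j - s' j = - 2 * \<tau>" using dz[OF ij(1)] dz[OF ij(2)] ij(3) by (auto simp: d_def)
  define w where "w = s i + s j"
  have wt: "2 * \<tau> \<le> w" "- (2 * \<tau>) \<le> w"
    using si s(1)[OF ij(1)] s(1)[OF ij(2)] s'(1)[OF ij(1)] s'(1)[OF ij(2)] by (auto simp: w_def)
  \<comment> \<open>The joint weight is split so that half the difference of the shares is
    \<open>\<tau>\<close>; the bounds \<open>wt\<close> make both shares nonnegative.\<close>
  define t where "t v = (if v = i then w / 2 + \<tau> else if v = j then w / 2 - \<tau> else s v)" for v
  show "x \<in> convex hull (steiner a i j ` N)"
  proof (rule convex_hull_familyI[OF N(1)])
    show "0 \<le> t v" if "v \<in> N" for v using s(1)[OF that] wt by (auto simp: t_def)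
    show "sum t N = 1" using s(2) ij(3) unfolding sum_remove2[OF N(1) ij(1-3)] by (simp add: t_def w_def)
    define \<sigma> where "\<sigma> = w / 2 + \<tau> - s i"
    have tij: "t i = s i + \<sigma>" "t j = s j - \<sigma>" using ij(3) by (simp_all add: t_def w_def \<sigma>_def)
    have "(\<Sum>v\<in>N - {i, j}. t v *\<^sub>R a v) = (\<Sum>v\<in>N - {i, j}. s v *\<^sub>R a v)"
      by (intro sum.cong) (auto simp: t_def)
    then have "(\<Sum>v\<in>N. t v *\<^sub>R a v) = (\<Sum>v\<in>N. s v *\<^sub>R a v) + \<sigma> *\<^sub>R e"
      unfolding sum_remove2[OF N(1) ij(1-3)] tij by (simp add: e_def algebra_simps)
    then have "orth_proj e (\<Sum>v\<in>N. t v *\<^sub>R a v) = orth_proj e x"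
      using orth_proj_add_scaleR[OF e0] s(3) by simp
    moreover have "(t i - t j) / 2 = \<tau>" using ij(3) by (simp add: t_def)
    ultimately show "(\<Sum>v\<in>N. t v *\<^sub>R steiner a i j v) = x"
      unfolding steiner_sum[OF N(1) ij(1-3)] e_def[symmetric]
      by (simp add: orth_proj_def \<tau>_def)
  qed
qed

section \<open>Configurations of two classes of points around a ball\<close>

text \<open>Every condition is closed: the hulls of the two classes are merely required to meet,
  which survives limits in which individual coefficients of the affine relation vanish. The value
  \<open>0\<close> off the index set and the bound \<open>M\<close> confine the families to a
  compact product; in the hyperbolic case a bound \<open>M < 1\<close> also keeps limits inside the
  model.\<close>

definition ball_config ::
  "('a \<Rightarrow> ennreal) \<Rightarrow> nat set \<Rightarrow> nat set \<Rightarrow> real \<Rightarrow> real \<Rightarrow> ennreal \<Rightarrow> (nat \<Rightarrow> 'a::euclidean_space) \<Rightarrow> bool" where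
  "ball_config W I J R M V a \<longleftrightarrow> (\<forall>v. v \<notin> I \<union> J \<longrightarrow> a v = 0) \<and> (\<forall>v\<in>I \<union> J. norm (a v) \<le> M) \<and>
     convex hull (a ` I) \<inter> convex hull (a ` J) \<noteq> {} \<and> cball 0 R \<subseteq> convex hull (a ` (I \<union> J)) \<and>
     mass W (convex hull (a ` (I \<union> J))) \<le> V"

lemma ball_config_commute: "ball_config W I J R M V a = ball_config W J I R M V a"
  by (auto simp: ball_config_def Un_commute Int_commute)

text \<open>Projection does not increase norms, which settles all members but \<open>i\<close> and
  \<open>j\<close>. The heights of \<open>a i\<close> and \<open>a j\<close> differ by
  \<open>1\<close>, so one of them is at least \<open>1/2\<close> in absolute value, and that point
  is no closer to \<open>0\<close> than the new ones at heights \<open>1/2\<close> and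
  \<open>-1/2\<close>.\<close>

lemma norm_steiner_le:
  fixes a :: "'i \<Rightarrow> 'a::euclidean_space"
  assumes ne: "a i \<noteq> a j" and M: "norm (a i) \<le> M" "norm (a j) \<le> M" "norm (a v) \<le> M"
  shows "norm (steiner a i j v) \<le> M"
proof -
  define e where "e = a i - a j"
  have e0: "e \<noteq> 0" using ne by (simp add: e_def)
  define \<alpha> where "\<alpha> x = (x \<bullet> e) / (e \<bullet> e)" for x
  have dec: "x = orth_proj e x + \<alpha> x *\<^sub>R e" for x by (simp add: orth_proj_def \<alpha>_def)
  have nrm: "(norm x)\<^sup>2 = (norm (orth_proj e x))\<^sup>2 + (\<alpha> x)\<^sup>2 * (norm e)\<^sup>2" for x
    using norm_orth_proj_add_scaleR[OF e0, of x "\<alpha> x"] dec[of x] by simp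
  have \<alpha>1: "\<alpha> (a i) - \<alpha> (a j) = 1"
  proof -
    have "a i \<bullet> e = e \<bullet> e + a j \<bullet> e" by (simp add: e_def inner_diff_left)
    then show ?thesis using e0 by (simp add: \<alpha>_def add_divide_distrib)
  qed
  have pij: "orth_proj e (a i) = orth_proj e (a j)"
    using orth_proj_add_scaleR[OF e0, of "a j" 1] by (simp add: e_def)
  have M0: "M \<ge> 0" using M(1) norm_ge_zero order_trans by blast
  have half: "(norm (orth_proj e (a i) + s *\<^sub>R e))\<^sup>2 \<le> M\<^sup>2" if s: "s\<^sup>2 = 1/4" for s
  proof -
    have "1/4 \<le> (\<alpha> (a i))\<^sup>2 \<or> 1/4 \<le> (\<alpha> (a j))\<^sup>2"
    proof (rule ccontr)
      assume "\<not> ?thesis"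
      then have "(\<alpha> (a i))\<^sup>2 < (1/2)\<^sup>2" "(\<alpha> (a j))\<^sup>2 < (1/2)\<^sup>2" by (auto simp: power2_eq_square)
      then have "\<bar>\<alpha> (a i)\<bar> < 1/2" "\<bar>\<alpha> (a j)\<bar> < 1/2"
        using power2_less_imp_less[of "\<bar>\<alpha> (a i)\<bar>" "1/2"] power2_less_imp_less[of "\<bar>\<alpha> (a j)\<bar>" "1/2"] by auto
      then show False using \<alpha>1 by linarith
    qed
    then obtain k where k: "k \<in> {i, j}" "1/4 \<le> (\<alpha> (a k))\<^sup>2" by auto
    have "(norm (orth_proj e (a i) + s *\<^sub>R e))\<^sup>2 = (norm (orth_proj e (a k)))\<^sup>2 + 1/4 * (norm e)\<^sup>2"
      using k(1) pij s by (auto simp: norm_orth_proj_add_scaleR[OF e0])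
    also have "\<dots> \<le> (norm (a k))\<^sup>2" unfolding nrm[of "a k"] using k(2) by (intro add_left_mono mult_right_mono) auto
    also have "\<dots> \<le> M\<^sup>2" using k(1) M by (intro power_mono) auto
    finally show ?thesis .
  qed
  have "(norm (steiner a i j v))\<^sup>2 \<le> M\<^sup>2"
  proof (cases "v = i \<or> v = j")
    case True
    have "steiner a i j i = orth_proj e (a i) + (1/2) *\<^sub>R e" by (simp add: steiner_def e_def)
    moreover have "steiner a i j j = orth_proj e (a i) + (-1/2) *\<^sub>R e"
      using ne unfolding pij by (auto simp: steiner_def e_def)
    ultimately show ?thesis using half[of "1/2"] half[of "-1/2"] True
      by (elim disjE) (simp_all add: power2_eq_square)
  next
    case False
    have "(norm (orth_proj e (a v)))\<^sup>2 \<le> (norm (a v))\<^sup>2" unfolding nrm[of "a v"] by simp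
    also have "\<dots> \<le> M\<^sup>2" using M by (intro power_mono) auto
    finally show ?thesis using False by (simp add: steiner_def e_def)
  qed
  then show ?thesis using M0 by (rule power2_le_imp_le)
qed

text \<open>A common point of the two hulls provides an affine relation that is nonnegative on
  \<open>I\<close> and nonpositive on \<open>J\<close>, as \<open>cball_subset_steiner\<close>
  requires for a pair in \<open>I\<close>. The projection of this point is common to the new
  hulls.\<close>

lemma ball_config_steiner:
  fixes a :: "nat \<Rightarrow> 'a::euclidean_space"
  assumes fin: "finite I" "finite J" and disj: "I \<inter> J = {}" and card: "card (I \<union> J) = DIM('a) + 2"
    and R: "R > 0" and W: "W \<in> borel_measurable borel" "\<And>x y. norm x \<le> norm y \<Longrightarrow> W x \<le> W y"
    and cfg: "ball_config W I J R M V a" and ij: "i \<in> I" "j \<in> I" "i \<noteq> j" and ne: "a i \<noteq> a j"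
  shows "ball_config W I J R M V (\<lambda>v. if v \<in> I \<union> J then steiner a i j v else 0)"
proof -
  define N where "N = I \<union> J"
  have N: "finite N" "i \<in> N" "j \<in> N" "card N = DIM('a) + 2" using fin ij card by (auto simp: N_def)
  define b where "b v = (if v \<in> N then steiner a i j v else 0)" for v
  have bim: "b ` S = steiner a i j ` S" if "S \<subseteq> N" for S using that by (intro image_cong) (auto simp: b_def)
  have bI: "b ` I = steiner a i j ` I" "b ` J = steiner a i j ` J" "b ` N = steiner a i j ` N"
    by (auto simp: bim N_def)
  have aM: "norm (a v) \<le> M" if "v \<in> N" for v using cfg that by (auto simp: ball_config_def N_def)
  obtain z where z: "z \<in> convex hull (a ` I)" "z \<in> convex hull (a ` J)" using cfg by (auto simp: ball_config_def)
  obtain l where l: "\<And>v. v \<in> I \<Longrightarrow> 0 \<le> l v" "sum l I = 1" "(\<Sum>v\<in>I. l v *\<^sub>R a v) = z"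
    using z(1) unfolding convex_hull_family[OF fin(1)] by auto
  obtain m where m: "\<And>v. v \<in> J \<Longrightarrow> 0 \<le> m v" "sum m J = 1" "(\<Sum>v\<in>J. m v *\<^sub>R a v) = z"
    using z(2) unfolding convex_hull_family[OF fin(2)] by auto
  define c where "c v = (if v \<in> I then l v else - m v)" for v
  have cJ: "c v = - m v" if "v \<in> J" for v using that disj by (auto simp: c_def)
  have "sum c N = sum c I + sum c J" unfolding N_def using fin disj by (rule sum.union_disjoint)
  moreover have "sum c I = 1" using l(2) by (simp add: c_def)
  moreover have "sum c J = -1" using m(2) cJ by (simp add: sum_negf cong: sum.cong)
  ultimately have c1: "sum c N = 0" by simp
  have "(\<Sum>v\<in>N. c v *\<^sub>R a v) = (\<Sum>v\<in>I. c v *\<^sub>R a v) + (\<Sum>v\<in>J. c v *\<^sub>R a v)"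
    unfolding N_def using fin disj by (rule sum.union_disjoint)
  moreover have "(\<Sum>v\<in>I. c v *\<^sub>R a v) = z" using l(3) by (simp add: c_def)
  moreover have "(\<Sum>v\<in>J. c v *\<^sub>R a v) = - z" using m(3) cJ by (simp add: sum_negf cong: sum.cong)
  ultimately have c2: "(\<Sum>v\<in>N. c v *\<^sub>R a v) = 0" by simp
  have c3: "\<exists>v\<in>N. c v < 0"
  proof (rule ccontr)
    assume "\<not> ?thesis"
    then have "m v = 0" if "v \<in> J" for v using that m(1)[OF that] cJ[OF that] by (force simp: N_def)
    then show False using m(2) by simp
  qed
  have cij: "0 \<le> c i" "0 \<le> c j" using l(1) ij by (auto simp: c_def)
  have ball: "cball 0 R \<subseteq> convex hull (a ` N)" using cfg by (auto simp: ball_config_def N_def)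
  have "cball 0 R \<subseteq> convex hull (b ` N)"
    unfolding bI using cball_subset_steiner[OF N(1,4) R ball c1 c2 c3 N(2,3) ij(3) cij ne] .
  moreover have "mass W (convex hull (b ` N)) \<le> V"
    unfolding bI using nn_integral_steiner_le[OF N(1-3) ij(3) ne W] cfg
    by (auto simp: ball_config_def N_def intro: order_trans)
  moreover have "norm (b v) \<le> M" if "v \<in> N" for v
    using norm_steiner_le[of a i j M, OF ne aM[OF N(2)] aM[OF N(3)] aM[OF that]] that by (simp add: b_def)
  moreover have "convex hull (b ` I) \<inter> convex hull (b ` J) \<noteq> {}"
  proof -
    define e where "e = a i - a j"
    have e0: "e \<noteq> 0" using ne by (simp add: e_def)
    \<comment> \<open>Averaging the weights of \<open>i\<close> and \<open>j\<close> removes the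
      component along \<open>e\<close>, so the symmetrized members of \<open>I\<close> combine to
      exactly the projection of \<open>z\<close>.\<close>
    define l' where "l' v = (if v = i \<or> v = j then (l i + l j) / 2 else l v)" for v
    have "orth_proj e z \<in> convex hull (steiner a i j ` I)"
    proof (rule convex_hull_familyI[OF fin(1)])
      show "0 \<le> l' v" if "v \<in> I" for v using l(1) that ij by (auto simp: l'_def)
      show "sum l' I = 1" using l(2) unfolding sum_remove2[OF fin(1) ij] by (simp add: l'_def)
      have "(\<Sum>v\<in>I. l' v *\<^sub>R a v) = z + ((l j - l i) / 2) *\<^sub>R e"
      proof -
        define \<sigma> where "\<sigma> = (l j - l i) / 2"
        have lij: "l' i = l i + \<sigma>" "l' j = l j - \<sigma>"
          using ij(3) by (simp_all add: l'_def \<sigma>_def field_simps)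
        have "(\<Sum>v\<in>I - {i, j}. l' v *\<^sub>R a v) = (\<Sum>v\<in>I - {i, j}. l v *\<^sub>R a v)"
          by (intro sum.cong) (auto simp: l'_def)
        then have "(\<Sum>v\<in>I. l' v *\<^sub>R a v) = (\<Sum>v\<in>I. l v *\<^sub>R a v) + \<sigma> *\<^sub>R e"
          unfolding sum_remove2[OF fin(1) ij] lij by (simp add: e_def algebra_simps)
        then show ?thesis using l(3) by (simp add: \<sigma>_def)
      qed
      then show "(\<Sum>v\<in>I. l' v *\<^sub>R steiner a i j v) = orth_proj e z"
        unfolding steiner_sum[OF fin(1) ij] e_def[symmetric]
        by (simp add: orth_proj_add_scaleR[OF e0]) (simp add: l'_def)
    qed
    moreover have "orth_proj e z \<in> convex hull (steiner a i j ` J)"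
    proof (rule convex_hull_familyI[OF fin(2) m(1,2)])
      have "(\<Sum>v\<in>J. m v *\<^sub>R steiner a i j v) = (\<Sum>v\<in>J. m v *\<^sub>R orth_proj e (a v))"
        using disj ij by (intro sum.cong) (auto simp: steiner_def e_def)
      also have "\<dots> = orth_proj e (\<Sum>v\<in>J. m v *\<^sub>R a v)"
        by (simp add: linear_sum[OF linear_orth_proj] linear_scale[OF linear_orth_proj])
      finally show "(\<Sum>v\<in>J. m v *\<^sub>R steiner a i j v) = orth_proj e z" by (simp add: m(3))
    qed
    ultimately show ?thesis unfolding bI by blast
  qed
  ultimately have "ball_config W I J R M V b"
    unfolding ball_config_def N_def[symmetric] by (auto simp: b_def)
  then show ?thesis by (simp only: b_def[abs_def] N_def)
qed

text \<open>Only the heights \<open>\<alpha> v\<close> along \<open>e\<close> change. Their squares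
  sum to \<open>1/2\<close> afterwards, and before to
  \<open>1/2 + (\<alpha> i + \<alpha> j)\<^sup>2 / 2\<close> plus the squares of the other heights,
  because \<open>\<alpha> i - \<alpha> j = 1\<close>. No decrease therefore means
  \<open>\<alpha> i = - \<alpha> j\<close> and height \<open>0\<close> elsewhere.\<close>

lemma steiner_sum_norm:
  fixes a :: "'i \<Rightarrow> 'a::euclidean_space"
  assumes N: "finite N" "i \<in> N" "j \<in> N" "i \<noteq> j" and ne: "a i \<noteq> a j"
    and le: "(\<Sum>v\<in>N. (norm (a v))\<^sup>2) \<le> (\<Sum>v\<in>N. (norm (steiner a i j v))\<^sup>2)"
  shows "norm (a i) = norm (a j)" "\<And>v. v \<in> N \<Longrightarrow> v \<noteq> i \<Longrightarrow> v \<noteq> j \<Longrightarrow> (a i - a j) \<bullet> a v = 0"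
proof -
  define e where "e = a i - a j"
  have e0: "e \<noteq> 0" using ne by (simp add: e_def)
  define \<alpha> where "\<alpha> v = (a v \<bullet> e) / (e \<bullet> e)" for v
  define s where "s v = (if v = i then 1/2 else if v = j then - 1/2 else 0::real)" for v
  have nrm: "(norm (a v))\<^sup>2 = (norm (orth_proj e (a v)))\<^sup>2 + (\<alpha> v)\<^sup>2 * (norm e)\<^sup>2" for v
    using norm_orth_proj_add_scaleR[OF e0, of "a v" "\<alpha> v"] by (simp add: orth_proj_def \<alpha>_def)
  have nrm': "(norm (steiner a i j v))\<^sup>2 = (norm (orth_proj e (a v)))\<^sup>2 + (s v)\<^sup>2 * (norm e)\<^sup>2" for v
    using norm_orth_proj_add_scaleR[OF e0, of "a v" "s v"] by (simp add: steiner_def s_def e_def)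
  have \<alpha>1: "\<alpha> i = 1 + \<alpha> j"
  proof -
    have "a i \<bullet> e = e \<bullet> e + a j \<bullet> e" by (simp add: e_def inner_diff_left)
    then show ?thesis using e0 by (simp add: \<alpha>_def add_divide_distrib)
  qed
  have "(\<Sum>v\<in>N. (\<alpha> v)\<^sup>2) * (norm e)\<^sup>2 \<le> (\<Sum>v\<in>N. (s v)\<^sup>2) * (norm e)\<^sup>2"
    using le by (simp add: nrm nrm' sum.distrib sum_distrib_right)
  then have "(\<Sum>v\<in>N. (\<alpha> v)\<^sup>2) \<le> (\<Sum>v\<in>N. (s v)\<^sup>2)" using e0 by simp
  also have "(\<Sum>v\<in>N. (s v)\<^sup>2) = 1/2"
    unfolding sum_remove2[OF N] using N(4) by (simp add: s_def power2_eq_square)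
  also have "(\<Sum>v\<in>N. (\<alpha> v)\<^sup>2) = 1/2 + (\<alpha> i + \<alpha> j)\<^sup>2 / 2 + (\<Sum>v\<in>N - {i, j}. (\<alpha> v)\<^sup>2)"
    unfolding sum_remove2[OF N] \<alpha>1 by (simp add: power2_eq_square field_simps)
  finally have "(\<alpha> i + \<alpha> j)\<^sup>2 / 2 + (\<Sum>v\<in>N - {i, j}. (\<alpha> v)\<^sup>2) \<le> 0" by simp
  moreover have "(\<alpha> i + \<alpha> j)\<^sup>2 \<ge> 0" "(\<Sum>v\<in>N - {i, j}. (\<alpha> v)\<^sup>2) \<ge> 0" by (auto intro: sum_nonneg)
  ultimately have z: "(\<alpha> i + \<alpha> j)\<^sup>2 = 0" "(\<Sum>v\<in>N - {i, j}. (\<alpha> v)\<^sup>2) = 0" by linarith+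
  have "\<alpha> i = - \<alpha> j" using z(1) by simp
  then have "(\<alpha> i)\<^sup>2 = (\<alpha> j)\<^sup>2" by simp
  moreover have "orth_proj e (a i) = orth_proj e (a j)"
    using orth_proj_add_scaleR[OF e0, of "a j" 1] by (simp add: e_def)
  ultimately have "(norm (a i))\<^sup>2 = (norm (a j))\<^sup>2" unfolding nrm by simp
  then show "norm (a i) = norm (a j)" by simp
  show "(a i - a j) \<bullet> a v = 0" if "v \<in> N" "v \<noteq> i" "v \<noteq> j" for v
  proof -
    have "(\<alpha> v)\<^sup>2 = 0" using z(2) N(1) that by (subst (asm) sum_nonneg_eq_0_iff) auto
    then have "a v \<bullet> e = 0" using e0 by (simp add: \<alpha>_def)
    then show ?thesis by (simp add: e_def inner_commute)
  qed
qed

section \<open>Fixed points of all symmetrizations\<close>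

text \<open>If the limit point were outside, a hyperplane would separate it strictly from the limit
  vertices, hence from all late vertices and their hulls.\<close>

lemma convex_hull_family_limit:
  fixes a :: "nat \<Rightarrow> 'i \<Rightarrow> 'a::euclidean_space"
  assumes N: "finite N" and lim: "\<And>v. v \<in> N \<Longrightarrow> (\<lambda>n. a n v) \<longlonglongrightarrow> l v"
    and x: "\<And>n. x n \<in> convex hull (a n ` N)" "x \<longlonglongrightarrow> y"
  shows "y \<in> convex hull (l ` N)"
proof (rule ccontr)
  assume y: "y \<notin> convex hull (l ` N)"
  have "closed (convex hull (l ` N))" using compact_convex_hull_family[OF N] by (rule compact_imp_closed)
  then obtain u b where u: "u \<bullet> y < b" "\<And>z. z \<in> convex hull (l ` N) \<Longrightarrow> b < u \<bullet> z"
    using separating_hyperplane_closed_point[OF convex_convex_hull _ y] by blast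
  have "\<forall>v\<in>N. eventually (\<lambda>n. b < u \<bullet> a n v) sequentially"
  proof
    fix v assume v: "v \<in> N"
    have "(\<lambda>n. u \<bullet> a n v) \<longlonglongrightarrow> u \<bullet> l v" by (intro tendsto_inner tendsto_const lim v)
    moreover have "b < u \<bullet> l v" using u(2) v by (simp add: hull_inc)
    ultimately show "eventually (\<lambda>n. b < u \<bullet> a n v) sequentially" by (rule order_tendstoD)
  qed
  then have "eventually (\<lambda>n. \<forall>v\<in>N. b < u \<bullet> a n v) sequentially" using N by (simp add: eventually_ball_finite)
  then have "eventually (\<lambda>n. b \<le> u \<bullet> x n) sequentially"
  proof eventually_elim
    fix n assume "\<forall>v\<in>N. b < u \<bullet> a n v"
    then have "a n ` N \<subseteq> {z. b \<le> u \<bullet> z}" by force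
    then have "convex hull (a n ` N) \<subseteq> {z. b \<le> u \<bullet> z}"
      by (intro hull_minimal) (simp_all add: convex_halfspace_ge)
    then show "b \<le> u \<bullet> x n" using x(1)[of n] by auto
  qed
  moreover have "(\<lambda>n. u \<bullet> x n) \<longlonglongrightarrow> u \<bullet> y" by (intro tendsto_inner tendsto_const x)
  ultimately have "b \<le> u \<bullet> y" by (intro tendsto_lowerbound) auto
  then show False using u(1) by simp
qed

text \<open>If infinitely many hulls missed \<open>x\<close>, unit normals separating
  \<open>x\<close> from them would accumulate at some \<open>w\<close>, and \<open>w\<close> would
  support the limit hull at \<open>x\<close>, which is impossible at an interior point.\<close>

lemma eventually_in_convex_hull_family:
  fixes a :: "nat \<Rightarrow> 'i \<Rightarrow> 'a::euclidean_space"
  assumes N: "finite N" and lim: "\<And>v. v \<in> N \<Longrightarrow> (\<lambda>n. a n v) \<longlonglongrightarrow> l v"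
    and x: "x \<in> interior (convex hull (l ` N))"
  shows "eventually (\<lambda>n. x \<in> convex hull (a n ` N)) sequentially"
proof (rule ccontr)
  assume "\<not> ?thesis"
  from not_eventually_sequentiallyD[OF this]
  obtain r :: "nat \<Rightarrow> nat" where r: "strict_mono r" "\<And>n. x \<notin> convex hull (a (r n) ` N)"
    by auto
  have "\<exists>u. norm u = 1 \<and> (\<forall>v\<in>N. u \<bullet> x \<le> u \<bullet> a (r n) v)" for n
  proof -
    have "closed (convex hull (a (r n) ` N))" using compact_convex_hull_family[OF N] by (rule compact_imp_closed)
    then obtain u b where u: "u \<bullet> x < b" "\<And>z. z \<in> convex hull (a (r n) ` N) \<Longrightarrow> b < u \<bullet> z"
      using separating_hyperplane_closed_point[OF convex_convex_hull _ r(2)] by blast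
    have uv: "u \<bullet> x < u \<bullet> a (r n) v" if "v \<in> N" for v using u(1) u(2)[OF hull_inc] that by fastforce
    have "N \<noteq> {}" using x by auto
    then obtain v where "v \<in> N" by auto
    then have "u \<noteq> 0" using uv[of v] by auto
    then show ?thesis using uv
      by (intro exI[of _ "u /\<^sub>R norm u"]) (auto simp: less_imp_le mult_left_mono)
  qed
  then have "\<forall>n. \<exists>u. norm u = 1 \<and> (\<forall>v\<in>N. u \<bullet> x \<le> u \<bullet> a (r n) v)" by blast
  from choice[OF this] obtain u where u: "\<And>n. norm (u n) = 1" "\<And>n v. v \<in> N \<Longrightarrow> u n \<bullet> x \<le> u n \<bullet> a (r n) v"
    by blast
  have "\<forall>n. u n \<in> sphere 0 1" using u(1) by simp
  then obtain w q where w: "w \<in> sphere 0 1" "strict_mono q" "(u \<circ> q) \<longlonglongrightarrow> w"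
    using seq_compactE[OF compact_imp_seq_compact[OF compact_sphere[of "0::'a" 1]], of u] by blast
  have "w \<bullet> x \<le> w \<bullet> l v" if v: "v \<in> N" for v
  proof (rule LIMSEQ_le)
    show "(\<lambda>n. (u \<circ> q) n \<bullet> x) \<longlonglongrightarrow> w \<bullet> x" by (intro tendsto_inner tendsto_const w)
    have "((\<lambda>n. a n v) \<circ> (r \<circ> q)) \<longlonglongrightarrow> l v"
      using lim[OF v] by (rule LIMSEQ_subseq_LIMSEQ) (intro strict_mono_o r w)
    then show "(\<lambda>n. (u \<circ> q) n \<bullet> a (r (q n)) v) \<longlonglongrightarrow> w \<bullet> l v"
      by (intro tendsto_inner w) (simp add: o_def)
    show "\<exists>M. \<forall>n\<ge>M. (u \<circ> q) n \<bullet> x \<le> (u \<circ> q) n \<bullet> a (r (q n)) v" using u(2) v by auto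
  qed
  then have "l ` N \<subseteq> {z. w \<bullet> x \<le> w \<bullet> z}" by auto
  then have sub: "convex hull (l ` N) \<subseteq> {z. w \<bullet> x \<le> w \<bullet> z}"
    by (intro hull_minimal) (simp_all add: convex_halfspace_ge)
  obtain d where d: "d > 0" "cball x d \<subseteq> convex hull (l ` N)"
    using x unfolding mem_interior_cball by blast
  have "x - d *\<^sub>R w \<in> cball x d" using d(1) w(1) by (simp add: dist_norm)
  then have "x - d *\<^sub>R w \<in> {z. w \<bullet> x \<le> w \<bullet> z}" using d(2) sub by blast
  then have "w \<bullet> x \<le> w \<bullet> (x - d *\<^sub>R w)" by simp
  then show False using d(1) w(1) by (simp add: inner_diff_right norm_eq_1)
qed

lemma AE_notin_convex_frontier:
  fixes S :: "'a::euclidean_space set"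
  assumes "convex S" shows "AE x in lborel. x \<notin> frontier S"
proof -
  have "frontier S \<in> null_sets lebesgue"
    using negligible_convex_frontier[OF assms] by (simp add: negligible_iff_null_sets)
  then have "frontier S \<in> null_sets lborel" by (simp add: null_sets_completion_iff)
  then show ?thesis by (rule AE_not_in)
qed

text \<open>Fatou's lemma: the frontier of a convex set is null, so almost every point of the limit
  hull is interior and lies in all late hulls. Only lower semicontinuity is claimed, and it holds
  even where the density is infinite.\<close>

lemma nn_integral_convex_hull_family_limit_le:
  fixes a :: "nat \<Rightarrow> 'i \<Rightarrow> 'a::euclidean_space"
  assumes N: "finite N" and lim: "\<And>v. v \<in> N \<Longrightarrow> (\<lambda>n. a n v) \<longlonglongrightarrow> l v"
    and W[measurable]: "W \<in> borel_measurable borel"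
    and V: "\<And>n. mass W (convex hull (a n ` N)) \<le> V"
  shows "mass W (convex hull (l ` N)) \<le> V"
proof -
  define P where "P n = convex hull (a n ` N)" for n
  define Q where "Q = convex hull (l ` N)"
  have cP: "compact (P n)" for n unfolding P_def by (rule compact_convex_hull_family[OF N])
  have [measurable]: "P n \<in> sets borel" for n using cP by (rule borel_compact)
  have cQ: "closed Q" unfolding Q_def by (intro compact_imp_closed compact_convex_hull_family N)
  have ae: "AE x in lborel. x \<notin> frontier Q"
    unfolding Q_def by (intro AE_notin_convex_frontier convex_convex_hull)
  have "mass W Q
      \<le> (\<integral>\<^sup>+x. liminf (\<lambda>n. W x * indicator (P n) x) \<partial>lborel)"
  proof (rule nn_integral_mono_AE)
    show "AE x in lborel. W x * indicator Q x \<le> liminf (\<lambda>n. W x * indicator (P n) x)"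
      using ae
    proof eventually_elim
      fix x assume x: "x \<notin> frontier Q"
      show "W x * indicator Q x \<le> liminf (\<lambda>n. W x * indicator (P n) x)"
      proof (cases "x \<in> Q")
        case True
        then have "x \<in> interior Q" using x cQ by (simp add: frontier_def)
        then have "eventually (\<lambda>n. x \<in> P n) sequentially"
          unfolding P_def Q_def by (auto intro!: eventually_in_convex_hull_family[OF N] lim)
        then have "eventually (\<lambda>n. W x * indicator Q x \<le> W x * indicator (P n) x) sequentially"
          by eventually_elim (simp add: True)
        then show ?thesis by (rule Liminf_bounded)
      qed simp
    qed
  qed
  also have "\<dots> \<le> liminf (\<lambda>n. \<integral>\<^sup>+x. W x * indicator (P n) x \<partial>lborel)"
    by (rule nn_integral_liminf) measurable
  also have "\<dots> \<le> V"
    using V unfolding P_def[symmetric] by (intro Liminf_le always_eventually allI) auto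
  finally show ?thesis by (simp add: Q_def)
qed

lemma tendsto_fun_apply:
  fixes a :: "nat \<Rightarrow> 'i \<Rightarrow> 'a::topological_space"
  assumes "a \<longlonglongrightarrow> l" shows "(\<lambda>n. a n v) \<longlonglongrightarrow> l v"
  using continuous_on_tendsto_compose[OF continuous_on_product_coordinates[of v] assms] by simp

text \<open>Closedness is checked along sequences, condition by condition. For the meeting hulls,
  common points are bounded by \<open>M\<close>, and a limit of a subsequence of them is common to
  the limit hulls.\<close>

lemma compact_ball_config:
  fixes W :: "'a::euclidean_space \<Rightarrow> ennreal"
  assumes fin: "finite I" "finite J" and W: "W \<in> borel_measurable borel"
  shows "compact {a. ball_config W I J R M V a}" (is "compact ?K")
proof -
  \<comment> \<open>Coordinates outside the index set are confined to a single point, so Tychonoff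
    applies to the product over all natural numbers.\<close>
  define S where "S v = (if v \<in> I \<union> J then cball 0 M else {0::'a})" for v
  have "compactin (product_topology (\<lambda>i. euclidean) UNIV) (Pi\<^sub>E UNIV S)"
    unfolding compactin_PiE by (auto simp: S_def)
  then have C: "compact (Pi\<^sub>E UNIV S)" by (simp add: euclidean_product_topology)
  have sub: "?K \<subseteq> Pi\<^sub>E UNIV S" by (auto simp: ball_config_def S_def PiE_def Pi_def)
  have "closed ?K"
    unfolding closed_sequential_limits
  proof clarify
    fix a l assume "\<forall>n. a n \<in> ?K" and l: "a \<longlonglongrightarrow> l"
    then have a: "\<And>n. ball_config W I J R M V (a n)" by auto
    have lv: "(\<lambda>n. a n v) \<longlonglongrightarrow> l v" for v using l by (rule tendsto_fun_apply)
    have fN: "finite (I \<union> J)" using fin by simp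
    have "l v = 0" if "v \<notin> I \<union> J" for v
      using lv[of v] a that by (simp add: ball_config_def LIMSEQ_const_iff)
    moreover have "norm (l v) \<le> M" if "v \<in> I \<union> J" for v
      by (rule LIMSEQ_le_const2[OF tendsto_norm[OF lv[of v]]]) (use a that in \<open>auto simp: ball_config_def\<close>)
    moreover have "cball 0 R \<subseteq> convex hull (l ` (I \<union> J))"
    proof
      fix x :: 'a assume "x \<in> cball 0 R"
      then have "x \<in> convex hull (a n ` (I \<union> J))" for n using a[of n] by (auto simp: ball_config_def)
      then show "x \<in> convex hull (l ` (I \<union> J))"
        by (rule convex_hull_family_limit[OF fN lv _ tendsto_const])
    qed
    moreover have "mass W (convex hull (l ` (I \<union> J))) \<le> V"
      by (rule nn_integral_convex_hull_family_limit_le[OF fN lv W]) (use a in \<open>auto simp: ball_config_def\<close>)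
    moreover have "convex hull (l ` I) \<inter> convex hull (l ` J) \<noteq> {}"
    proof -
      have "\<exists>z. z \<in> convex hull (a n ` I) \<and> z \<in> convex hull (a n ` J)" for n
        using a[of n] by (auto simp: ball_config_def)
      then have "\<forall>n. \<exists>z. z \<in> convex hull (a n ` I) \<and> z \<in> convex hull (a n ` J)" by blast
      from choice[OF this] obtain z where z: "\<And>n. z n \<in> convex hull (a n ` I)" "\<And>n. z n \<in> convex hull (a n ` J)"
        by blast
      have zM: "z n \<in> cball 0 M" for n
      proof -
        have "convex hull (a n ` I) \<subseteq> cball 0 M"
          using a[of n] by (intro hull_minimal) (auto simp: ball_config_def)
        then show ?thesis using z(1) by blast
      qed
      obtain y q where y: "strict_mono q" "(z \<circ> q) \<longlonglongrightarrow> y"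
        using seq_compactE[OF compact_imp_seq_compact[OF compact_cball[of "0::'a" M]], of z] zM by blast
      have lq: "(\<lambda>n. a (q n) v) \<longlonglongrightarrow> l v" for v
        using LIMSEQ_subseq_LIMSEQ[OF lv y(1)] by (simp add: o_def)
      have "y \<in> convex hull (l ` I)"
        by (rule convex_hull_family_limit[OF fin(1) lq _ y(2)]) (simp add: z)
      moreover have "y \<in> convex hull (l ` J)"
        by (rule convex_hull_family_limit[OF fin(2) lq _ y(2)]) (simp add: z)
      ultimately show ?thesis by blast
    qed
    ultimately show "ball_config W I J R M V l" by (simp add: ball_config_def)
  qed
  then show ?thesis using C sub by (metis compact_Int_closed inf.absorb_iff2 inf_commute)
qed

text \<open>The configuration of least moment of inertia is a fixed point of all symmetrizations.\<close>

lemma exists_symmetric_ball_config: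
  fixes W :: "'a::euclidean_space \<Rightarrow> ennreal"
  assumes fin: "finite I" "finite J" and disj: "I \<inter> J = {}" and card: "card (I \<union> J) = DIM('a) + 2"
    and R: "R > 0" and W: "W \<in> borel_measurable borel" "\<And>x y. norm x \<le> norm y \<Longrightarrow> W x \<le> W y"
    and cfg: "ball_config W I J R M V a0"
  shows "\<exists>a. ball_config W I J R M V a \<and>
    (\<forall>i j. i \<in> I \<and> j \<in> I \<or> i \<in> J \<and> j \<in> J \<longrightarrow>
      norm (a i) = norm (a j) \<and> (\<forall>v\<in>I \<union> J. v \<noteq> i \<longrightarrow> v \<noteq> j \<longrightarrow> a i \<bullet> a v = a j \<bullet> a v))"
proof -
  define \<Phi> where "\<Phi> a = (\<Sum>v\<in>I \<union> J. (norm (a v))\<^sup>2)" for a :: "nat \<Rightarrow> 'a"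
  define K where "K = {a. ball_config W I J R M V a}"
  have "compact K" unfolding K_def by (rule compact_ball_config[OF fin W(1)])
  moreover have "K \<noteq> {}" using cfg by (auto simp: K_def)
  moreover have "continuous_on K \<Phi>"
  proof -
    have "continuous_on K (\<lambda>a. a v)" for v
      by (rule continuous_on_subset[OF continuous_on_product_coordinates]) simp
    then show ?thesis
      unfolding \<Phi>_def by (intro continuous_on_sum continuous_on_power continuous_on_norm)
  qed
  ultimately obtain a where a: "a \<in> K" "\<And>b. b \<in> K \<Longrightarrow> \<Phi> a \<le> \<Phi> b"
    using continuous_attains_inf[of K \<Phi>] by blast
  have cfga: "ball_config W I J R M V a" using a(1) by (simp add: K_def)
  have key: "norm (a i) = norm (a j) \<and> (\<forall>v\<in>I \<union> J. v \<noteq> i \<longrightarrow> v \<noteq> j \<longrightarrow> a i \<bullet> a v = a j \<bullet> a v)"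
    if ij: "i \<in> I \<and> j \<in> I \<or> i \<in> J \<and> j \<in> J" for i j
  proof (cases "a i = a j")
    case False
    then have ne: "i \<noteq> j" by auto
    define b where "b v = (if v \<in> I \<union> J then steiner a i j v else 0)" for v
    have "ball_config W I J R M V b"
      using ij
    proof
      assume "i \<in> I \<and> j \<in> I"
      then show ?thesis
        using ball_config_steiner[OF fin disj card R W cfga _ _ ne False] by (simp only: b_def[abs_def])
    next
      assume "i \<in> J \<and> j \<in> J"
      moreover have "ball_config W J I R M V a" using cfga by (simp add: ball_config_commute)
      ultimately have "ball_config W J I R M V (\<lambda>v. if v \<in> J \<union> I then steiner a i j v else 0)"
        using ball_config_steiner[OF fin(2,1) _ _ R W _ _ _ ne False] disj card
        by (simp add: Int_commute Un_commute)
      then show ?thesis by (simp only: b_def[abs_def] ball_config_commute[of W I J] Un_commute[of I J])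
    qed
    then have "\<Phi> a \<le> \<Phi> b" using a(2) by (simp add: K_def)
    have le: "(\<Sum>v\<in>I \<union> J. (norm (a v))\<^sup>2) \<le> (\<Sum>v\<in>I \<union> J. (norm (steiner a i j v))\<^sup>2)"
    proof -
      have "\<Phi> b = (\<Sum>v\<in>I \<union> J. (norm (steiner a i j v))\<^sup>2)"
        unfolding \<Phi>_def by (rule sum.cong) (auto simp: b_def)
      then show ?thesis using \<open>\<Phi> a \<le> \<Phi> b\<close> by (simp add: \<Phi>_def)
    qed
    have ijN: "finite (I \<union> J)" "i \<in> I \<union> J" "j \<in> I \<union> J" using ij fin by auto
    show ?thesis
      using steiner_sum_norm[OF ijN ne False le] by (auto simp: inner_diff_left)
  qed simp
  show ?thesis
    by (rule exI[of _ a], intro conjI cfga allI impI) (use key in blast)+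
qed

section \<open>Gram matrices of the fixed configurations\<close>

text \<open>A regular simplex with circumcentre \<open>0\<close> and squared circumradius
  \<open>\<alpha>\<close>, encoded by its Gram matrix. The off-diagonal value is the one compatible
  with vanishing vertex sum.\<close>

definition centred_simplex :: "'i set \<Rightarrow> ('i \<Rightarrow> 'a::euclidean_space) \<Rightarrow> real \<Rightarrow> bool" where
  "centred_simplex I a \<alpha> \<longleftrightarrow> finite I \<and> card I \<ge> 2 \<and> \<alpha> > 0 \<and> (\<Sum>i\<in>I. a i) = 0 \<and>
     (\<forall>i\<in>I. a i \<bullet> a i = \<alpha>) \<and> (\<forall>i\<in>I. \<forall>j\<in>I. i \<noteq> j \<longrightarrow> a i \<bullet> a j = - \<alpha> / (real (card I) - 1))"

definition cross_config ::
  "'i set \<Rightarrow> 'j set \<Rightarrow> ('i \<Rightarrow> 'a::euclidean_space) \<Rightarrow> ('j \<Rightarrow> 'a) \<Rightarrow> real \<Rightarrow> real \<Rightarrow> bool" where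
  "cross_config I J a b \<alpha> \<gamma> \<longleftrightarrow> centred_simplex I a \<alpha> \<and> centred_simplex J b \<gamma> \<and>
     card I + card J = DIM('a) + 2 \<and> (\<forall>i\<in>I. \<forall>j\<in>J. a i \<bullet> b j = 0)"

text \<open>By symmetry the inner product with the sum \<open>S\<close> is constant on each class.
  The common point of the two hulls makes the two constants equal, and a functional constant on all
  the points vanishes because of the ball.\<close>

lemma symmetric_ball_config_sum_zero:
  fixes a :: "nat \<Rightarrow> 'a::euclidean_space"
  assumes fin: "finite I" "finite J" and disj: "I \<inter> J = {}" and R: "R > 0"
    and cfg: "ball_config W I J R M V a"
    and nrm: "\<And>i j. i \<in> I \<Longrightarrow> j \<in> I \<Longrightarrow> norm (a i) = norm (a j)"
    and orth: "\<And>i j v. i \<in> I \<and> j \<in> I \<or> i \<in> J \<and> j \<in> J \<Longrightarrow> v \<in> I \<union> J \<Longrightarrow> v \<noteq> i \<Longrightarrow> v \<noteq> j \<Longrightarrow> a i \<bullet> a v = a j \<bullet> a v"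
  shows "(\<Sum>i\<in>I. a i) = 0"
proof -
  define S where "S = (\<Sum>i\<in>I. a i)"
  have "convex hull (a ` I) \<inter> convex hull (a ` J) \<noteq> {}" using cfg by (simp add: ball_config_def)
  then obtain z where z: "z \<in> convex hull (a ` I)" "z \<in> convex hull (a ` J)"
    by (metis disjoint_iff)
  have const: "S \<bullet> z = c" if "z \<in> convex hull (a ` L)" "\<And>i. i \<in> L \<Longrightarrow> S \<bullet> a i = c" for L c
  proof -
    have "a ` L \<subseteq> {x. S \<bullet> x = c}" using that(2) by auto
    then have "convex hull (a ` L) \<subseteq> {x. S \<bullet> x = c}" by (intro hull_minimal convex_hyperplane)
    then show ?thesis using that(1) by auto
  qed
  have cI: "S \<bullet> a i = S \<bullet> a j" if ij: "i \<in> I" "j \<in> I" for i j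
  proof (cases "i = j")
    case False
    have "(\<Sum>v\<in>I - {i, j}. a v \<bullet> a i) = (\<Sum>v\<in>I - {i, j}. a v \<bullet> a j)"
    proof (intro sum.cong refl)
      fix v assume "v \<in> I - {i, j}"
      then have "a i \<bullet> a v = a j \<bullet> a v" using ij by (intro orth) auto
      then show "a v \<bullet> a i = a v \<bullet> a j" by (simp add: inner_commute)
    qed
    moreover have "a i \<bullet> a i = a j \<bullet> a j" using nrm[OF ij] by (simp add: norm_eq)
    moreover have "S \<bullet> x = a i \<bullet> x + a j \<bullet> x + (\<Sum>v\<in>I - {i, j}. a v \<bullet> x)" for x
      unfolding S_def sum_remove2[OF fin(1) ij False] by (simp add: inner_add_left inner_sum_left)
    ultimately show ?thesis by (simp add: inner_commute[of "a j" "a i"])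
  qed simp
  have cJ: "S \<bullet> a i = S \<bullet> a j" if ij: "i \<in> J" "j \<in> J" for i j
    unfolding S_def inner_sum_left
  proof (intro sum.cong refl)
    fix v assume "v \<in> I"
    then have "a i \<bullet> a v = a j \<bullet> a v" using ij disj by (intro orth) auto
    then show "a v \<bullet> a i = a v \<bullet> a j" by (simp add: inner_commute)
  qed
  have "I \<noteq> {}" "J \<noteq> {}" using z by auto
  then obtain i0 j0 where i0: "i0 \<in> I" "j0 \<in> J" by auto
  have "S \<bullet> a i0 = S \<bullet> a j0"
    using const[OF z(1) cI[OF _ i0(1)]] const[OF z(2) cJ[OF _ i0(2)]] by simp
  then have *: "S \<bullet> a v = S \<bullet> a i0" if "v \<in> I \<union> J" for v
    using cI[of v i0] cJ[of v j0] that i0 by (metis UnE)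
  have "cball 0 R \<subseteq> convex hull (a ` (I \<union> J))" using cfg by (simp add: ball_config_def)
  then have "S = 0" using * by (rule const_inner_on_cball_imp_zero(1)[OF R, of a "I \<union> J"])
  then show ?thesis by (simp add: S_def)
qed

text \<open>Pairing the vanishing sum of the class \<open>I\<close> with a member of
  \<open>I\<close> determines the off-diagonal Gram entries, and pairing it with a member of
  \<open>J\<close> gives orthogonality. Were \<open>\<alpha>\<close> zero, \<open>I\<close> would
  collapse to \<open>0\<close>; the at most \<open>d\<close> points of \<open>J\<close> lie in a
  hyperplane, which passes through the common point \<open>0\<close>, so everything would lie in
  it.\<close>

lemma symmetric_ball_config_centred:
  fixes a :: "nat \<Rightarrow> 'a::euclidean_space"
  assumes fin: "finite I" "finite J" and disj: "I \<inter> J = {}" and R: "R > 0"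
    and cI: "card I \<ge> 2" and cJ: "card J \<le> DIM('a)"
    and cfg: "ball_config W I J R M V a"
    and nrm: "\<And>i j. i \<in> I \<Longrightarrow> j \<in> I \<Longrightarrow> norm (a i) = norm (a j)"
    and orth: "\<And>i j v. i \<in> I \<and> j \<in> I \<or> i \<in> J \<and> j \<in> J \<Longrightarrow> v \<in> I \<union> J \<Longrightarrow> v \<noteq> i \<Longrightarrow> v \<noteq> j \<Longrightarrow> a i \<bullet> a v = a j \<bullet> a v"
  shows "\<exists>\<alpha>. centred_simplex I a \<alpha>" "\<And>i j. i \<in> I \<Longrightarrow> j \<in> J \<Longrightarrow> a i \<bullet> a j = 0"
proof -
  have S: "(\<Sum>i\<in>I. a i) = 0"
    by (rule symmetric_ball_config_sum_zero[OF fin disj R cfg nrm orth])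
  have "I \<noteq> {}" using cI by auto
  then obtain i0 where i0: "i0 \<in> I" by auto
  define \<alpha> where "\<alpha> = a i0 \<bullet> a i0"
  have eq: "a i \<bullet> a i = \<alpha>" if "i \<in> I" for i using nrm[OF that i0] by (simp add: \<alpha>_def norm_eq)
  have cross: "a i \<bullet> a j = - \<alpha> / (real (card I) - 1)" if ij: "i \<in> I" "j \<in> I" "i \<noteq> j" for i j
  proof -
    have "0 = (\<Sum>v\<in>I. a v \<bullet> a j)" using S by (metis inner_sum_left inner_zero_left)
    also have "\<dots> = \<alpha> + (\<Sum>v\<in>I - {j}. a v \<bullet> a j)" using fin ij by (simp add: sum.remove[of I j] eq)
    also have "(\<Sum>v\<in>I - {j}. a v \<bullet> a j) = (\<Sum>v\<in>I - {j}. a i \<bullet> a j)"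
      using ij by (intro sum.cong refl orth) auto
    also have "\<dots> = (real (card I) - 1) * (a i \<bullet> a j)" using fin ij cI by (simp add: of_nat_diff)
    finally show ?thesis using cI by (simp add: field_simps)
  qed
  show perp: "a i \<bullet> a j = 0" if ij: "i \<in> I" "j \<in> J" for i j
  proof -
    have "0 = (\<Sum>v\<in>I. a v \<bullet> a j)" using S by (metis inner_sum_left inner_zero_left)
    also have "\<dots> = (\<Sum>v\<in>I. a i \<bullet> a j)" using ij disj by (intro sum.cong refl orth) auto
    also have "\<dots> = real (card I) * (a i \<bullet> a j)" by simp
    finally show ?thesis using cI by simp
  qed
  have "\<alpha> \<noteq> 0"
  proof
    assume "\<alpha> = 0"
    then have aI: "a i = 0" if "i \<in> I" for i using eq[OF that] by simp
    obtain u c where u: "u \<noteq> 0" "\<And>v. v \<in> J \<Longrightarrow> u \<bullet> a v = c" using exists_const_inner[OF fin(2) cJ] by blast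
    have "convex hull (a ` I) \<inter> convex hull (a ` J) \<noteq> {}" using cfg by (simp add: ball_config_def)
  then obtain z where z: "z \<in> convex hull (a ` I)" "z \<in> convex hull (a ` J)" by blast
    have "convex hull (a ` I) \<subseteq> {x. u \<bullet> x = 0}"
      by (intro hull_minimal convex_hyperplane) (auto simp: aI)
    moreover have "convex hull (a ` J) \<subseteq> {x. u \<bullet> x = c}"
      by (intro hull_minimal convex_hyperplane) (auto simp: u)
    ultimately have "c = 0" using z by auto
    then have "u \<bullet> a v = 0" if "v \<in> I \<union> J" for v using that u(2) aI by auto
    moreover have "cball 0 R \<subseteq> convex hull (a ` (I \<union> J))" using cfg by (simp add: ball_config_def)
    ultimately show False using const_inner_on_cball_imp_zero(1)[OF R, of a "I \<union> J" u 0] u(1) by blast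
  qed
  moreover have "\<alpha> \<ge> 0" by (simp add: \<alpha>_def)
  ultimately have "\<alpha> > 0" by simp
  then show "\<exists>\<alpha>. centred_simplex I a \<alpha>"
    using fin cI S eq cross by (intro exI[of _ \<alpha>]) (simp add: centred_simplex_def)
qed

section \<open>From a polytope to an initial configuration\<close>

text \<open>A generating set \<open>E\<close> of least cardinality is either smaller than
  \<open>d + 2\<close>, and then a repeated point placed in both classes makes the hulls meet, or it
  has \<open>d + 2\<close> points, and Radon's theorem provides the classes.\<close>

lemma exists_ball_config:
  fixes A :: "'a::euclidean_space set"
  assumes d: "DIM('a) \<ge> 2" and A: "finite A" "card A \<le> DIM('a) + 2" "\<And>x. x \<in> A \<Longrightarrow> norm x \<le> M"
    and R: "R > 0" "cball 0 R \<subseteq> convex hull A"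
  shows "\<exists>I J a. finite I \<and> finite J \<and> I \<inter> J = {} \<and> card (I \<union> J) = DIM('a) + 2 \<and> card I \<ge> 2 \<and> card J \<ge> 2 \<and>
    ball_config W I J R M (mass W (convex hull A)) a"
proof -
  define n where "n = DIM('a) + 2"
  obtain E where E: "E \<subseteq> A" "convex hull E = convex hull A"
    and Emin: "\<And>F. F \<subseteq> A \<Longrightarrow> convex hull F = convex hull A \<Longrightarrow> card E \<le> card F"
  proof -
    define P where "P F \<longleftrightarrow> F \<subseteq> A \<and> convex hull F = convex hull A" for F
    have "P A" by (simp add: P_def)
    from ex_has_least_nat[of P A card, OF this]
    obtain E where "P E" "\<forall>F. P F \<longrightarrow> card E \<le> card F" by blast
    then show ?thesis using that[of E] by (simp add: P_def)
  qed
  have finE: "finite E" using E A by (meson finite_subset)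
  have "card E \<le> n" using card_mono[OF A(1) E(1)] A(2) by (simp add: n_def)
  have "0 \<in> convex hull E" using R E by auto
  then have Ene: "E \<noteq> {}" by auto
  have cfg: "ball_config W I J R M (mass W (convex hull A)) (\<lambda>v. if v \<in> I \<union> J then a v else 0)"
    if "a ` (I \<union> J) = E" "convex hull (a ` I) \<inter> convex hull (a ` J) \<noteq> {}" for I J and a :: "nat \<Rightarrow> 'a"
  proof -
    have im: "(\<lambda>v. if v \<in> I \<union> J then a v else 0) ` S = a ` S" if "S \<subseteq> I \<union> J" for S using that by (intro image_cong) auto
    have "norm (a v) \<le> M" if "v \<in> I \<union> J" for v using that \<open>a ` (I \<union> J) = E\<close> E(1) A(3) by blast
    then show ?thesis
      unfolding ball_config_def using im[of I] im[of J] im[of "I \<union> J"] that R E by simp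
  qed
  show ?thesis
  proof (cases "card E = n")
    case False
    then have En: "card E < n" using \<open>card E \<le> n\<close> by simp
    obtain f where f: "bij_betw f {0..<card E} E" using ex_bij_betw_nat_finite[OF finE] by blast
    \<comment> \<open>Padding repeats the point \<open>f 0\<close>. Index \<open>n - 1\<close>,
      which belongs to \<open>J\<close>, carries it because \<open>card E < n\<close>, and so does
      index \<open>0\<close>, which belongs to \<open>I\<close>.\<close>
    define a where "a v = (if v < card E then f v else f 0)" for v
    define I J :: "nat set" where "I = {0, 1}" and "J = {2..<n}"
    have "card E > 0" using Ene finE by (simp add: card_gt_0_iff)
    have fE: "f ` {0..<card E} = E" using f by (simp add: bij_betw_def)
    have "a ` (I \<union> J) = E"
    proof -
      have IJ: "I \<union> J = {0..<n}" using d by (auto simp: I_def J_def n_def)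
      have "a ` {0..<n} \<subseteq> E" using fE \<open>card E > 0\<close> by (auto simp: a_def)
      moreover have "E \<subseteq> a ` {0..<n}"
      proof
        fix x assume "x \<in> E"
        then have "x \<in> f ` {0..<card E}" by (simp add: fE)
        then obtain v where "v < card E" "x = f v" by auto
        then show "x \<in> a ` {0..<n}" using En by (auto simp: a_def intro!: image_eqI[of _ _ v])
      qed
      ultimately show ?thesis by (simp add: IJ)
    qed
    moreover have "convex hull (a ` I) \<inter> convex hull (a ` J) \<noteq> {}"
    proof -
      have "a (n - 1) = a 0" using En \<open>card E > 0\<close> by (auto simp: a_def)
      moreover have "a 0 \<in> convex hull (a ` I)" by (rule hull_inc) (simp add: I_def)
      moreover have "a (n - 1) \<in> convex hull (a ` J)" using d by (intro hull_inc imageI) (auto simp: J_def n_def)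
      ultimately show ?thesis by auto
    qed
    moreover have "finite I" "finite J" "I \<inter> J = {}" "card I = 2" "card J = DIM('a)" by (auto simp: I_def J_def n_def)
    moreover have "card (I \<union> J) = card I + card J" using calculation by (intro card_Un_disjoint)
    ultimately show ?thesis using cfg[of a I J] d by (intro exI[of _ I] exI[of _ J] exI[of _ "\<lambda>v. if v \<in> I \<union> J then a v else 0"] conjI) auto
  next
    case True
    then have "affine_dependent E" using finE by (intro affine_dependent_biggerset) (auto simp: n_def)
    then obtain P Q where PQ: "P \<inter> Q = {}" "P \<union> Q = E" "convex hull P \<inter> convex hull Q \<noteq> {}"
      using Radon_partition[OF finE] by blast
    \<comment> \<open>A class consisting of one point would put that point into the hull of the
      others, against the minimal choice of \<open>E\<close>.\<close>
    have two: "card P \<ge> 2" if PQ: "P \<inter> Q = {}" "P \<union> Q = E" "convex hull P \<inter> convex hull Q \<noteq> {}" for P Q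
    proof (rule ccontr)
      assume "\<not> card P \<ge> 2"
      have finP: "finite P" using PQ finE by (metis finite_Un)
      have "P \<noteq> {}" using PQ(3) by auto
      then have "card P \<noteq> 0" using finP by simp
      then have "card P = 1" using \<open>\<not> card P \<ge> 2\<close> by simp
      then obtain p where p: "P = {p}" using card_1_singletonE by blast
      then have "p \<in> convex hull Q" using PQ(3) by auto
      have "E \<subseteq> convex hull Q" using PQ(2) p \<open>p \<in> convex hull Q\<close> hull_subset[of Q convex] by auto
      then have "convex hull E \<subseteq> convex hull Q" by (simp add: subset_hull)
      moreover have "convex hull Q \<subseteq> convex hull E" using PQ(2) by (intro hull_mono) auto
      ultimately have "convex hull Q = convex hull A" using E by auto
      then have "card E \<le> card Q" using Emin PQ(2) E(1) by auto
      moreover have "card Q < card E" using PQ p finE by (intro psubset_card_mono) auto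
      ultimately show False by simp
    qed
    obtain f where f: "bij_betw f {0..<n} E" using ex_bij_betw_nat_finite[OF finE] True by auto
    define I J where "I = {v\<in>{0..<n}. f v \<in> P}" and "J = {v\<in>{0..<n}. f v \<in> Q}"
    have IJ: "finite I" "finite J" "I \<inter> J = {}" using PQ(1) by (auto simp: I_def J_def)
    have "I \<union> J = {0..<n}" using f PQ(2) by (auto simp: I_def J_def bij_betw_def)
    then have IJn: "card (I \<union> J) = n" by simp
    have "P \<subseteq> f ` {0..<n}" "Q \<subseteq> f ` {0..<n}" using f PQ(2) by (auto simp: bij_betw_def)
    then have fI: "f ` I = P" "f ` J = Q" by (auto simp: I_def J_def)
    have "card P \<le> card I" "card Q \<le> card J" using fI IJ card_image_le by blast+
    moreover have "card P \<ge> 2" "card Q \<ge> 2" using two[OF PQ] two[of Q P] PQ by (auto simp: Un_commute Int_commute)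
    ultimately have "card I \<ge> 2" "card J \<ge> 2" by auto
    then show ?thesis using IJ IJn cfg[of f I J] fI PQ
      by (intro exI[of _ I] exI[of _ J] exI[of _ "\<lambda>v. if v \<in> I \<union> J then f v else 0"] conjI) (auto simp: n_def image_Un)
  qed
qed

theorem exists_cross_config:
  fixes A :: "'a::euclidean_space set"
  assumes d: "DIM('a) \<ge> 2" and A: "finite A" "card A \<le> DIM('a) + 2" "\<And>x. x \<in> A \<Longrightarrow> norm x \<le> M"
    and R: "R > 0" "cball 0 R \<subseteq> convex hull A"
    and W: "W \<in> borel_measurable borel" "\<And>x y. norm x \<le> norm y \<Longrightarrow> W x \<le> W y"
  shows "\<exists>(I::nat set) J a \<alpha> \<gamma>. cross_config I J a a \<alpha> \<gamma> \<and> card I \<le> card J \<and> (\<forall>v\<in>I \<union> J. norm (a v) \<le> M) \<and>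
    cball 0 R \<subseteq> convex hull (a ` I \<union> a ` J) \<and>
    mass W (convex hull (a ` I \<union> a ` J))
      \<le> mass W (convex hull A)"
proof -
  obtain I J :: "nat set" and a0 where IJ: "finite I" "finite J" "I \<inter> J = {}" "card (I \<union> J) = DIM('a) + 2" "card I \<ge> 2" "card J \<ge> 2"
    "ball_config W I J R M (mass W (convex hull A)) a0"
    using exists_ball_config[OF d A R, of W] by blast
  obtain a where a: "ball_config W I J R M (mass W (convex hull A)) a"
    "\<And>i j. i \<in> I \<and> j \<in> I \<or> i \<in> J \<and> j \<in> J \<Longrightarrow> norm (a i) = norm (a j)"
    "\<And>i j v. i \<in> I \<and> j \<in> I \<or> i \<in> J \<and> j \<in> J \<Longrightarrow> v \<in> I \<union> J \<Longrightarrow> v \<noteq> i \<Longrightarrow> v \<noteq> j \<Longrightarrow> a i \<bullet> a v = a j \<bullet> a v"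
    using exists_symmetric_ball_config[OF IJ(1-4) R(1) W IJ(7)] by blast
  have cIJ: "card I + card J = DIM('a) + 2" using IJ card_Un_disjoint by metis
  have a': "ball_config W J I R M (mass W (convex hull A)) a"
    using a(1) by (simp add: ball_config_commute)
  have JI: "J \<inter> I = {}" using IJ(3) by blast
  have a3: "\<And>i j v. i \<in> J \<and> j \<in> J \<or> i \<in> I \<and> j \<in> I \<Longrightarrow> v \<in> J \<union> I \<Longrightarrow> v \<noteq> i \<Longrightarrow> v \<noteq> j \<Longrightarrow> a i \<bullet> a v = a j \<bullet> a v"
    using a(3) by blast
  have cl: "card I \<le> DIM('a)" "card J \<le> DIM('a)" using cIJ IJ(5,6) by auto
  have n: "\<And>i j. i \<in> I \<Longrightarrow> j \<in> I \<Longrightarrow> norm (a i) = norm (a j)" "\<And>i j. i \<in> J \<Longrightarrow> j \<in> J \<Longrightarrow> norm (a i) = norm (a j)"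
    using a(2) by auto
  note sI = symmetric_ball_config_centred[OF IJ(1-3) R(1) IJ(5) cl(2) a(1) n(1) a(3)]
  note sJ = symmetric_ball_config_centred[OF IJ(2,1) JI R(1) IJ(6) cl(1) a' n(2) a3]
  obtain \<alpha> where \<alpha>: "centred_simplex I a \<alpha>" using sI(1) by blast
  obtain \<gamma> where \<gamma>: "centred_simplex J a \<gamma>" using sJ(1) by blast
  have 1: "cross_config I J a a \<alpha> \<gamma>" using \<alpha> \<gamma> cIJ sI(2) by (auto simp: cross_config_def)
  have 2: "cross_config J I a a \<gamma> \<alpha>" using \<alpha> \<gamma> cIJ sJ(2) by (auto simp: cross_config_def)
  have 3: "\<forall>v\<in>I \<union> J. norm (a v) \<le> M" "cball 0 R \<subseteq> convex hull (a ` I \<union> a ` J)"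
    "mass W (convex hull (a ` I \<union> a ` J))
      \<le> mass W (convex hull A)"
    using a(1) by (auto simp: ball_config_def image_Un)
  show ?thesis
  proof (cases "card I \<le> card J")
    case True
    show ?thesis
      by (rule exI[of _ I], rule exI[of _ J], rule exI[of _ a], rule exI[of _ \<alpha>], rule exI[of _ \<gamma>])
        (intro conjI 1 True 3)
  next
    case False
    then have le: "card J \<le> card I" by simp
    show ?thesis
      by (rule exI[of _ J], rule exI[of _ I], rule exI[of _ a], rule exI[of _ \<gamma>], rule exI[of _ \<alpha>])
        (intro conjI 2 le; use 3 in \<open>simp add: Un_commute\<close>)
  qed
qed

section \<open>Two regular simplices in orthogonal subspaces\<close>

lemma centred_simplex_inner:
  assumes "centred_simplex I a \<alpha>" "i \<in> I" "j \<in> I"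
  shows "a i \<bullet> a j = (if i = j then \<alpha> else - \<alpha> / (real (card I) - 1))"
  using assms by (auto simp: centred_simplex_def)

text \<open>Pairing an affine relation with one vertex \<open>a i\<close> leaves \<open>u i\<close>
  times the gap between the diagonal and off-diagonal Gram entries, which have opposite
  signs.\<close>

lemma centred_simplex_not_affine_dependent:
  assumes c: "centred_simplex I a \<alpha>"
  shows "inj_on a I" "\<not> affine_dependent (a ` I)"
proof -
  have I: "finite I" "card I \<ge> 2" "\<alpha> > 0" using c by (auto simp: centred_simplex_def)
  have neg: "- \<alpha> / (real (card I) - 1) < 0" using I by (simp add: divide_neg_pos)
  show inj: "inj_on a I"
  proof (rule inj_onI, rule ccontr)
    fix i j assume ij: "i \<in> I" "j \<in> I" "a i = a j" "i \<noteq> j"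
    have "a i \<bullet> a j = \<alpha>" using centred_simplex_inner[OF c ij(1) ij(1)] ij(3) by simp
    then show False using centred_simplex_inner[OF c ij(1,2)] ij(4) neg I(3) by simp
  qed
  show "\<not> affine_dependent (a ` I)"
  proof
    assume "affine_dependent (a ` I)"
    then obtain U where U: "sum U (a ` I) = 0" "\<exists>v\<in>a ` I. U v \<noteq> 0" "(\<Sum>v\<in>a ` I. U v *\<^sub>R v) = 0"
      using affine_dependent_explicit_finite[of "a ` I"] I by auto
    define u where "u i = U (a i)" for i
    have u: "sum u I = 0" "(\<Sum>i\<in>I. u i *\<^sub>R a i) = 0" "\<exists>i\<in>I. u i \<noteq> 0"
      using U unfolding sum.reindex[OF inj] by (auto simp: u_def)
    have "u i = 0" if i: "i \<in> I" for i
    proof -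
      define \<beta> where "\<beta> = - \<alpha> / (real (card I) - 1)"
      have "0 = (\<Sum>j\<in>I. u j *\<^sub>R a j) \<bullet> a i" using u by simp
      also have "\<dots> = (\<Sum>j\<in>I. u j * \<beta> + (if j = i then u i * (\<alpha> - \<beta>) else 0))"
        unfolding inner_sum_left
        by (intro sum.cong refl) (simp add: centred_simplex_inner[OF c _ i] \<beta>_def algebra_simps)
      also have "\<dots> = u i * (\<alpha> - \<beta>)"
        using u(1) i I(1) by (simp add: sum.distrib flip: sum_distrib_right)
      finally show ?thesis using neg I(3) by (auto simp: \<beta>_def)
    qed
    then show False using u(3) by blast
  qed
qed

text \<open>The barycentre \<open>0\<close> lies in the affine hull, so linear and affine dimension
  agree.\<close>

lemma centred_simplex_dim:
  assumes c: "centred_simplex I a \<alpha>"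
  shows "dim (a ` I) = card I - 1"
proof -
  have I: "finite I" "card I \<ge> 2" "(\<Sum>i\<in>I. a i) = 0" using c by (auto simp: centred_simplex_def)
  have "(\<Sum>i\<in>I. (1 / real (card I)) *\<^sub>R a i) \<in> convex hull (a ` I)"
    using I by (intro convex_sum convex_convex_hull) (auto intro: hull_inc)
  then have "0 \<in> convex hull (a ` I)" using I by (simp flip: scaleR_right.sum)
  then have "0 \<in> affine hull (a ` I)" using convex_hull_subset_affine_hull by blast
  then have "aff_dim (a ` I) = int (dim (a ` I))" by (rule aff_dim_zero)
  moreover have "aff_dim (a ` I) = int (card (a ` I)) - 1"
    using aff_dim_affine_independent[OF centred_simplex_not_affine_dependent(2)[OF c]] by linarith
  ultimately show ?thesis using card_image[OF centred_simplex_not_affine_dependent(1)[OF c]] I by simp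
qed

text \<open>The reals \<open>k\<close> and \<open>l\<close> are the dimensions of the two simplices.
  The two families have their own index types and the parameters are symmetric, so that interpreting
  the locale through \<open>flip\<close> yields each fact about the second simplex from that about
  the first.\<close>

locale cross =
  fixes I :: "'i set" and J :: "'j set" and a :: "'i \<Rightarrow> 'a::euclidean_space" and b :: "'j \<Rightarrow> 'a" and \<alpha> \<gamma> k l :: real
  assumes cfg: "cross_config I J a b \<alpha> \<gamma>" and k_def: "k = real (card I) - 1" and l_def: "l = real (card J) - 1"
begin

lemma cI: "centred_simplex I a \<alpha>" and cJ: "centred_simplex J b \<gamma>" and cIJ: "card I + card J = DIM('a) + 2"
  using cfg by (auto simp: cross_config_def)

lemma basic: "finite I" "finite J" "card I \<ge> 2" "card J \<ge> 2" "\<alpha> > 0" "\<gamma> > 0" "k \<ge> 1" "l \<ge> 1"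
  "(\<Sum>i\<in>I. a i) = 0" "(\<Sum>j\<in>J. b j) = 0" "real (card I) = k + 1" "real (card J) = l + 1"
  using cI cJ by (auto simp: centred_simplex_def k_def l_def)

lemma inner_aa: "i \<in> I \<Longrightarrow> p \<in> I \<Longrightarrow> a i \<bullet> a p = (if i = p then \<alpha> else - \<alpha> / k)"
  using centred_simplex_inner[OF cI] by (simp add: k_def)
lemma inner_bb: "j \<in> J \<Longrightarrow> q \<in> J \<Longrightarrow> b j \<bullet> b q = (if j = q then \<gamma> else - \<gamma> / l)"
  using centred_simplex_inner[OF cJ] by (simp add: l_def)
lemma inner_ab: "i \<in> I \<Longrightarrow> j \<in> J \<Longrightarrow> a i \<bullet> b j = 0" "i \<in> I \<Longrightarrow> j \<in> J \<Longrightarrow> b j \<bullet> a i = 0"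
  using cfg by (auto simp: cross_config_def inner_commute)

lemma flip: "cross J I b a \<gamma> \<alpha> l k"
  using cfg k_def l_def by unfold_locales (auto simp: cross_config_def inner_commute)

lemma orthogonal_all_zero:
  assumes "\<And>i. i \<in> I \<Longrightarrow> y \<bullet> a i = 0" "\<And>j. j \<in> J \<Longrightarrow> y \<bullet> b j = 0"
  shows "y = 0"
proof -
  have "dim (a ` I \<union> b ` J) = dim (a ` I) + dim (b ` J)"
    by (rule dim_orthogonal_sum) (auto simp: inner_ab)
  also have "\<dots> = DIM('a)"
    unfolding centred_simplex_dim[OF cI] centred_simplex_dim[OF cJ] using cIJ basic(3,4) by simp
  finally have "span (a ` I \<union> b ` J) = UNIV" using dim_eq_full by blast
  then have y: "y \<in> span (a ` I \<union> b ` J)" by simp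
  have "orthogonal y z" if "z \<in> a ` I \<union> b ` J" for z using that assms by (auto simp: orthogonal_def)
  then have "orthogonal y y" using orthogonal_to_span[OF y] by blast
  then show ?thesis by (simp add: orthogonal_def)
qed

text \<open>The vertices of a centred regular simplex form a tight frame of their span, with
  constant \<open>(k + 1) * \<alpha> / k\<close>; the Gram matrix is a multiple of the identity plus
  a constant matrix, and the latter is annihilated by the vanishing vertex sum.\<close>

lemma frame_sum_a:
  assumes "p \<in> I"
  shows "(\<Sum>i\<in>I. ((k / ((k + 1) * \<alpha>)) * (x \<bullet> a i)) *\<^sub>R a i) \<bullet> a p = x \<bullet> a p"
proof -
  define K where "K = k / ((k + 1) * \<alpha>)"
  define m n where "m = - K * \<alpha> / k" and "n = K * \<alpha> + K * \<alpha> / k"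
  have "(\<Sum>i\<in>I. (K * (x \<bullet> a i)) *\<^sub>R a i) \<bullet> a p
     = (\<Sum>i\<in>I. (x \<bullet> a i) * m + (if i = p then (x \<bullet> a p) * n else 0))"
    unfolding inner_sum_left by (intro sum.cong refl) (auto simp: inner_aa assms m_def n_def algebra_simps)
  also have "\<dots> = (x \<bullet> (\<Sum>i\<in>I. a i)) * m + (x \<bullet> a p) * n"
    using assms basic(1) by (simp add: sum.distrib sum_distrib_right inner_sum_right)
  also have "n = 1"
  proof -
    have "K * \<alpha> = k / (k + 1)" using basic by (simp add: K_def)
    then show ?thesis using basic by (simp add: n_def field_simps)
  qed
  finally show ?thesis using basic(9) by (simp add: K_def)
qed

lemma frame_expansion:
  "x = (\<Sum>i\<in>I. ((k / ((k + 1) * \<alpha>)) * (x \<bullet> a i)) *\<^sub>R a i) + (\<Sum>j\<in>J. ((l / ((l + 1) * \<gamma>)) * (x \<bullet> b j)) *\<^sub>R b j)"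
proof -
  interpret f: cross J I b a \<gamma> \<alpha> l k by (rule flip)
  define A where "A = (\<Sum>i\<in>I. ((k / ((k + 1) * \<alpha>)) * (x \<bullet> a i)) *\<^sub>R a i)"
  define B where "B = (\<Sum>j\<in>J. ((l / ((l + 1) * \<gamma>)) * (x \<bullet> b j)) *\<^sub>R b j)"
  have "A \<bullet> b j = 0" if "j \<in> J" for j using that by (simp add: A_def inner_sum_left inner_ab)
  moreover have "B \<bullet> a i = 0" if "i \<in> I" for i using that by (simp add: B_def inner_sum_left inner_ab)
  moreover have "A \<bullet> a i = x \<bullet> a i" if "i \<in> I" for i unfolding A_def by (rule frame_sum_a[OF that])
  moreover have "B \<bullet> b j = x \<bullet> b j" if "j \<in> J" for j unfolding B_def by (rule f.frame_sum_a[OF that])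
  ultimately have "x - (A + B) = 0"
    by (intro orthogonal_all_zero) (simp_all add: inner_diff_left inner_add_left)
  then show ?thesis by (simp add: A_def B_def)
qed

section \<open>Facets, inradius and decomposition into cells\<close>

definition Q :: "'a set" where "Q = convex hull (a ` I \<union> b ` J)"

text \<open>Dropping one vertex from each simplex leaves the vertices of a facet of
  \<open>Q\<close>; the cell is the cone over this facet with apex \<open>0\<close>.\<close>

definition cell :: "'i \<Rightarrow> 'j \<Rightarrow> 'a set" where
  "cell i j = convex hull (insert 0 (a ` (I - {i}) \<union> b ` (J - {j})))"

text \<open>Normal of the facet that omits \<open>a i\<close> and \<open>b j\<close>, scaled to have
  inner product \<open>1\<close> with all its vertices.\<close>

definition facet_normal :: "'i \<Rightarrow> 'j \<Rightarrow> 'a" where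
  "facet_normal i j = - (k / \<alpha>) *\<^sub>R a i - (l / \<gamma>) *\<^sub>R b j"

lemma facet_normal_le:
  assumes ij: "i \<in> I" "j \<in> J" and x: "x \<in> Q" shows "facet_normal i j \<bullet> x \<le> 1"
proof -
  have "facet_normal i j \<bullet> a p \<le> 1" if "p \<in> I" for p
    using that ij basic by (auto simp: facet_normal_def inner_diff_left inner_aa inner_ab)
  moreover have "facet_normal i j \<bullet> b q \<le> 1" if "q \<in> J" for q
    using that ij basic by (auto simp: facet_normal_def inner_diff_left inner_bb inner_ab)
  ultimately have "a ` I \<union> b ` J \<subseteq> {x. facet_normal i j \<bullet> x \<le> 1}" by auto
  then have "Q \<subseteq> {x. facet_normal i j \<bullet> x \<le> 1}"
    unfolding Q_def by (intro hull_minimal) (simp_all add: convex_halfspace_le)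
  then show ?thesis using x by auto
qed

lemma norm_facet_normal:
  assumes "i \<in> I" "j \<in> J" shows "(norm (facet_normal i j))\<^sup>2 = k\<^sup>2 / \<alpha> + l\<^sup>2 / \<gamma>"
proof -
  have "facet_normal i j \<bullet> facet_normal i j = k\<^sup>2 / \<alpha> + l\<^sup>2 / \<gamma>"
    using assms basic
    by (simp add: facet_normal_def inner_diff_left inner_diff_right inner_aa inner_bb inner_ab power2_eq_square)
  then show ?thesis by (simp add: power2_norm_eq_inner)
qed

text \<open>All facet normals have the same length, the reciprocal of the inradius of
  \<open>Q\<close>; the test point is where the sphere of radius \<open>R\<close> meets such a
  normal. The two terms \<open>k\<^sup>2 / \<alpha>\<close> and \<open>l\<^sup>2 / \<gamma>\<close>
  are the inverse squared inradii of the simplices.\<close>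

lemma inradius_le:
  assumes R: "R > 0" "cball 0 R \<subseteq> Q" shows "R\<^sup>2 * (k\<^sup>2 / \<alpha> + l\<^sup>2 / \<gamma>) \<le> 1"
proof -
  have "I \<noteq> {}" "J \<noteq> {}" using basic by auto
  then obtain i j where ij: "i \<in> I" "j \<in> J" by auto
  define u where "u = facet_normal i j"
  have nu: "(norm u)\<^sup>2 = k\<^sup>2 / \<alpha> + l\<^sup>2 / \<gamma>" unfolding u_def by (rule norm_facet_normal[OF ij])
  have "k\<^sup>2 / \<alpha> > 0" "l\<^sup>2 / \<gamma> > 0" using basic by auto
  then have u0: "norm u > 0" using nu by (metis add_pos_pos norm_ge_zero less_le power_zero_numeral less_irrefl)
  have "(R / norm u) *\<^sub>R u \<in> Q" using R u0 by (intro subsetD[OF R(2)]) simp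
  then have "u \<bullet> ((R / norm u) *\<^sub>R u) \<le> 1" unfolding u_def by (rule facet_normal_le[OF ij])
  then have "R * norm u \<le> 1" using u0 by (simp add: power2_norm_eq_inner[symmetric] power2_eq_square)
  then have "(R * norm u)\<^sup>2 \<le> 1" using R u0 by (intro power_le_one) auto
  then show ?thesis by (simp add: power_mult_distrib nu)
qed

lemma zero_in_Q: "0 \<in> Q"
proof -
  have "(\<Sum>i\<in>I. (1 / real (card I)) *\<^sub>R a i) \<in> convex hull (a ` I)"
    using basic by (intro convex_sum convex_convex_hull) (auto intro: hull_inc)
  then have "0 \<in> convex hull (a ` I)" using basic by (simp flip: scaleR_right.sum)
  then show ?thesis unfolding Q_def using hull_mono[of "a ` I" "a ` I \<union> b ` J"] by blast
qed

lemma cell_subset: "cell i j \<subseteq> Q"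
proof -
  have "a ` I \<union> b ` J \<subseteq> Q" unfolding Q_def by (rule hull_subset)
  then have "insert 0 (a ` (I - {i}) \<union> b ` (J - {j})) \<subseteq> Q" using zero_in_Q by auto
  then show ?thesis unfolding cell_def Q_def by (intro hull_minimal) auto
qed

text \<open>Since the vertices of each simplex sum to \<open>0\<close>, the coefficients of the
  frame expansion may be lowered by their minimum. They become nonnegative, vanish at
  \<open>i\<close> and \<open>j\<close>, and add up to exactly
  \<open>facet_normal i j \<bullet> x\<close>, so the rest of the weight can go to the apex.\<close>

lemma in_cellI:
  assumes ij: "i \<in> I" "j \<in> J" and min: "\<And>p. p \<in> I \<Longrightarrow> x \<bullet> a i \<le> x \<bullet> a p" "\<And>q. q \<in> J \<Longrightarrow> x \<bullet> b j \<le> x \<bullet> b q"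
    and le: "facet_normal i j \<bullet> x \<le> 1"
  shows "x \<in> cell i j"
proof -
  define K L where "K = k / ((k + 1) * \<alpha>)" and "L = l / ((l + 1) * \<gamma>)"
  have KL: "K \<ge> 0" "L \<ge> 0" using basic by (auto simp: K_def L_def)
  define s where "s p = K * (x \<bullet> a p - x \<bullet> a i)" for p
  define t where "t q = L * (x \<bullet> b q - x \<bullet> b j)" for q
  have s0: "s p \<ge> 0" if "p \<in> I" for p using min KL that by (simp add: s_def)
  have t0: "t q \<ge> 0" if "q \<in> J" for q using min KL that by (simp add: t_def)
  have "(\<Sum>p\<in>I. s p *\<^sub>R a p) = (\<Sum>p\<in>I. (K * (x \<bullet> a p)) *\<^sub>R a p) - (K * (x \<bullet> a i)) *\<^sub>R (\<Sum>p\<in>I. a p)"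
    by (simp add: s_def sum_subtractf scaleR_right.sum algebra_simps)
  moreover have "(\<Sum>q\<in>J. t q *\<^sub>R b q) = (\<Sum>q\<in>J. (L * (x \<bullet> b q)) *\<^sub>R b q) - (L * (x \<bullet> b j)) *\<^sub>R (\<Sum>q\<in>J. b q)"
    by (simp add: t_def sum_subtractf scaleR_right.sum algebra_simps)
  ultimately have x: "x = (\<Sum>p\<in>I. s p *\<^sub>R a p) + (\<Sum>q\<in>J. t q *\<^sub>R b q)"
    using frame_expansion[of x] basic(9,10) by (simp add: K_def L_def)
  have "sum s I = K * (x \<bullet> (\<Sum>p\<in>I. a p)) - K * (k + 1) * (x \<bullet> a i)"
    using basic(11) by (simp add: s_def inner_sum_right sum_distrib_left[symmetric] sum_subtractf algebra_simps)
  also have "\<dots> = - (k / \<alpha>) * (x \<bullet> a i)" using basic by (simp add: K_def)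
  finally have S: "sum s I = - (k / \<alpha>) * (x \<bullet> a i)" .
  have "sum t J = L * (x \<bullet> (\<Sum>q\<in>J. b q)) - L * (l + 1) * (x \<bullet> b j)"
    using basic(12) by (simp add: t_def inner_sum_right sum_distrib_left[symmetric] sum_subtractf algebra_simps)
  also have "\<dots> = - (l / \<gamma>) * (x \<bullet> b j)" using basic by (simp add: L_def)
  finally have T: "sum t J = - (l / \<gamma>) * (x \<bullet> b j)" .
  have st1: "sum s I + sum t J \<le> 1"
    using le unfolding S T by (simp add: facet_normal_def inner_diff_left inner_diff_right inner_commute[of _ x])
  define C where "C = cell i j"
  have "convex C" by (simp add: C_def cell_def)
  have aC: "a p \<in> C" if "p \<in> I - {i}" for p unfolding C_def cell_def using that by (intro hull_inc) auto
  have bC: "b q \<in> C" if "q \<in> J - {j}" for q unfolding C_def cell_def using that by (intro hull_inc) auto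
  have zC: "0 \<in> C" unfolding C_def cell_def by (intro hull_inc) auto
  have si: "s i = 0" "t j = 0" by (auto simp: s_def t_def)
  \<comment> \<open>\<open>None\<close> stands for the apex, and the sum type merges both vertex
    families into one convex combination. The dropped vertices may be sent to \<open>0\<close> by
    \<open>g\<close> because their coefficients \<open>s i\<close> and \<open>t j\<close>
    vanish.\<close>
  define c where "c y = (case y of None \<Rightarrow> 1 - (sum s I + sum t J) | Some (Inl p) \<Rightarrow> s p | Some (Inr q) \<Rightarrow> t q)" for y
  define g where "g y = (case y of None \<Rightarrow> 0 | Some (Inl p) \<Rightarrow> if p = i then 0 else a p | Some (Inr q) \<Rightarrow> if q = j then 0 else b q)" for y
  define N where "N = insert None (Some ` (Inl ` I \<union> Inr ` J))"
  have sumN: "sum h N = h None + (\<Sum>p\<in>I. h (Some (Inl p))) + (\<Sum>q\<in>J. h (Some (Inr q)))"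
    for h :: "_ \<Rightarrow> 'z::comm_monoid_add"
  proof -
    have "sum h N = h None + sum h (Some ` (Inl ` I \<union> Inr ` J))"
      unfolding N_def using basic by (intro sum.insert) auto
    also have "sum h (Some ` (Inl ` I \<union> Inr ` J)) = sum (h \<circ> Some) (Inl ` I \<union> Inr ` J)"
      by (rule sum.reindex) simp
    also have "\<dots> = sum (h \<circ> Some) (Inl ` I) + sum (h \<circ> Some) (Inr ` J)"
      using basic by (intro sum.union_disjoint) auto
    also have "sum (h \<circ> Some) (Inl ` I) = (\<Sum>p\<in>I. h (Some (Inl p)))"
      by (subst sum.reindex) (auto simp: inj_on_def)
    also have "sum (h \<circ> Some) (Inr ` J) = (\<Sum>q\<in>J. h (Some (Inr q)))"
      by (subst sum.reindex) (auto simp: inj_on_def)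
    finally show ?thesis by (simp add: add.assoc)
  qed
  have "(\<Sum>y\<in>N. c y *\<^sub>R g y) \<in> C"
  proof (rule convex_sum[OF _ \<open>convex C\<close>])
    show "finite N" using basic by (simp add: N_def)
    show "sum c N = 1" unfolding sumN by (simp add: c_def)
    show "0 \<le> c y" if "y \<in> N" for y using that s0 t0 st1 by (auto simp: N_def c_def)
    show "g y \<in> C" if "y \<in> N" for y using that aC bC zC by (auto simp: N_def g_def)
  qed
  also have "(\<Sum>y\<in>N. c y *\<^sub>R g y) = (\<Sum>p\<in>I. s p *\<^sub>R a p) + (\<Sum>q\<in>J. t q *\<^sub>R b q)"
    unfolding sumN using si by (auto simp: c_def g_def intro!: arg_cong2[of _ _ _ _ "(+)"] sum.cong)
  finally show ?thesis using x by (simp add: C_def)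
qed

lemma exists_cell:
  assumes "\<And>i j. i \<in> I \<Longrightarrow> j \<in> J \<Longrightarrow> facet_normal i j \<bullet> x \<le> 1"
  shows "\<exists>i\<in>I. \<exists>j\<in>J. x \<in> cell i j"
proof -
  have "I \<noteq> {}" "J \<noteq> {}" using basic by auto
  then obtain i j where i: "i \<in> I" "\<And>p. p \<in> I \<Longrightarrow> x \<bullet> a i \<le> x \<bullet> a p" and j: "j \<in> J" "\<And>q. q \<in> J \<Longrightarrow> x \<bullet> b j \<le> x \<bullet> b q"
    using ex_is_arg_min_if_finite[OF basic(1), of "\<lambda>i. x \<bullet> a i"]
      ex_is_arg_min_if_finite[OF basic(2), of "\<lambda>j. x \<bullet> b j"]
    by (auto simp: is_arg_min_linorder)
  then show ?thesis using in_cellI[OF i(1) j(1) i(2) j(2)] assms by blast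
qed

lemma cball_subset_Q:
  assumes R: "R > 0" "R\<^sup>2 * (k\<^sup>2 / \<alpha> + l\<^sup>2 / \<gamma>) \<le> 1" shows "cball 0 R \<subseteq> Q"
proof
  fix x :: 'a assume x: "x \<in> cball 0 R"
  have "facet_normal i j \<bullet> x \<le> 1" if ij: "i \<in> I" "j \<in> J" for i j
  proof -
    have "(R * norm (facet_normal i j))\<^sup>2 \<le> 1\<^sup>2" using R(2) by (simp add: power_mult_distrib norm_facet_normal[OF ij])
    then have "R * norm (facet_normal i j) \<le> 1" by (rule power2_le_imp_le) simp
    moreover have "facet_normal i j \<bullet> x \<le> norm (facet_normal i j) * norm x" by (rule norm_cauchy_schwarz)
    moreover have "norm (facet_normal i j) * norm x \<le> norm (facet_normal i j) * R"
      using x by (intro mult_left_mono) auto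
    ultimately show ?thesis by (simp add: mult.commute)
  qed
  then show "x \<in> Q" using exists_cell[of x] cell_subset by blast
qed

end

section \<open>Volume of the polytope in terms of an orthonormal corner\<close>

lemma emeasure_rank_one_hull:
  fixes e u :: "'a::euclidean_space"
  assumes S: "finite S" and D: "1 + u \<bullet> e \<noteq> 0"
  shows "emeasure lborel (convex hull ((\<lambda>x. x + (u \<bullet> x) *\<^sub>R e) ` S)) = ennreal \<bar>1 + u \<bullet> e\<bar> * emeasure lborel (convex hull S)"
proof -
  have "linear (\<lambda>x. x + (u \<bullet> x) *\<^sub>R e)"
    by (rule linearI) (auto simp: inner_add_right algebra_simps)
  then have "convex hull ((\<lambda>x. x + (u \<bullet> x) *\<^sub>R e) ` S) = (\<lambda>x. x + (u \<bullet> x) *\<^sub>R e) ` (convex hull S)"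
    by (simp add: convex_hull_linear_image)
  moreover have "convex hull S \<in> sets borel"
    using S by (intro borel_compact compact_convex_hull finite_imp_compact)
  ultimately show ?thesis using emeasure_rank_one_image[OF _ D] by simp
qed

lemma AE_inner_neq_zero:
  assumes "(w::'a::euclidean_space) \<noteq> 0" shows "AE x in lborel. x \<bullet> w \<noteq> 0"
proof -
  have "{x. w \<bullet> x = 0} \<in> null_sets lebesgue"
    using negligible_hyperplane[of w 0] assms by (simp add: negligible_iff_null_sets)
  moreover have "{x. w \<bullet> x = 0} \<in> sets lborel" by simp
  ultimately have "{x. w \<bullet> x = 0} \<in> null_sets lborel" by (simp add: null_sets_completion_iff)
  then have "AE x in lborel. x \<notin> {x. w \<bullet> x = 0}" by (rule AE_not_in)
  then show ?thesis by (simp add: inner_commute)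
qed

definition orthonormal :: "'a::real_inner set \<Rightarrow> bool" where
  "orthonormal F \<longleftrightarrow> (\<forall>x\<in>F. \<forall>y\<in>F. x \<bullet> y = (if x = y then 1 else 0))"

text \<open>The vectors are scaled one at a time: stretching along \<open>f\<close> is a rank-one
  map of determinant \<open>\<sigma>\<close> that fixes everything orthogonal to \<open>f\<close>.
  The set \<open>B\<close> collects the vectors already treated.\<close>

lemma emeasure_scale_orthonormal:
  fixes F :: "'a::euclidean_space set"
  assumes "finite F" "orthonormal F" "finite B" "\<And>f v. f \<in> F \<Longrightarrow> v \<in> B \<Longrightarrow> f \<bullet> v = 0" and \<sigma>: "\<sigma> > 0"
  shows "emeasure lborel (convex hull (insert 0 ((*\<^sub>R) \<sigma> ` F \<union> B)))
    = ennreal (\<sigma> ^ card F) * emeasure lborel (convex hull (insert 0 (F \<union> B)))"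
  using assms(1-4)
proof (induction F arbitrary: B rule: finite_induct)
  case empty
  then show ?case by simp
next
  case (insert f F)
  have o: "orthonormal F" "f \<bullet> f = 1" "\<And>x. x \<in> F \<Longrightarrow> f \<bullet> x = 0" "\<And>x. x \<in> F \<Longrightarrow> x \<bullet> f = 0"
    using insert.prems(1) insert.hyps(2) by (auto simp: orthonormal_def)
  have "emeasure lborel (convex hull (insert 0 ((*\<^sub>R) \<sigma> ` insert f F \<union> B)))
     = emeasure lborel (convex hull (insert 0 ((*\<^sub>R) \<sigma> ` F \<union> insert (\<sigma> *\<^sub>R f) B)))" by simp
  also have "\<dots> = ennreal (\<sigma> ^ card F) * emeasure lborel (convex hull (insert 0 (F \<union> insert (\<sigma> *\<^sub>R f) B)))"
    using insert.prems o by (intro insert.IH) auto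
  also have "insert 0 (F \<union> insert (\<sigma> *\<^sub>R f) B) = (\<lambda>x. x + (f \<bullet> x) *\<^sub>R ((\<sigma> - 1) *\<^sub>R f)) ` insert 0 (insert f F \<union> B)"
  proof -
    have "(\<lambda>x. x + (f \<bullet> x) *\<^sub>R ((\<sigma> - 1) *\<^sub>R f)) ` X = X" if "\<And>x. x \<in> X \<Longrightarrow> f \<bullet> x = 0" for X
    proof -
      have "(\<lambda>x. x + (f \<bullet> x) *\<^sub>R ((\<sigma> - 1) *\<^sub>R f)) ` X = (\<lambda>x. x) ` X" using that by (intro image_cong) auto
      then show ?thesis by simp
    qed
    from this[of F] this[of B] o insert.prems(3) show ?thesis
      by (simp add: image_Un scaleR_left_diff_distrib)
  qed
  also have "emeasure lborel (convex hull \<dots>) = ennreal \<bar>1 + f \<bullet> ((\<sigma> - 1) *\<^sub>R f)\<bar> * emeasure lborel (convex hull (insert 0 (insert f F \<union> B)))"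
    using insert \<sigma> o(2) by (intro emeasure_rank_one_hull) auto
  also have "\<bar>1 + f \<bullet> ((\<sigma> - 1) *\<^sub>R f)\<bar> = \<sigma>" using \<sigma> o(2) by simp
  finally show ?case using insert.hyps \<sigma> by (simp add: ennreal_mult mult.assoc[symmetric] mult.commute)
qed

context cross
begin

lemma cell_order:
  assumes ij: "i \<in> I" "j \<in> J" and x: "x \<in> cell i j" and p: "p \<in> I"
  shows "x \<bullet> a i \<le> x \<bullet> a p"
proof -
  have "\<alpha> / k > 0" using basic by simp
  then have "- (\<alpha> / k) \<le> \<alpha>" using basic(5) by linarith
  then have "insert 0 (a ` (I - {i}) \<union> b ` (J - {j})) \<subseteq> {x. (a i - a p) \<bullet> x \<le> 0}"
    using ij p basic by (auto simp: inner_diff_left inner_aa inner_ab)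
  then have "cell i j \<subseteq> {x. (a i - a p) \<bullet> x \<le> 0}"
    unfolding cell_def by (intro hull_minimal) (simp_all add: convex_halfspace_le)
  then have "(a i - a p) \<bullet> x \<le> 0" using x by blast
  then show ?thesis by (simp add: inner_diff_left inner_diff_right inner_commute)
qed

lemma flip_cell: "cross.cell J I b a j i = cell i j"
proof -
  interpret f: cross J I b a \<gamma> \<alpha> l k by (rule flip)
  show ?thesis unfolding cell_def f.cell_def by (simp add: Un_commute)
qed

lemma a_inj: "i \<in> I \<Longrightarrow> p \<in> I \<Longrightarrow> i \<noteq> p \<Longrightarrow> a i - a p \<noteq> 0"
  using centred_simplex_not_affine_dependent(1)[OF cI] by (auto simp: inj_on_def)

lemma cell_measurable [measurable]: "cell i j \<in> sets borel"
  unfolding cell_def using basic by (intro borel_compact compact_convex_hull finite_imp_compact) auto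

lemma Q_measurable [measurable]: "Q \<in> sets borel"
  unfolding Q_def using basic by (intro borel_compact compact_convex_hull finite_imp_compact) auto

text \<open>By \<open>cell_order\<close> a point of two different cells has equal inner products
  with two vertices of the same simplex. The overlaps thus lie in finitely many hyperplanes and are
  null.\<close>

lemma emeasure_Q_cells: "emeasure lborel Q = (\<Sum>i\<in>I. \<Sum>j\<in>J. emeasure lborel (cell i j))"
proof -
  interpret f: cross J I b a \<gamma> \<alpha> l k by (rule flip)
  have "AE x in lborel. \<forall>i\<in>I. \<forall>p\<in>I - {i}. x \<bullet> (a i - a p) \<noteq> 0"
    using basic(1) a_inj by (intro AE_finite_allI finite_Diff AE_inner_neq_zero) auto
  moreover have "AE x in lborel. \<forall>j\<in>J. \<forall>q\<in>J - {j}. x \<bullet> (b j - b q) \<noteq> 0"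
    using basic(2) f.a_inj by (intro AE_finite_allI finite_Diff AE_inner_neq_zero) auto
  ultimately have ae: "AE x in lborel. indicator Q x = (\<Sum>i\<in>I. \<Sum>j\<in>J. indicator (cell i j) x :: ennreal)"
  proof eventually_elim
    fix x
    assume na: "\<forall>i\<in>I. \<forall>p\<in>I - {i}. x \<bullet> (a i - a p) \<noteq> 0" and nb: "\<forall>j\<in>J. \<forall>q\<in>J - {j}. x \<bullet> (b j - b q) \<noteq> 0"
    show "indicator Q x = (\<Sum>i\<in>I. \<Sum>j\<in>J. indicator (cell i j) x :: ennreal)"
    proof (cases "x \<in> Q")
      case False
      then have "x \<notin> cell i j" for i j using cell_subset by blast
      then show ?thesis using False by simp
    next
      case True
      then obtain i j where ij: "i \<in> I" "j \<in> J" "x \<in> cell i j"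
        using exists_cell[of x] facet_normal_le by blast
      have uniq: "p = i \<and> q = j" if pq: "p \<in> I" "q \<in> J" "x \<in> cell p q" for p q
      proof
        have "x \<bullet> (a p - a i) = 0"
          using cell_order[OF ij pq(1)] cell_order[OF pq ij(1)] by (simp add: inner_diff_right)
        then show "p = i" using na pq ij by blast
        have "x \<bullet> (b q - b j) = 0"
        proof -
          have "x \<in> f.cell j i" "x \<in> f.cell q p" using ij(3) pq(3) by (simp_all add: flip_cell)
          then show ?thesis
            using f.cell_order[OF ij(2,1) _ pq(2)] f.cell_order[OF pq(2,1) _ ij(2)]
            by (simp add: inner_diff_right antisym)
        qed
        then show "q = j" using nb pq ij by blast
      qed
      have "(\<Sum>p\<in>I. \<Sum>q\<in>J. indicator (cell p q) x :: ennreal) = (\<Sum>p\<in>I. if p = i then 1 else 0)"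
      proof (rule sum.cong[OF refl])
        fix p assume p: "p \<in> I"
        show "(\<Sum>q\<in>J. indicator (cell p q) x :: ennreal) = (if p = i then 1 else 0)"
        proof (cases "p = i")
          case True
          have "(\<Sum>q\<in>J. indicator (cell p q) x :: ennreal) = (\<Sum>q\<in>J. if q = j then 1 else 0)"
          proof (rule sum.cong[OF refl])
            fix q assume q: "q \<in> J"
            have "x \<in> cell p q \<longleftrightarrow> q = j" using uniq[OF p q] ij True by blast
            then show "indicator (cell p q) x = (if q = j then 1 else 0 :: ennreal)" by (simp add: indicator_def)
          qed
          then show ?thesis using True ij(2) basic(2) by simp
        next
          case False
          have "(\<Sum>q\<in>J. indicator (cell p q) x :: ennreal) = 0"
          proof (intro sum.neutral ballI)
            fix q assume "q \<in> J"
            then have "x \<notin> cell p q" using uniq[OF p] False by blast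
            then show "indicator (cell p q) x = (0 :: ennreal)" by simp
          qed
          then show ?thesis using False by simp
        qed
      qed
      also have "\<dots> = 1" using ij(1) basic(1) by simp
      finally show ?thesis using True by simp
    qed
  qed
  have "emeasure lborel Q = (\<integral>\<^sup>+x. indicator Q x \<partial>lborel)" by simp
  also have "\<dots> = (\<integral>\<^sup>+x. (\<Sum>i\<in>I. \<Sum>j\<in>J. indicator (cell i j) x) \<partial>lborel)" by (rule nn_integral_cong_AE[OF ae])
  also have "\<dots> = (\<Sum>i\<in>I. \<Sum>j\<in>J. emeasure lborel (cell i j))"
    by (simp add: nn_integral_sum)
  finally show ?thesis .
qed

text \<open>The cells are exchanged by the orthogonal reflection that swaps \<open>a i\<close> and
  \<open>a p\<close>, which fixes \<open>0\<close> and all other vertices. The constant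
  \<open>K\<close> is chosen to give \<open>u \<bullet> a i = 1\<close>, whence the determinant
  \<open>-1\<close>.\<close>

lemma emeasure_cell_swap:
  assumes ip: "i \<in> I" "p \<in> I" and j: "j \<in> J"
  shows "emeasure lborel (cell p j) = emeasure lborel (cell i j)"
proof (cases "i = p")
  case False
  define e where "e = a p - a i"
  define K where "K = k / ((k + 1) * \<alpha>)"
  define u where "u = K *\<^sub>R (a i - a p)"
  have "\<alpha> + \<alpha> / k = ((k + 1) * \<alpha>) / k" using basic(7) by (simp add: field_simps)
  moreover have "(k + 1) * \<alpha> \<noteq> 0" "k \<noteq> 0" using basic by auto
  ultimately have kk: "K * (\<alpha> + \<alpha> / k) = 1" unfolding K_def by simp
  have "u \<bullet> a i = K * (\<alpha> + \<alpha> / k)" "u \<bullet> a p = - (K * (\<alpha> + \<alpha> / k))"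
    using ip False by (simp_all add: u_def inner_diff_left inner_aa) (simp add: algebra_simps)
  then have ua: "u \<bullet> a i = 1" "u \<bullet> a p = -1" unfolding kk .
  have ua3: "u \<bullet> a q = 0" if "q \<in> I" "q \<noteq> i" "q \<noteq> p" for q
    using ip that by (simp add: u_def inner_diff_left inner_aa)
  have ub: "u \<bullet> b q = 0" if "q \<in> J" for q using that ip by (simp add: u_def inner_diff_left inner_ab)
  have det: "1 + u \<bullet> e = -1" by (simp add: e_def inner_diff_right ua)
  define M where "M x = x + (u \<bullet> x) *\<^sub>R e" for x
  have Mi: "M (a i) = a p" "M 0 = 0" by (simp_all add: M_def ua e_def)
  have Mq: "M (a q) = a q" if "q \<in> I" "q \<noteq> i" "q \<noteq> p" for q using ua3[OF that] by (simp add: M_def)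
  have Mb: "M ` b ` (J - {j}) = b ` (J - {j})"
    unfolding image_image by (intro image_cong) (auto simp: M_def ub)
  have "I - {p} = insert i (I - {i, p})" "I - {i} = insert p (I - {i, p})" using ip False by auto
  then have "M ` a ` (I - {p}) = insert (a p) (M ` a ` (I - {i, p}))" "a ` (I - {i}) = insert (a p) (a ` (I - {i, p}))"
    by (simp_all add: Mi)
  moreover have "M ` a ` (I - {i, p}) = a ` (I - {i, p})"
    unfolding image_image by (intro image_cong) (auto simp: Mq)
  ultimately have "M ` (insert 0 (a ` (I - {p}) \<union> b ` (J - {j}))) = insert 0 (a ` (I - {i}) \<union> b ` (J - {j}))"
    by (simp add: Mi image_Un Mb)
  moreover have "emeasure lborel (convex hull (M ` (insert 0 (a ` (I - {p}) \<union> b ` (J - {j})))))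
      = ennreal \<bar>1 + u \<bullet> e\<bar> * emeasure lborel (cell p j)"
    unfolding M_def[abs_def] cell_def using basic det by (intro emeasure_rank_one_hull) auto
  ultimately show ?thesis by (simp add: det cell_def)
qed simp

lemma emeasure_Q_cell:
  assumes ij: "i \<in> I" "j \<in> J"
  shows "emeasure lborel Q = ennreal ((k + 1) * (l + 1)) * emeasure lborel (cell i j)"
proof -
  interpret f: cross J I b a \<gamma> \<alpha> l k by (rule flip)
  have "emeasure lborel (cell p q) = emeasure lborel (cell i j)" if "p \<in> I" "q \<in> J" for p q
    using emeasure_cell_swap[OF ij(1) that(1,2)] f.emeasure_cell_swap[OF ij(2) that(2) ij(1)] by (simp add: f.flip_cell)
  then have "emeasure lborel Q = (\<Sum>p\<in>I. \<Sum>q\<in>J. emeasure lborel (cell i j))"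
    unfolding emeasure_Q_cells by (intro sum.cong) auto
  also have "\<dots> = of_nat (card I * card J) * emeasure lborel (cell i j)" by (simp add: mult.assoc)
  also have "(of_nat (card I * card J) :: ennreal) = ennreal ((k + 1) * (l + 1))"
    using basic(11,12) by (metis ennreal_of_nat_eq_real_of_nat of_nat_mult)
  finally show ?thesis .
qed

text \<open>Subtracting the multiple \<open>1 / (r + 1)\<close> of one vertex from the others leaves
  pairwise orthogonal vectors of length \<open>\<sigma>\<close>, the edge length divided by the
  square root of 2. The number \<open>r\<close> is the determinant of the linear map performing the
  shift.\<close>

definition r :: real where "r = sqrt (k + 1)"
definition \<sigma> :: real where "\<sigma> = sqrt (\<alpha> * (k + 1) / k)"
definition frame :: "'i \<Rightarrow> 'i \<Rightarrow> 'a" where "frame i0 i = (a i - (1 / (r + 1)) *\<^sub>R a i0) /\<^sub>R \<sigma>"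

lemma r: "r > 1" "k / (r + 1) = r - 1" "r\<^sup>2 = k + 1"
proof -
  show 1: "r\<^sup>2 = k + 1" using basic by (simp add: r_def)
  show "r > 1" unfolding r_def using basic by simp
  moreover have "k = (r - 1) * (r + 1)" using 1 by (simp add: power2_eq_square algebra_simps)
  ultimately show "k / (r + 1) = r - 1" by (metis add_pos_pos less_irrefl less_trans nonzero_mult_div_cancel_right zero_less_one)
qed

lemma \<sigma>: "\<sigma> > 0" "\<sigma>\<^sup>2 = \<alpha> + \<alpha> / k"
proof -
  have "\<alpha> * (k + 1) / k > 0" using basic by simp
  then show "\<sigma> > 0" "\<sigma>\<^sup>2 = \<alpha> + \<alpha> / k"
    unfolding \<sigma>_def using basic(7) by (simp_all add: algebra_simps add_divide_distrib)
qed

text \<open>The coefficient \<open>g = 1 / (r + 1)\<close> solves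
  \<open>k * g\<^sup>2 + 2 * g = 1\<close>, which says that the shift adds
  \<open>\<alpha> / k\<close> to every inner product and so cancels the off-diagonal
  entries.\<close>

lemma shift_inner:
  assumes "i0 \<in> I" "i \<in> I - {i0}" "p \<in> I - {i0}"
  shows "(a i - (1 / (r + 1)) *\<^sub>R a i0) \<bullet> (a p - (1 / (r + 1)) *\<^sub>R a i0) = (if i = p then \<sigma>\<^sup>2 else 0)"
proof -
  define g where "g = 1 / (r + 1)"
  have k: "k * g = r - 1" using r(2) by (simp add: g_def)
  have g1: "(r + 1) * g = 1" using r(1) by (simp add: g_def)
  have "k * g\<^sup>2 + 2 * g = (k * g) * g + 2 * g" by (simp add: power2_eq_square)
  also have "\<dots> = (r + 1) * g" unfolding k by (simp add: algebra_simps)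
  finally have kg: "k * g\<^sup>2 + 2 * g = 1" unfolding g1 .
  have "g\<^sup>2 + 2 * g / k = (k * g\<^sup>2 + 2 * g) / k" using basic by (simp add: field_simps)
  then have "g\<^sup>2 + 2 * g / k = 1 / k" unfolding kg .
  moreover have "g\<^sup>2 * \<alpha> + 2 * g * \<alpha> / k = (g\<^sup>2 + 2 * g / k) * \<alpha>" by (simp add: algebra_simps)
  ultimately have g: "g\<^sup>2 * \<alpha> + 2 * g * \<alpha> / k = \<alpha> / k" by simp
  have "(a i - g *\<^sub>R a i0) \<bullet> (a p - g *\<^sub>R a i0) = a i \<bullet> a p + (g\<^sup>2 * \<alpha> + 2 * g * \<alpha> / k)"
  proof -
    have "i0 \<noteq> i" "i0 \<noteq> p" "i \<noteq> i0" "p \<noteq> i0" "i \<in> I" "p \<in> I" using assms by auto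
    then show ?thesis using assms(1)
      by (simp add: inner_diff_left inner_diff_right inner_aa power2_eq_square algebra_simps)
  qed
  then show ?thesis unfolding g using assms by (auto simp: g_def[symmetric] inner_aa \<sigma>)
qed

lemma frame_inner:
  assumes "i0 \<in> I" "i \<in> I - {i0}" "p \<in> I - {i0}"
  shows "frame i0 i \<bullet> frame i0 p = (if i = p then 1 else 0)"
proof -
  have "frame i0 i \<bullet> frame i0 p = (if i = p then \<sigma>\<^sup>2 else 0) / \<sigma>\<^sup>2"
    unfolding shift_inner[OF assms, symmetric] frame_def by (simp add: power2_eq_square divide_inverse)
  then show ?thesis using \<sigma>(1) by simp
qed

lemma frame_orthonormal:
  assumes "i0 \<in> I"
  shows "orthonormal (frame i0 ` (I - {i0}))" "card (frame i0 ` (I - {i0})) = card I - 1"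
proof -
  have "inj_on (frame i0) (I - {i0})"
  proof (rule inj_onI, rule ccontr)
    fix i p assume ip: "i \<in> I - {i0}" "p \<in> I - {i0}" "frame i0 i = frame i0 p" "i \<noteq> p"
    then show False using frame_inner[OF assms ip(1,2)] frame_inner[OF assms ip(1,1)] by simp
  qed
  then show "orthonormal (frame i0 ` (I - {i0}))" "card (frame i0 ` (I - {i0})) = card I - 1"
    using frame_inner[OF assms] assms basic(1) by (auto simp: orthonormal_def card_image inj_on_def)
qed

text \<open>The functional \<open>u\<close> takes the value \<open>1\<close> at every vertex but
  \<open>a i0\<close>, so one rank-one map shifts all of them by the same vector; its determinant is
  \<open>1 + k * g = r\<close>.\<close>

lemma emeasure_shift:
  assumes i0: "i0 \<in> I" and B: "finite B" "\<And>v. v \<in> B \<Longrightarrow> a i0 \<bullet> v = 0"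
  shows "emeasure lborel (convex hull (insert 0 ((\<lambda>i. a i - (1 / (r + 1)) *\<^sub>R a i0) ` (I - {i0}) \<union> B)))
    = ennreal r * emeasure lborel (convex hull (insert 0 (a ` (I - {i0}) \<union> B)))"
proof -
  define g where "g = 1 / (r + 1)"
  define u where "u = (- (k / \<alpha>)) *\<^sub>R a i0"
  have ua: "u \<bullet> a i = 1" if "i \<in> I - {i0}" for i using that i0 basic by (auto simp: u_def inner_aa)
  have ub: "u \<bullet> v = 0" if "v \<in> B" for v using B that by (simp add: u_def)
  have "u \<bullet> ((- g) *\<^sub>R a i0) = k * g" using i0 basic by (simp add: u_def inner_aa)
  also have "\<dots> = r - 1" using r(2) by (simp add: g_def)
  finally have det: "1 + u \<bullet> ((- g) *\<^sub>R a i0) = r" by simp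
  have "(\<lambda>x. x + (u \<bullet> x) *\<^sub>R ((- g) *\<^sub>R a i0)) ` B = (\<lambda>x. x) ` B" using ub by (intro image_cong) auto
  then have "(\<lambda>x. x + (u \<bullet> x) *\<^sub>R ((- g) *\<^sub>R a i0)) ` B = B" by simp
  moreover have "(\<lambda>x. x + (u \<bullet> x) *\<^sub>R ((- g) *\<^sub>R a i0)) ` a ` (I - {i0}) = (\<lambda>i. a i - g *\<^sub>R a i0) ` (I - {i0})"
    unfolding image_image using ua by (intro image_cong) auto
  ultimately have "(\<lambda>x. x + (u \<bullet> x) *\<^sub>R ((- g) *\<^sub>R a i0)) ` (insert 0 (a ` (I - {i0}) \<union> B))
      = insert 0 ((\<lambda>i. a i - g *\<^sub>R a i0) ` (I - {i0}) \<union> B)"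
    by (simp add: image_Un)
  moreover have "emeasure lborel (convex hull ((\<lambda>x. x + (u \<bullet> x) *\<^sub>R ((- g) *\<^sub>R a i0)) ` (insert 0 (a ` (I - {i0}) \<union> B))))
     = ennreal \<bar>1 + u \<bullet> ((- g) *\<^sub>R a i0)\<bar> * emeasure lborel (convex hull (insert 0 (a ` (I - {i0}) \<union> B)))"
    using basic B det r(1) by (intro emeasure_rank_one_hull) auto
  ultimately show ?thesis unfolding det using r(1) by (simp add: g_def)
qed

lemma emeasure_shift_scale:
  assumes i0: "i0 \<in> I" and B: "finite B" "\<And>i v. i \<in> I \<Longrightarrow> v \<in> B \<Longrightarrow> a i \<bullet> v = 0"
  shows "ennreal r * emeasure lborel (convex hull (insert 0 (a ` (I - {i0}) \<union> B)))
    = ennreal (\<sigma> ^ (card I - 1)) * emeasure lborel (convex hull (insert 0 (frame i0 ` (I - {i0}) \<union> B)))"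
proof -
  have im: "(\<lambda>i. a i - (1 / (r + 1)) *\<^sub>R a i0) ` (I - {i0}) = (*\<^sub>R) \<sigma> ` frame i0 ` (I - {i0})"
    unfolding image_image frame_def using \<sigma>(1) by simp
  have perp: "f \<bullet> v = 0" if "f \<in> frame i0 ` (I - {i0})" "v \<in> B" for f v
    using that B(2) i0 by (auto simp: frame_def inner_diff_left)
  show ?thesis
    using emeasure_shift[OF i0 B(1)] B(2)[OF i0]
      emeasure_scale_orthonormal[OF _ frame_orthonormal(1)[OF i0] B(1) perp \<sigma>(1)] basic(1)
    unfolding im frame_orthonormal(2)[OF i0] by simp
qed

end

section \<open>The smallest volume for given dimensions\<close>

text \<open>The weighted inequality of arithmetic and geometric means, from
  \<open>z \<le> exp (z - 1)\<close> applied to each factor.\<close>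

lemma weighted_power_le_one:
  fixes x y :: real
  assumes "x \<ge> 0" "y \<ge> 0" "real K * x + real L * y \<le> real K + real L"
  shows "x ^ K * y ^ L \<le> 1"
proof -
  have e: "z ^ n \<le> exp (real n * (z - 1))" if "z \<ge> 0" for z :: real and n
  proof -
    have "z \<le> exp (z - 1)" using exp_ge_add_one_self[of "z - 1"] by simp
    then have "z ^ n \<le> exp (z - 1) ^ n" using that by (intro power_mono)
    then show ?thesis by (simp add: exp_of_nat_mult)
  qed
  have "x ^ K * y ^ L \<le> exp (real K * (x - 1)) * exp (real L * (y - 1))"
    using assms e by (intro mult_mono) auto
  also have "\<dots> = exp (real K * (x - 1) + real L * (y - 1))" by (simp add: exp_add)
  also have "\<dots> \<le> 1" using assms(3) by (simp add: algebra_simps)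
  finally show ?thesis .
qed

definition psi :: "nat \<Rightarrow> nat \<Rightarrow> real" where
  "psi d k = real (k + 1) ^ (k + 1) * real (d - k + 1) ^ (d - k + 1)"

lemma psi_pos: "psi d k > 0" by (simp add: psi_def)

text \<open>The logarithm of \<open>psi d k\<close> is \<open>g (k + 1)\<close> with
  \<open>g x = x * ln x + (D - x) * ln (D - x)\<close> and \<open>D = d + 2\<close>; the derivative
  \<open>ln x - ln (D - x)\<close> is negative below the midpoint \<open>D / 2\<close>, and
  \<open>m + 1\<close> does not exceed it.\<close>

lemma psi_strict:
  assumes "k < m" "2 * m \<le> d" shows "psi d m < psi d k"
proof -
  define D where "D = real d + 2"
  define g where "g x = x * ln x + (D - x) * ln (D - x)" for x :: real
  have g: "ln (psi d j) = g (real (j + 1))" if "j \<le> d" for j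
  proof -
    have e: "D - real (j + 1) = real (d - j + 1)" using that by (simp add: D_def of_nat_diff)
    have "ln (psi d j) = ln (real (j + 1) ^ (j + 1)) + ln (real (d - j + 1) ^ (d - j + 1))"
      unfolding psi_def by (intro ln_mult_pos) simp_all
    also have "\<dots> = real (j + 1) * ln (real (j + 1)) + real (d - j + 1) * ln (real (d - j + 1))"
      by (simp only: ln_realpow of_nat_0_less_iff zero_less_Suc Suc_eq_plus1[symmetric])
    finally show ?thesis unfolding g_def e .
  qed
  have "g (real (m + 1)) < g (real (k + 1))"
  proof (rule DERIV_neg_imp_decreasing_open[where f = g and a = "real (k + 1)" and b = "real (m + 1)"])
    show "real (k + 1) < real (m + 1)" using assms by simp
    show "\<exists>y. (g has_real_derivative y) (at x) \<and> y < 0" if x: "real (k + 1) < x" "x < real (m + 1)" for x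
    proof -
      have x0: "0 < x" "x < D - x" using x assms by (auto simp: D_def)
      have "(g has_real_derivative ln x - ln (D - x)) (at x)"
        unfolding g_def using x0 by (auto intro!: derivative_eq_intros)
      moreover have "ln x - ln (D - x) < 0" using x0 by simp
      ultimately show ?thesis by blast
    qed
    have "D - x > 0" if "x \<in> {real (k + 1)..real (m + 1)}" for x using that assms by (auto simp: D_def)
    then show "continuous_on {real (k + 1)..real (m + 1)} g"
      unfolding g_def by (intro continuous_intros) (auto simp: less_imp_neq[symmetric])
  qed
  then have "ln (psi d m) < ln (psi d k)" using g[of m] g[of k] assms by simp
  then show ?thesis using psi_pos by simp
qed

context cross
begin

text \<open>The number of cells \<open>(k + 1) * (l + 1)\<close> is the square of the product of
  both constants \<open>r\<close>, and passing to the orthonormal frames divides by each constant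
  once, so each survives to the first power. The corner spanned by the frames is left
  unevaluated.\<close>

lemma emeasure_Q_frame:
  assumes i0: "i0 \<in> I" and j0: "j0 \<in> J"
  shows "emeasure lborel Q = ennreal (cross.r k * cross.r l * cross.\<sigma> \<alpha> k ^ (card I - 1) * cross.\<sigma> \<gamma> l ^ (card J - 1))
    * emeasure lborel (convex hull (insert 0 (cross.frame a \<alpha> k i0 ` (I - {i0}) \<union> cross.frame b \<gamma> l j0 ` (J - {j0}))))"
proof -
  interpret f: cross J I b a \<gamma> \<alpha> l k by (rule flip)
  define F1 where "F1 = frame i0 ` (I - {i0})"
  define F2 where "F2 = f.frame j0 ` (J - {j0})"
  define A where "A = emeasure lborel (cell i0 j0)"
  define B where "B = emeasure lborel (convex hull (insert 0 (F1 \<union> b ` (J - {j0}))))"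
  define C where "C = emeasure lborel (convex hull (insert 0 (F1 \<union> F2)))"
  have AB: "ennreal r * A = ennreal (\<sigma> ^ (card I - 1)) * B"
    unfolding A_def B_def cell_def F1_def
    by (rule emeasure_shift_scale[OF i0]) (use basic in \<open>auto simp: inner_ab\<close>)
  have "b j \<bullet> v = 0" if "j \<in> J" "v \<in> F1" for j v
    using that i0 by (auto simp: F1_def frame_def inner_diff_right inner_ab)
  then have BC: "ennreal f.r * B = ennreal (f.\<sigma> ^ (card J - 1)) * C"
    using f.emeasure_shift_scale[OF j0, of F1] basic(1)
    unfolding B_def C_def F2_def by (simp add: Un_commute F1_def)
  have rr: "r > 0" "f.r > 0" "\<sigma> > 0" "f.\<sigma> > 0" using r f.r \<sigma> f.\<sigma> by auto
  have "emeasure lborel Q = ennreal ((r * f.r) * (f.r * r)) * A"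
    unfolding emeasure_Q_cell[OF i0 j0] A_def r(3)[symmetric] f.r(3)[symmetric] by (simp add: power2_eq_square mult_ac)
  also have "\<dots> = ennreal (r * f.r) * (ennreal f.r * (ennreal r * A))"
    using rr by (simp add: ennreal_mult mult.assoc)
  also have "\<dots> = ennreal (r * f.r) * (ennreal (\<sigma> ^ (card I - 1)) * (ennreal f.r * B))"
    unfolding AB by (simp add: mult_ac)
  also have "\<dots> = ennreal (r * f.r) * (ennreal (\<sigma> ^ (card I - 1)) * (ennreal (f.\<sigma> ^ (card J - 1)) * C))"
    unfolding BC ..
  also have "\<dots> = ennreal (r * f.r * \<sigma> ^ (card I - 1) * f.\<sigma> ^ (card J - 1)) * C"
    using rr by (simp add: ennreal_mult mult.assoc)
  finally show ?thesis by (simp add: C_def F1_def F2_def)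
qed

text \<open>Squaring clears the roots and splits off the factor \<open>psi\<close>, which depends on
  the dimensions only; the circumradii stay in the other factor.\<close>

lemma coefficient_square:
  "(cross.r k * cross.r l * cross.\<sigma> \<alpha> k ^ (card I - 1) * cross.\<sigma> \<gamma> l ^ (card J - 1))\<^sup>2
    = psi DIM('a) (card I - 1) * ((\<alpha> / k) ^ (card I - 1) * (\<gamma> / l) ^ (card J - 1))"
proof -
  interpret f: cross J I b a \<gamma> \<alpha> l k by (rule flip)
  have s: "\<sigma>\<^sup>2 = (k + 1) * (\<alpha> / k)" "f.\<sigma>\<^sup>2 = (l + 1) * (\<gamma> / l)"
    using \<sigma>(2) f.\<sigma>(2) basic by (simp_all add: field_simps)
  have c: "real (card I - 1 + 1) = k + 1" "real (DIM('a) - (card I - 1) + 1) = l + 1"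
    "DIM('a) - (card I - 1) = card J - 1"
    using basic cIJ by (auto simp: of_nat_diff)
  have "(r * f.r * \<sigma> ^ (card I - 1) * f.\<sigma> ^ (card J - 1))\<^sup>2
     = r\<^sup>2 * f.r\<^sup>2 * (\<sigma>\<^sup>2) ^ (card I - 1) * (f.\<sigma>\<^sup>2) ^ (card J - 1)"
    by (simp add: power_mult_distrib power_mult[symmetric] mult.commute)
  also have "\<dots> = (k + 1) * (l + 1) * ((k + 1) * (\<alpha> / k)) ^ (card I - 1) * ((l + 1) * (\<gamma> / l)) ^ (card J - 1)"
    unfolding r(3) f.r(3) s ..
  also have "\<dots> = psi DIM('a) (card I - 1) * ((\<alpha> / k) ^ (card I - 1) * (\<gamma> / l) ^ (card J - 1))"
  proof -
    have "A * B * (A * x) ^ n * (B * y) ^ p = (A ^ (n + 1) * B ^ (p + 1)) * (x ^ n * y ^ p)" for A B x y :: real and n p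
      by (simp add: power_mult_distrib)
    then show ?thesis unfolding psi_def c(1,2) unfolding c(3) by blast
  qed
  finally show ?thesis .
qed

text \<open>After normalization to \<open>x\<close> and \<open>y\<close> the inradius condition
  reads \<open>k * x + l * y \<le> k + l\<close>, so means can be compared. The bound is attained at
  \<open>x = y = 1\<close>, that is, when \<open>\<alpha> / k\<close> and
  \<open>\<gamma> / l\<close> both equal \<open>d * R\<^sup>2\<close>.\<close>

lemma coefficient_lower_bound:
  assumes R: "R > 0" "R\<^sup>2 * (k\<^sup>2 / \<alpha> + l\<^sup>2 / \<gamma>) \<le> 1"
  shows "(R\<^sup>2 * real DIM('a)) ^ DIM('a) \<le> (\<alpha> / k) ^ (card I - 1) * (\<gamma> / l) ^ (card J - 1)"
proof -
  define d where "d = real DIM('a)"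
  have dkl: "d = k + l" using basic(11,12) cIJ unfolding d_def by linarith
  have KL: "real (card I - 1) = k" "real (card J - 1) = l" using basic by (auto simp: of_nat_diff)
  have dsum: "DIM('a) = (card I - 1) + (card J - 1)" using cIJ basic(3,4) by simp
  define x where "x = R\<^sup>2 * d * (k / \<alpha>)"
  define y where "y = R\<^sup>2 * d * (l / \<gamma>)"
  have d0: "d > 0" using basic dkl by simp
  have xy: "x > 0" "y > 0" using R d0 basic by (auto simp: x_def y_def)
  have "k * x + l * y = d * (R\<^sup>2 * (k\<^sup>2 / \<alpha> + l\<^sup>2 / \<gamma>))"
    by (simp add: x_def y_def power2_eq_square algebra_simps)
  also have "\<dots> \<le> d * 1" using R(2) d0 by (intro mult_left_mono) auto
  finally have "k * x + l * y \<le> d" by simp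
  then have "real (card I - 1) * x + real (card J - 1) * y \<le> real (card I - 1) + real (card J - 1)"
    unfolding KL dkl .
  then have "x ^ (card I - 1) * y ^ (card J - 1) \<le> 1"
    using xy by (intro weighted_power_le_one) auto
  moreover have "R\<^sup>2 * d = x * (\<alpha> / k)" "R\<^sup>2 * d = y * (\<gamma> / l)"
    using basic by (auto simp: x_def y_def)
  then have "(R\<^sup>2 * d) ^ DIM('a) = (x * (\<alpha> / k)) ^ (card I - 1) * (y * (\<gamma> / l)) ^ (card J - 1)"
    unfolding dsum power_add by simp
  then have "(R\<^sup>2 * d) ^ DIM('a) = (x ^ (card I - 1) * y ^ (card J - 1)) * ((\<alpha> / k) ^ (card I - 1) * (\<gamma> / l) ^ (card J - 1))"
    by (simp only: power_mult_distrib mult_ac)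
  moreover have "(\<alpha> / k) ^ (card I - 1) * (\<gamma> / l) ^ (card J - 1) \<ge> 0" using basic by simp
  ultimately show ?thesis unfolding d_def by (metis mult_left_le_one_le mult.commute mult_right_mono mult_1)
qed

end

section \<open>Regular simplices rebuilt from orthonormal vectors\<close>

text \<open>Inverse of the construction \<open>cross.frame\<close>, with \<open>s\<close> in the
  role of \<open>\<sigma>\<close>. The vertices are indexed by \<open>F\<close> together with
  \<open>0\<close>, which is not a unit vector; the vertex \<open>z\<close> at index
  \<open>0\<close> is the negative multiple of the sum of \<open>F\<close> that has squared norm
  \<open>\<alpha>\<close>.\<close>

definition simplex_of_frame :: "'a::euclidean_space set \<Rightarrow> real \<Rightarrow> 'a \<Rightarrow> 'a" where
  "simplex_of_frame F \<alpha> p = (let m = real (card F); r = sqrt (m + 1); s = sqrt (\<alpha> * (m + 1) / m);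
     z = - (s / r) *\<^sub>R \<Sum>F in if p = 0 then z else s *\<^sub>R p + (1 / (r + 1)) *\<^sub>R z)"

lemma simplex_of_frame:
  fixes F :: "'a::euclidean_space set"
  assumes F: "finite F" "orthonormal F" "card F \<ge> 1" and \<alpha>: "\<alpha> > 0"
  shows "centred_simplex (insert 0 F) (simplex_of_frame F \<alpha>) \<alpha>"
    and "card (insert 0 F) = card F + 1" "0 \<notin> F"
    and "p \<in> F \<Longrightarrow> (simplex_of_frame F \<alpha> p - (1 / (sqrt (real (card F) + 1) + 1)) *\<^sub>R simplex_of_frame F \<alpha> 0)
        /\<^sub>R sqrt (\<alpha> * (real (card F) + 1) / real (card F)) = p"
    and "(\<And>f. f \<in> F \<Longrightarrow> f \<bullet> v = 0) \<Longrightarrow> q \<in> insert 0 F \<Longrightarrow> simplex_of_frame F \<alpha> q \<bullet> v = 0"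
proof -
  define m where "m = real (card F)"
  define r where "r = sqrt (m + 1)"
  define s where "s = sqrt (\<alpha> * (m + 1) / m)"
  define g where "g = 1 / (r + 1)"
  define z where "z = - (s / r) *\<^sub>R \<Sum>F"
  have z0: "simplex_of_frame F \<alpha> 0 = z"
    by (simp add: simplex_of_frame_def Let_def z_def m_def r_def s_def)
  have zn: "simplex_of_frame F \<alpha> p = s *\<^sub>R p + g *\<^sub>R z" if "p \<noteq> 0" for p
    using that by (simp add: simplex_of_frame_def Let_def z_def m_def r_def s_def g_def)
  show nF: "0 \<notin> F" using F(2) unfolding orthonormal_def by (metis inner_zero_left zero_neq_one)
  show cF: "card (insert 0 F) = card F + 1" using nF F(1) by simp
  have m1: "m \<ge> 1" using F(3) by (simp add: m_def)
  have r2: "r\<^sup>2 = m + 1" and r0: "r > 0" using m1 by (auto simp: r_def)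
  have s2: "s\<^sup>2 = \<alpha> * r\<^sup>2 / m" and s0: "s > 0" unfolding r2 using m1 \<alpha> by (auto simp: s_def)
  have mr: "m = (r - 1) * (r + 1)" using r2 by (simp add: power2_eq_square algebra_simps)
  have mg: "m * g = r - 1" using r0 by (subst mr) (simp add: g_def)
  have fw: "p \<bullet> \<Sum>F = 1" if "p \<in> F" for p
  proof -
    have "p \<bullet> \<Sum>F = (\<Sum>q\<in>F. if q = p then 1 else 0)"
      unfolding inner_sum_right using F(2) that by (intro sum.cong) (auto simp: orthonormal_def)
    then show ?thesis using F(1) that by simp
  qed
  have "\<Sum>F \<bullet> \<Sum>F = m" by (subst (1) inner_sum_left) (simp add: fw m_def)
  then have zz: "z \<bullet> z = \<alpha>" using s2 r0 m1 by (simp add: z_def power2_eq_square field_simps)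
  have pz: "p \<bullet> z = - s / r" if "p \<in> F" for p using fw[OF that] by (simp add: z_def)
  have spz: "s * (- s / r) = - \<alpha> * r / m" using s2 r0 m1 by (simp add: power2_eq_square field_simps)
  have za: "(s *\<^sub>R p + g *\<^sub>R z) \<bullet> z = - \<alpha> / m" if "p \<in> F" for p
  proof -
    have "(s *\<^sub>R p + g *\<^sub>R z) \<bullet> z = s * (- s / r) + g * \<alpha>" by (simp add: inner_add_left pz[OF that] zz)
    also have "\<dots> = \<alpha> * (m * g - r) / m" unfolding spz using m1 by (simp add: field_simps)
    finally show ?thesis unfolding mg by simp
  qed
  have pq: "(s *\<^sub>R p + g *\<^sub>R z) \<bullet> (s *\<^sub>R q + g *\<^sub>R z) = (if p = q then \<alpha> else - \<alpha> / m)" if "p \<in> F" "q \<in> F" for p q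
  proof -
    have "(s *\<^sub>R p + g *\<^sub>R z) \<bullet> (s *\<^sub>R q + g *\<^sub>R z) = s\<^sup>2 * (p \<bullet> q) + g * (s * (p \<bullet> z)) + g * ((s *\<^sub>R q + g *\<^sub>R z) \<bullet> z)"
      by (simp add: inner_add_left inner_add_right inner_commute power2_eq_square algebra_simps)
    also have "\<dots> = s\<^sup>2 * (p \<bullet> q) + g * (- \<alpha> * r / m) + g * (- \<alpha> / m)"
      unfolding za[OF that(2)] pz[OF that(1)] spz ..
    also have "\<dots> = s\<^sup>2 * (p \<bullet> q) - \<alpha> / m * (g * (r + 1))" by (simp add: algebra_simps)
    also have "g * (r + 1) = 1" using r0 by (simp add: g_def)
    also have "s\<^sup>2 = \<alpha> + \<alpha> / m" unfolding s2 r2 using m1 by (simp add: field_simps)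
    finally show ?thesis using F(2) that by (auto simp: orthonormal_def)
  qed
  have "(\<Sum>p\<in>insert 0 F. simplex_of_frame F \<alpha> p) = z + (\<Sum>p\<in>F. simplex_of_frame F \<alpha> p)"
    using nF F(1) by (simp add: z0)
  also have "(\<Sum>p\<in>F. simplex_of_frame F \<alpha> p) = (\<Sum>p\<in>F. s *\<^sub>R p + g *\<^sub>R z)"
    using nF by (intro sum.cong refl zn) auto
  also have "\<dots> = s *\<^sub>R \<Sum>F + (m * g) *\<^sub>R z"
    by (simp add: sum.distrib scaleR_right.sum sum_constant_scaleR m_def)
  also have "z + (s *\<^sub>R \<Sum>F + (m * g) *\<^sub>R z) = r *\<^sub>R z + s *\<^sub>R \<Sum>F"
    unfolding mg by (simp add: algebra_simps)
  also have "\<dots> = 0" using r0 by (simp add: z_def)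
  finally have S0: "(\<Sum>p\<in>insert 0 F. simplex_of_frame F \<alpha> p) = 0" .
  have ne: "p \<noteq> 0" if "p \<in> F" for p using that nF by auto
  have all: "simplex_of_frame F \<alpha> p \<bullet> simplex_of_frame F \<alpha> q = (if p = q then \<alpha> else - \<alpha> / m)"
    if "p \<in> insert 0 F" "q \<in> insert 0 F" for p q
  proof (cases "p = 0")
    case True
    show ?thesis
    proof (cases "q = 0")
      case False
      then have q: "q \<in> F" using that by simp
      show ?thesis using True False za[OF q] by (simp add: z0 zn inner_commute)
    qed (use True zz in \<open>simp add: z0\<close>)
  next
    case False
    then have p: "p \<in> F" using that by simp
    show ?thesis
    proof (cases "q = 0")
      case True
      then show ?thesis using False za[OF p] by (simp add: z0 zn)
    next
      case q: False
      then have "q \<in> F" using that by simp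
      then show ?thesis using False q pq[OF p] by (simp add: zn)
    qed
  qed
  show "centred_simplex (insert 0 F) (simplex_of_frame F \<alpha>) \<alpha>"
    unfolding centred_simplex_def
  proof (intro conjI ballI impI)
    show "finite (insert 0 F)" "card (insert 0 F) \<ge> 2" "\<alpha> > 0" using F(1,3) cF \<alpha> by auto
    show "(\<Sum>i\<in>insert 0 F. simplex_of_frame F \<alpha> i) = 0" by (rule S0)
    show "simplex_of_frame F \<alpha> i \<bullet> simplex_of_frame F \<alpha> i = \<alpha>" if "i \<in> insert 0 F" for i
      using all[OF that that] by simp
    show "simplex_of_frame F \<alpha> i \<bullet> simplex_of_frame F \<alpha> j = - \<alpha> / (real (card (insert 0 F)) - 1)"
      if "i \<in> insert 0 F" "j \<in> insert 0 F" "i \<noteq> j" for i j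
      using all[OF that(1,2)] that(3) unfolding cF by (simp add: m_def)
  qed
  show "p \<in> F \<Longrightarrow> (simplex_of_frame F \<alpha> p - (1 / (sqrt (real (card F) + 1) + 1)) *\<^sub>R simplex_of_frame F \<alpha> 0)
        /\<^sub>R sqrt (\<alpha> * (real (card F) + 1) / real (card F)) = p"
    unfolding m_def[symmetric] r_def[symmetric] s_def[symmetric] g_def[symmetric] z0
    using zn[OF ne] s0 by simp
  show "simplex_of_frame F \<alpha> q \<bullet> v = 0" if v: "\<And>f. f \<in> F \<Longrightarrow> f \<bullet> v = 0" and q: "q \<in> insert 0 F"
  proof -
    have "\<Sum>F \<bullet> v = 0" unfolding inner_sum_left using v by simp
    then have "z \<bullet> v = 0" by (simp add: z_def)
    then show ?thesis using q v by (cases "q = 0") (auto simp: z0 zn inner_add_left)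
  qed
qed

section \<open>Isometries of the model space\<close>

text \<open>The distance from the centre is \<open>arcosh (1 / sqrt (1 - (norm x)\<^sup>2))\<close>;
  monotonicity of \<open>arcosh\<close> and the identity between \<open>tanh\<close> and
  \<open>cosh\<close> turn the bound \<open>r\<close> into the Euclidean radius
  \<open>tanh r\<close>.\<close>

lemma mball_hyp_zero:
  assumes r: "r > 0"
  shows "mball True (0::'a::euclidean_space) r = cball 0 (tanh r)"
proof -
  have t: "0 < tanh r" "tanh r < 1" using r by (auto simp: tanh_real_lt_1)
  have "norm x < 1 \<and> mdist True 0 x \<le> r \<longleftrightarrow> norm x \<le> tanh r" for x :: 'a
  proof (cases "norm x < 1")
    case True
    define q where "q = 1 - (norm x)\<^sup>2"
    have q: "0 < q" "q \<le> 1" using True by (auto simp: q_def power_less_one_iff abs_square_less_1)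
    have c0: "cosh r > 0" by simp
    have y1: "1 \<le> 1 / sqrt q" using q by (simp add: field_simps)
    have "mdist True 0 x \<le> r \<longleftrightarrow> arcosh (1 / sqrt q) \<le> arcosh (cosh r)"
      using r by (simp add: mdist_def q_def arcosh_cosh_real)
    also have "\<dots> \<longleftrightarrow> 1 / sqrt q \<le> cosh r"
      using arcosh_less_iff_real[OF cosh_real_ge_1 y1, of r] by linarith
    also have "\<dots> \<longleftrightarrow> (1 / sqrt q)\<^sup>2 \<le> (cosh r)\<^sup>2" using c0 q abs_le_square_iff[of "1 / sqrt q" "cosh r"] by simp
    also have "\<dots> \<longleftrightarrow> (norm x)\<^sup>2 \<le> (tanh r)\<^sup>2"
    proof -
      have "(tanh r)\<^sup>2 = 1 - 1 / (cosh r)\<^sup>2"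
      proof -
        have "(sinh r)\<^sup>2 = (cosh r)\<^sup>2 - 1" using cosh_square_eq[of r] by simp
        then show ?thesis using c0 by (simp add: tanh_def power_divide diff_divide_distrib)
      qed
      moreover have "(1 / sqrt q)\<^sup>2 = 1 / q" using q by (simp add: power_divide)
      moreover have "1 / q \<le> (cosh r)\<^sup>2 \<longleftrightarrow> 1 / (cosh r)\<^sup>2 \<le> q" using q c0 by (simp add: field_simps)
      ultimately show ?thesis by (simp add: q_def) linarith
    qed
    also have "\<dots> \<longleftrightarrow> norm x \<le> tanh r" using t by (simp add: abs_le_square_iff[symmetric])
    finally show ?thesis using True by simp
  next
    case False
    then show ?thesis using t by auto
  qed
  then show ?thesis unfolding mball_def Mpts_def by (intro set_eqI) (simp only: mem_Collect_eq if_True mem_cball_0)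
qed

lemma mball_euclidean: "mball False c r = cball c r"
  by (auto simp: mball_def Mpts_def mdist_def)

text \<open>The hyperbolic density is continued by infinity outside the model, so that it is
  radially nondecreasing on the whole space and symmetrization needs no domain restriction.\<close>

definition weight :: "bool \<Rightarrow> 'a::euclidean_space \<Rightarrow> ennreal" where
  "weight hyp x = (if hyp then (if norm x < 1 then ennreal ((1 - (norm x)\<^sup>2) powr (- (real DIM('a) + 1) / 2)) else \<infinity>) else 1)"

lemma borel_measurable_weight [measurable]: "(weight hyp :: 'a::euclidean_space \<Rightarrow> ennreal) \<in> borel_measurable borel"
proof -
  have "(\<lambda>x::'a. if norm x < 1 then ennreal ((1 - (norm x)\<^sup>2) powr (- (real DIM('a) + 1) / 2)) else \<infinity>)
      \<in> borel_measurable borel"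
    unfolding powr_def by measurable
  then show ?thesis unfolding weight_def[abs_def] by (cases hyp) simp_all
qed

lemma weight_mono:
  fixes x y :: "'a::euclidean_space"
  assumes "norm x \<le> norm y" shows "weight hyp x \<le> weight hyp y"
proof (cases "hyp \<and> norm y < 1")
  case True
  have "(norm x)\<^sup>2 \<le> (norm y)\<^sup>2" using assms by (intro power_mono) auto
  moreover have "(norm y)\<^sup>2 < 1" using True by (simp add: power_less_one_iff abs_square_less_1)
  ultimately have "(1 - (norm x)\<^sup>2) powr (- (real DIM('a) + 1) / 2) \<le> (1 - (norm y)\<^sup>2) powr (- (real DIM('a) + 1) / 2)"
    by (intro powr_mono2') auto
  then show ?thesis using True assms by (simp add: weight_def ennreal_leI)
next
  case False
  then show ?thesis by (cases hyp) (auto simp: weight_def)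
qed

text \<open>On a compact set inside the model the density is continuous, hence Lebesgue integrable,
  so the gauge integral in \<open>mvol\<close> agrees with the nonnegative integral for which the
  symmetrization is proved.\<close>

lemma mvol_eq_nn_integral:
  fixes S :: "'a::euclidean_space set"
  assumes S: "compact S" "S \<subseteq> Mpts hyp"
  shows "ennreal (mvol hyp S) = mass (weight hyp) S" "mvol hyp S \<ge> 0"
proof -
  define f where "f x = (if hyp then (1 - (norm x)\<^sup>2) powr (- (real DIM('a) + 1) / 2) else 1)" for x :: 'a
  have f0: "f x \<ge> 0" for x by (simp add: f_def)
  have "continuous_on S f"
  proof (cases hyp)
    case True
    have "1 - (norm x)\<^sup>2 \<noteq> 0" if "x \<in> S" for x
      using S(2) that True abs_square_less_1[of "norm x"] by (auto simp: Mpts_def)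
    then have "continuous_on S (\<lambda>x. (1 - (norm x)\<^sup>2) powr (- (real DIM('a) + 1) / 2))"
      by (intro continuous_intros) auto
    then show ?thesis using True by (simp add: f_def)
  next
    case False
    then show ?thesis by (simp add: f_def)
  qed
  then have i: "set_integrable lborel S f"
    unfolding set_integrable_def by (rule borel_integrable_compact[OF S(1)])
  have m: "mvol hyp S = integral S f" unfolding mvol_def f_def ..
  also have "\<dots> = (LINT x:S|lborel. f x)" using set_borel_integral_eq_integral(2)[OF i] by simp
  finally have mv: "mvol hyp S = (LINT x:S|lborel. f x)" .
  show "mvol hyp S \<ge> 0" unfolding mv set_lebesgue_integral_def
    by (intro integral_nonneg_AE) (auto simp: f0)
  have "ennreal (mvol hyp S) = (\<integral>\<^sup>+x. ennreal (indicator S x *\<^sub>R f x) \<partial>lborel)"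
    unfolding mv set_lebesgue_integral_def
    using i by (intro nn_integral_eq_integral[symmetric]) (auto simp: set_integrable_def f0)
  also have "\<dots> = mass (weight hyp) S"
    using S(2) by (intro nn_integral_cong) (auto simp: indicator_def weight_def f_def Mpts_def)
  finally show "ennreal (mvol hyp S) = mass (weight hyp) S" .
qed

lemma mvol_le:
  fixes S T :: "'a::euclidean_space set"
  assumes "compact S" "S \<subseteq> Mpts hyp" "compact T" "T \<subseteq> Mpts hyp"
    "mass (weight hyp) S \<le> mass (weight hyp) T"
  shows "mvol hyp S \<le> mvol hyp T"
proof -
  have "ennreal (mvol hyp S) \<le> ennreal (mvol hyp T)"
    unfolding mvol_eq_nn_integral(1)[OF assms(1,2)] mvol_eq_nn_integral(1)[OF assms(3,4)] by (rule assms(5))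
  then show ?thesis
    by (rule ennreal_le_iff[OF mvol_eq_nn_integral(2)[OF assms(3,4)], THEN iffD1])
qed

lemma convex_Mpts: "convex (Mpts hyp)"
proof -
  have "{x::'a. norm x < 1} = ball 0 1" by auto
  then show ?thesis by (simp add: Mpts_def)
qed

text \<open>The isometry \<open>T\<close> of the model takes \<open>0\<close> to \<open>c\<close>; the linear map \<open>E\<close> is, up to scaling, its
  derivative at \<open>0\<close>.\<close>

locale model_isometry =
  fixes hyp :: bool and c :: "'a::euclidean_space" and T T' E :: "'a \<Rightarrow> 'a"
  assumes T: "\<And>x. x \<in> Mpts hyp \<Longrightarrow> T x \<in> Mpts hyp" "\<And>x. x \<in> Mpts hyp \<Longrightarrow> T' x \<in> Mpts hyp"
    and inv: "\<And>x. x \<in> Mpts hyp \<Longrightarrow> T' (T x) = x" "\<And>x. x \<in> Mpts hyp \<Longrightarrow> T (T' x) = x"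
    and dist: "\<And>x y. x \<in> Mpts hyp \<Longrightarrow> y \<in> Mpts hyp \<Longrightarrow> mdist hyp (T x) (T y) = mdist hyp x y"
    and hull: "\<And>A. finite A \<Longrightarrow> A \<subseteq> Mpts hyp \<Longrightarrow> T ` (convex hull A) = convex hull (T ` A)"
    and dep: "\<And>A. finite A \<Longrightarrow> A \<subseteq> Mpts hyp \<Longrightarrow> affine_dependent (T ` A) \<Longrightarrow> affine_dependent A"
    and vol: "\<And>S. compact S \<Longrightarrow> S \<subseteq> Mpts hyp \<Longrightarrow> compact (T ` S) \<Longrightarrow> mvol hyp (T ` S) = mvol hyp S"
    and T0: "(0::'a) \<in> Mpts hyp" "T 0 = c"
    and E: "linear E" "inj E" "\<And>w. w \<in> Mpts hyp \<Longrightarrow> \<exists>s. T w = c + s *\<^sub>R E w"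
      "\<And>u v. u \<bullet> v = 0 \<Longrightarrow> morth hyp c (E u) (E v)"
begin

lemma mball_image: "T ` mball hyp 0 r = mball hyp c r"
proof -
  have "x \<in> T ` mball hyp 0 r" if x: "x \<in> mball hyp c r" for x
  proof -
    have xM: "x \<in> Mpts hyp" using x by (simp add: mball_def)
    have "mdist hyp c x = mdist hyp 0 (T' x)" using dist[OF T0(1) T(2)[OF xM]] by (simp add: T0 inv xM)
    then have "T' x \<in> mball hyp 0 r" using x T xM by (simp add: mball_def)
    then show ?thesis using inv(2)[OF xM] by force
  qed
  moreover have "T x \<in> mball hyp c r" if "x \<in> mball hyp 0 r" for x
    using that dist[OF T0(1), of x] T by (auto simp: mball_def T0)
  ultimately show ?thesis by auto
qed

lemma hull_subset_Mpts: "A \<subseteq> Mpts hyp \<Longrightarrow> convex hull A \<subseteq> Mpts hyp"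
  using hull_minimal[of A "Mpts hyp" convex] convex_Mpts by blast

lemma mvol_hull_image:
  assumes A: "finite A" "A \<subseteq> Mpts hyp"
  shows "mvol hyp (convex hull (T ` A)) = mvol hyp (convex hull A)"
proof -
  have "compact (convex hull (T ` A))" using A by (intro compact_convex_hull finite_imp_compact) auto
  then show ?thesis using A vol[of "convex hull A"] hull[OF A] hull_subset_Mpts[OF A(2)]
    by (auto intro!: finite_imp_compact_convex_hull)
qed

lemma regular_simplex_image:
  assumes A: "regular_simplex hyp m A" shows "regular_simplex hyp m (T ` A)"
proof -
  have fA: "finite A" "A \<subseteq> Mpts hyp" "card A = m + 1" "\<not> affine_dependent A"
    using A by (auto simp: regular_simplex_def)
  obtain e where e: "\<forall>x\<in>A. \<forall>y\<in>A. x \<noteq> y \<longrightarrow> mdist hyp x y = e" using A by (auto simp: regular_simplex_def)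
  have "inj_on T A" using fA(2) inv(1) by (metis inj_onI subsetD)
  then have "card (T ` A) = m + 1" using fA by (simp add: card_image)
  moreover have "\<not> affine_dependent (T ` A)" using dep fA by blast
  moreover have "\<forall>x\<in>T ` A. \<forall>y\<in>T ` A. x \<noteq> y \<longrightarrow> mdist hyp x y = e"
  proof clarify
    fix x y assume "x \<in> A" "y \<in> A" "T x \<noteq> T y"
    then show "mdist hyp (T x) (T y) = e" using e dist fA(2) by (metis subsetD)
  qed
  ultimately show ?thesis using fA T(1) by (auto simp: regular_simplex_def)
qed

lemma orth_simplex_config_image:
  assumes "orth_simplex_config hyp 0 r k A1 A2"
  shows "orth_simplex_config hyp c r k (T ` A1) (T ` A2)"
proof -
  obtain V1 V2 where V: "subspace V1" "subspace V2" "dim V1 = k" "dim V2 = DIM('a) - k"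
      "\<forall>u\<in>V1. \<forall>v\<in>V2. morth hyp 0 u v" "A1 \<subseteq> (\<lambda>v. 0 + v) ` V1" "A2 \<subseteq> (\<lambda>v. 0 + v) ` V2"
    and reg: "regular_simplex hyp k A1" "regular_simplex hyp (DIM('a) - k) A2"
    and ball: "mball hyp 0 r \<subseteq> convex hull (A1 \<union> A2)"
    using assms unfolding orth_simplex_config_def by blast
  have fA: "finite (A1 \<union> A2)" "A1 \<union> A2 \<subseteq> Mpts hyp" using reg by (auto simp: regular_simplex_def)
  have sub: "T ` A \<subseteq> (\<lambda>v. c + v) ` (E ` V)" if V: "subspace V" "A \<subseteq> V" and A: "A \<subseteq> Mpts hyp" for A V
  proof clarify
    fix w assume w: "w \<in> A"
    then obtain s where "T w = c + s *\<^sub>R E w" using E(3) A by blast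
    then have "T w = c + E (s *\<^sub>R w)" using E(1) by (simp add: linear_scale)
    moreover have "s *\<^sub>R w \<in> V" using V w by (auto intro: subspace_scale)
    ultimately show "T w \<in> (\<lambda>v. c + v) ` (E ` V)" by blast
  qed
  have "dim (E ` V) = dim V" for V using E(1,2) by (intro dim_image_eq) (auto intro: inj_on_subset)
  moreover have "subspace (E ` V1)" "subspace (E ` V2)" using V E(1) by (auto intro: linear_subspace_image)
  moreover have "\<forall>u\<in>E ` V1. \<forall>v\<in>E ` V2. morth hyp c u v"
    using V(5) E(4) by (auto simp: morth_def split: if_splits)
  moreover have "T ` A1 \<subseteq> (\<lambda>v. c + v) ` (E ` V1)" "T ` A2 \<subseteq> (\<lambda>v. c + v) ` (E ` V2)"
    using V fA(2) sub[of V1 A1] sub[of V2 A2] by auto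
  moreover have "mball hyp c r \<subseteq> convex hull (T ` A1 \<union> T ` A2)"
    using image_mono[OF ball, of T] hull[OF fA] by (simp add: mball_image image_Un)
  ultimately show ?thesis
    unfolding orth_simplex_config_def using V(3,4) regular_simplex_image[OF reg(1)] regular_simplex_image[OF reg(2)]
    by (intro conjI exI[of _ "E ` V1"] exI[of _ "E ` V2"]) auto
qed

text \<open>The polytope is pulled back by \<open>T'\<close>, the problem solved around
  \<open>0\<close>, and the solution pushed forward by \<open>T\<close>. The predicate
  \<open>K\<close> on the dimension is kept abstract, so that both halves of the theorem share the
  transfer.\<close>

lemma transfer_from_origin:
  assumes sol: "\<And>A :: 'a set. finite A \<Longrightarrow> card A \<le> n \<Longrightarrow> A \<subseteq> Mpts hyp \<Longrightarrow> mball hyp 0 r \<subseteq> convex hull A \<Longrightarrow>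
      \<exists>k A1 (A2 :: 'a set). K k \<and> orth_simplex_config hyp 0 r k A1 A2 \<and> mvol hyp (convex hull A) \<ge> mvol hyp (convex hull (A1 \<union> A2))"
    and A: "finite A" "card A \<le> n" "A \<subseteq> Mpts hyp" "mball hyp c r \<subseteq> convex hull A"
  shows "\<exists>k A1 A2. K k \<and> orth_simplex_config hyp c r k A1 A2 \<and> mvol hyp (convex hull A) \<ge> mvol hyp (convex hull (A1 \<union> A2))"
proof -
  define B where "B = T' ` A"
  have B: "finite B" "B \<subseteq> Mpts hyp" using A T by (auto simp: B_def)
  have TB: "T ` B = A" using A(3) inv(2) by (force simp: B_def image_image)
  have cB: "card B \<le> n" using A(1,2) card_image_le[of A T'] by (simp add: B_def)
  have "mball hyp 0 r \<subseteq> convex hull B"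
  proof
    fix x :: 'a assume x: "x \<in> mball hyp 0 r"
    then have "T x \<in> T ` (convex hull B)" using A(4) mball_image[of r] hull[OF B] TB by auto
    then obtain y where y: "y \<in> convex hull B" "T x = T y" by auto
    have "x \<in> Mpts hyp" "y \<in> Mpts hyp" using x y hull_subset_Mpts[OF B(2)] by (auto simp: mball_def)
    then have "x = y" using inv(1) y(2) by metis
    then show "x \<in> convex hull B" using y by simp
  qed
  from sol[OF B(1) cB B(2) this] obtain k and A1 A2 :: "'a set" where k: "K k" "orth_simplex_config hyp 0 r k A1 A2"
    "mvol hyp (convex hull B) \<ge> mvol hyp (convex hull (A1 \<union> A2))" by blast
  have fA: "finite (A1 \<union> A2)" "A1 \<union> A2 \<subseteq> Mpts hyp"
    using k(2) by (auto simp: regular_simplex_def orth_simplex_config_def)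
  have "mvol hyp (convex hull (T ` A1 \<union> T ` A2)) \<le> mvol hyp (convex hull A)"
    using k(3) mvol_hull_image[OF fA] mvol_hull_image[OF B] TB by (simp add: image_Un)
  then show ?thesis
    by (intro exI[of _ k] exI[of _ "T ` A1"] exI[of _ "T ` A2"] conjI k(1) orth_simplex_config_image[OF k(2)])
qed

end

lemma mvol_translation:
  assumes S: "compact S" shows "mvol False ((+) c ` S) = mvol False S"
proof -
  have cS: "compact ((+) c ` S)" using S by (rule compact_translation)
  have [measurable]: "S \<in> sets borel" "(+) c ` S \<in> sets borel" using S cS by (auto intro: borel_compact)
  have "mass (weight False) ((+) c ` S)
      = (\<integral>\<^sup>+x. weight False (c + x) * indicator ((+) c ` S) (c + x) \<partial>lborel)"
    by (rule nn_integral_lborel_translate[symmetric]) measurable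
  also have "\<dots> = mass (weight False) S"
    by (intro nn_integral_cong) (auto simp: weight_def indicator_def)
  finally have *: "mass (weight False) ((+) c ` S)
      = mass (weight False) S" .
  have M: "X \<subseteq> Mpts False" for X :: "'a set" by (simp add: Mpts_def)
  have "ennreal (mvol False ((+) c ` S)) = ennreal (mvol False S)"
    unfolding mvol_eq_nn_integral(1)[OF cS M] mvol_eq_nn_integral(1)[OF S M] by (rule *)
  then show ?thesis
    by (rule ennreal_inj[OF mvol_eq_nn_integral(2)[OF cS M] mvol_eq_nn_integral(2)[OF S M], THEN iffD1])
qed

lemma model_isometry_translation: "model_isometry False c ((+) c) (\<lambda>x. x - c) (\<lambda>x. x)"
  apply unfold_locales
               apply (simp add: Mpts_def)
              apply (simp add: Mpts_def)
             apply simp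
            apply simp
           apply (simp add: mdist_def)
          apply (simp add: convex_hull_translation)
         apply (erule affine_dependent_translation_eq[THEN iffD2])
        apply (rule mvol_translation, assumption)
       apply (simp add: Mpts_def)
      apply simp
      apply (rule refl)
     apply (rule refl)
    apply (rule inj_on_id2)
   apply (rule exI[of _ 1], simp)
  apply (simp add: morth_def)
  done

lemma model_isometry_id: "model_isometry hyp 0 (\<lambda>x. x) (\<lambda>x. x) (\<lambda>x. x)"
  apply unfold_locales
              apply assumption
             apply (rule refl)
            apply (rule refl)
           apply simp
          apply simp
         apply simp
        apply (simp add: Mpts_def)
       apply simp
      apply (rule refl)
     apply (rule refl)
    apply (rule inj_on_id2)
   apply (rule exI[of _ 1], simp)
  apply (simp add: morth_def)
  done

section \<open>Hyperbolic reflections in the Klein model\<close>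

text \<open>The Lorentz product of \<open>(1, y)\<close> with the unit timelike vector in direction
  \<open>(1, c)\<close>. It is the time coordinate of the reflected vector, hence the factor to
  divide by on returning to the model.\<close>

definition klein_den :: "'a::euclidean_space \<Rightarrow> 'a \<Rightarrow> real" where
  "klein_den c y = (1 - y \<bullet> c) / sqrt (1 - (norm c)\<^sup>2)"

text \<open>The hyperbolic reflection interchanging \<open>0\<close> and \<open>c\<close>; on the hyperboloid in
  \<open>\<real> \<times> \<real>\<^sup>d\<close> it is the Lorentz reflection along \<open>(1, 0) - (1, c) / s\<close>.\<close>

definition klein_refl :: "'a::euclidean_space \<Rightarrow> 'a \<Rightarrow> 'a" where
  "klein_refl c y = (y + ((klein_den c y - 1) / (1 - sqrt (1 - (norm c)\<^sup>2))) *\<^sub>R c) /\<^sub>R klein_den c y"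

locale klein =
  fixes c :: "'a::euclidean_space" and s :: real
  assumes c0: "c \<noteq> 0" and c1: "norm c < 1" and s_def: "s = sqrt (1 - (norm c)\<^sup>2)"
begin

abbreviation "D \<equiv> klein_den c"
abbreviation "H \<equiv> klein_refl c"

lemma s: "0 < s" "s < 1" "c \<bullet> c = 1 - s\<^sup>2"
proof -
  have "(norm c)\<^sup>2 < 1" using c1 by (simp add: abs_square_less_1)
  moreover have "(norm c)\<^sup>2 > 0" using c0 by simp
  ultimately show "0 < s" "s < 1" "c \<bullet> c = 1 - s\<^sup>2"
    by (simp_all add: s_def power2_norm_eq_inner real_sqrt_lt_1_iff)
qed

lemma D_eq: "D y = (1 - y \<bullet> c) / s" and H_eq: "H y = (y + ((D y - 1) / (1 - s)) *\<^sub>R c) /\<^sub>R D y"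
  by (simp_all add: klein_den_def klein_refl_def s_def)

lemma inner_c: "y \<bullet> c = 1 - s * D y"
  using s by (simp add: D_eq)

lemma D_pos: assumes "norm y < 1" shows "D y > 0"
proof -
  have "y \<bullet> c \<le> norm y * norm c" by (rule norm_cauchy_schwarz)
  also have "\<dots> < 1" using mult_left_le_one_le[of "norm c" "norm y"] assms c1 by simp
  finally show ?thesis using s by (simp add: D_eq)
qed

lemma D_scaleR_H: "D y \<noteq> 0 \<Longrightarrow> D y *\<^sub>R H y = y + ((D y - 1) / (1 - s)) *\<^sub>R c"
  by (simp add: H_eq)

lemma D_H: assumes "D y \<noteq> 0" shows "D (H y) = 1 / D y"
proof -
  have "D y * (H y \<bullet> c) = (D y *\<^sub>R H y) \<bullet> c" by simp
  also have "\<dots> = y \<bullet> c + (D y - 1) / (1 - s) * (1 - s\<^sup>2)"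
    by (simp only: D_scaleR_H[OF assms]) (simp add: inner_add_left s)
  also have "(D y - 1) / (1 - s) * (1 - s\<^sup>2) = (D y - 1) * (1 + s)"
  proof -
    have "1 - s\<^sup>2 = (1 - s) * (1 + s)" by (simp add: power2_eq_square algebra_simps)
    then show ?thesis using s by simp
  qed
  also have "y \<bullet> c + (D y - 1) * (1 + s) = D y - s"
    unfolding inner_c by (simp add: algebra_simps)
  finally have "H y \<bullet> c = 1 - s / D y" using assms by (simp add: field_simps)
  then show ?thesis using s by (simp add: D_eq[of "H y"])
qed

lemma H_H: assumes "D y \<noteq> 0" shows "H (H y) = y"
proof -
  have "H (H y) = D y *\<^sub>R (H y + ((1 / D y - 1) / (1 - s)) *\<^sub>R c)"
    by (simp add: H_eq[of "H y"] D_H[OF assms])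
  also have "\<dots> = y + ((D y - 1) / (1 - s) + D y * ((1 / D y - 1) / (1 - s))) *\<^sub>R c"
    by (simp add: scaleR_right_distrib D_scaleR_H[OF assms] scaleR_left_distrib)
  also have "(D y - 1) / (1 - s) + D y * ((1 / D y - 1) / (1 - s)) = 0"
    using assms s by (simp add: field_simps)
  finally show ?thesis by simp
qed

text \<open>The number \<open>1 - x \<bullet> y\<close> is the Lorentz product of
  \<open>(1, x)\<close> and \<open>(1, y)\<close>. The reflection preserves it, and the denominators
  come from normalizing the time coordinates to \<open>1\<close>.\<close>

lemma inner_H:
  assumes "D x \<noteq> 0" "D y \<noteq> 0" shows "1 - H x \<bullet> H y = (1 - x \<bullet> y) / (D x * D y)"
proof -
  have "D x * D y * (H x \<bullet> H y) = (D x *\<^sub>R H x) \<bullet> (D y *\<^sub>R H y)" by simp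
  also have "\<dots> = x \<bullet> y + ((D y - 1) * (x \<bullet> c) + (D x - 1) * (y \<bullet> c) + (D x - 1) * (D y - 1) * (1 + s)) / (1 - s)"
  proof -
    have cc: "c \<bullet> c / (1 - s) = 1 + s"
      unfolding s(3) using s(2) by (simp add: field_simps power2_eq_square)
    have "(D x *\<^sub>R H x) \<bullet> (D y *\<^sub>R H y) = x \<bullet> y + (D y - 1) / (1 - s) * (x \<bullet> c) + (D x - 1) / (1 - s) * (y \<bullet> c)
        + (D x - 1) * (D y - 1) / (1 - s) * (c \<bullet> c / (1 - s))"
      unfolding D_scaleR_H[OF assms(1)] D_scaleR_H[OF assms(2)]
      by (simp add: inner_add_left inner_add_right inner_commute)
    then show ?thesis unfolding cc by (simp add: add_divide_distrib)
  qed
  also have "(D y - 1) * (x \<bullet> c) + (D x - 1) * (y \<bullet> c) + (D x - 1) * (D y - 1) * (1 + s) = (1 - s) * (D x * D y - 1)"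
    unfolding inner_c by (simp add: algebra_simps)
  also have "x \<bullet> y + (1 - s) * (D x * D y - 1) / (1 - s) = x \<bullet> y + D x * D y - 1" using s by simp
  finally have "D x * D y * (1 - H x \<bullet> H y) = 1 - x \<bullet> y" by (simp add: algebra_simps)
  then show ?thesis using assms by (simp add: field_simps)
qed

lemma norm_H_lt: assumes "norm y < 1" shows "norm (H y) < 1"
proof -
  have d: "D y > 0" using D_pos[OF assms] .
  have "y \<bullet> y < 1" using assms by (simp add: norm_lt_square)
  then have "1 - H y \<bullet> H y > 0" using d by (simp add: inner_H)
  then show ?thesis by (simp add: norm_lt_square)
qed

lemma mdist_H:
  assumes "norm x < 1" "norm y < 1" shows "mdist True (H x) (H y) = mdist True x y"
proof -
  have d: "D x > 0" "D y > 0" using D_pos assms by auto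
  have n: "1 - (norm (H z))\<^sup>2 = (1 - (norm z)\<^sup>2) / (D z)\<^sup>2" if "D z > 0" for z
    using inner_H[of z z] that by (simp add: power2_norm_eq_inner power2_eq_square[of "D z"])
  have "(1 - (norm (H x))\<^sup>2) * (1 - (norm (H y))\<^sup>2) = (1 - (norm x)\<^sup>2) * (1 - (norm y)\<^sup>2) / (D x * D y)\<^sup>2"
    by (simp add: n[OF d(1)] n[OF d(2)] power_mult_distrib)
  then have "sqrt ((1 - (norm (H x))\<^sup>2) * (1 - (norm (H y))\<^sup>2)) = sqrt ((1 - (norm x)\<^sup>2) * (1 - (norm y)\<^sup>2)) / (D x * D y)"
    using d by (simp add: real_sqrt_divide)
  then show ?thesis using d by (simp add: mdist_def inner_H)
qed

lemma D_combination:
  assumes "sum u A = 1" shows "D (\<Sum>x\<in>A. u x *\<^sub>R x) = (\<Sum>x\<in>A. u x * D x)"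
proof -
  have "1 - (\<Sum>x\<in>A. u x *\<^sub>R x) \<bullet> c = (\<Sum>x\<in>A. u x * (1 - x \<bullet> c))"
    using assms by (simp add: inner_sum_left algebra_simps sum_subtractf)
  then show ?thesis by (simp add: D_eq sum_divide_distrib)
qed

text \<open>A projective map turns weights \<open>u x\<close> into weights proportional to
  \<open>u x * D x\<close>, which stay nonnegative because \<open>D\<close> is positive on the
  model.\<close>

lemma H_hull_subset:
  assumes A: "finite A" "\<And>x. x \<in> A \<Longrightarrow> norm x < 1" and y: "y \<in> convex hull A"
  shows "H y \<in> convex hull (H ` A)"
proof -
  obtain u where u: "\<And>x. x \<in> A \<Longrightarrow> 0 \<le> u x" "sum u A = 1" "(\<Sum>x\<in>A. u x *\<^sub>R x) = y"
    using y unfolding convex_hull_finite[OF A(1)] by auto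
  have Dy: "D y = (\<Sum>x\<in>A. u x * D x)" using D_combination[OF u(2)] u(3) by simp
  have Dx: "D x > 0" if "x \<in> A" for x using D_pos A(2) that by auto
  have "D y \<ge> 0" unfolding Dy using u(1) Dx by (intro sum_nonneg) (simp add: less_imp_le)
  moreover have "D y \<noteq> 0"
  proof
    assume "D y = 0"
    then have "\<forall>x\<in>A. u x * D x = 0"
      unfolding Dy using A(1) u(1) Dx by (subst (asm) sum_nonneg_eq_0_iff) (auto simp: less_imp_le)
    then have "u x = 0" if "x \<in> A" for x using Dx that by fastforce
    then show False using u(2) by simp
  qed
  ultimately have D0: "D y > 0" by simp
  define w where "w x = u x * D x / D y" for x
  have "(\<Sum>x\<in>A. w x *\<^sub>R H x) \<in> convex hull (H ` A)"
  proof (rule convex_sum[OF A(1) convex_convex_hull])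
    show "sum w A = 1" using D0 Dy by (simp add: w_def flip: sum_divide_distrib)
    show "0 \<le> w x" if "x \<in> A" for x using u(1) Dx D0 that by (simp add: w_def less_imp_le)
  qed (simp add: hull_inc)
  also have "(\<Sum>x\<in>A. w x *\<^sub>R H x) = H y"
  proof -
    define k where "k = c /\<^sub>R (1 - s)"
    have DH: "D z *\<^sub>R H z = z + (D z - 1) *\<^sub>R k" if "D z > 0" for z
      using that by (simp add: D_scaleR_H k_def divide_inverse)
    have "D y *\<^sub>R (\<Sum>x\<in>A. w x *\<^sub>R H x) = (\<Sum>x\<in>A. u x *\<^sub>R (D x *\<^sub>R H x))"
      using D0 by (simp add: scaleR_right.sum w_def)
    also have "\<dots> = (\<Sum>x\<in>A. u x *\<^sub>R x + (u x * D x - u x) *\<^sub>R k)"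
      using Dx by (intro sum.cong refl) (simp add: DH scaleR_right_distrib algebra_simps)
    also have "\<dots> = y + (D y - 1) *\<^sub>R k"
      using u(2,3) by (simp add: sum.distrib sum_subtractf Dy scaleR_left.sum[symmetric])
    also have "\<dots> = D y *\<^sub>R H y" using DH[OF D0] by simp
    finally show ?thesis using D0 by simp
  qed
  finally show ?thesis .
qed

text \<open>In homogeneous coordinates an affine relation is a linear relation between the vectors
  \<open>(1, H x)\<close>. The linear reflection carries it to one between the multiples
  \<open>D (H x)\<close> of \<open>(1, x)\<close>, and the multipliers do not vanish.\<close>

lemma affine_dependent_H:
  assumes A: "finite A" "\<And>x. x \<in> A \<Longrightarrow> norm x < 1" and dep: "affine_dependent (H ` A)"
  shows "affine_dependent A"
proof -
  have HH: "H (H x) = x" if "x \<in> A" for x using H_H D_pos[OF A(2)[OF that]] by simp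
  have inj: "inj_on H A" using HH by (metis inj_onI)
  obtain U where U: "sum U (H ` A) = 0" "\<exists>v\<in>H ` A. U v \<noteq> 0" "(\<Sum>v\<in>H ` A. U v *\<^sub>R v) = 0"
    using dep affine_dependent_explicit_finite[of "H ` A"] A(1) by auto
  define u where "u x = U (H x)" for x
  have u: "sum u A = 0" "(\<Sum>x\<in>A. u x *\<^sub>R H x) = 0" "\<exists>x\<in>A. u x \<noteq> 0"
    using U unfolding sum.reindex[OF inj] by (auto simp: u_def)
  define w where "w x = u x * D (H x)" for x
  have DH: "D (H x) \<noteq> 0" if "x \<in> A" for x using D_H[of x] D_pos[OF A(2)[OF that]] by simp
  have "sum w A = (\<Sum>x\<in>A. u x - (u x *\<^sub>R H x) \<bullet> c) / s"
    by (simp add: w_def D_eq sum_divide_distrib algebra_simps)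
  also have "\<dots> = (sum u A - (\<Sum>x\<in>A. u x *\<^sub>R H x) \<bullet> c) / s"
    by (simp only: sum_subtractf inner_sum_left)
  also have "\<dots> = 0" using u by simp
  finally have w0: "sum w A = 0" .
  define k where "k = c /\<^sub>R (1 - s)"
  have "(\<Sum>x\<in>A. w x *\<^sub>R x) = (\<Sum>x\<in>A. u x *\<^sub>R (D (H x) *\<^sub>R H (H x)))"
    by (intro sum.cong) (simp_all add: w_def HH)
  also have "\<dots> = (\<Sum>x\<in>A. u x *\<^sub>R H x + (w x - u x) *\<^sub>R k)"
    using DH by (intro sum.cong refl)
      (simp add: D_scaleR_H w_def k_def scaleR_right_distrib algebra_simps divide_inverse)
  also have "\<dots> = 0" using u w0 by (simp add: sum.distrib sum_subtractf scaleR_left.sum[symmetric])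
  finally have "(\<Sum>x\<in>A. w x *\<^sub>R x) = 0" .
  moreover have "\<exists>x\<in>A. w x \<noteq> 0" using u(3) DH by (auto simp: w_def)
  ultimately show ?thesis using w0 affine_dependent_explicit_finite[OF A(1)] by auto
qed

end

text \<open>The part below the hyperboloid of the cone over a set in the Klein model has Lebesgue measure
  proportional to the hyperbolic volume of that set.\<close>

definition klein_cone :: "'a::euclidean_space set \<Rightarrow> (real \<times> 'a) set" where
  "klein_cone S = {p. fst p > 0 \<and> snd p /\<^sub>R fst p \<in> S \<and> (fst p)\<^sup>2 - (norm (snd p))\<^sup>2 \<le> 1}"

lemma klein_cone_measurable [measurable]:
  fixes S :: "'a::euclidean_space set"
  assumes [measurable]: "S \<in> sets borel" shows "klein_cone S \<in> sets borel"
proof -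
  have "(\<lambda>p. fst p > 0 \<and> snd p /\<^sub>R fst p \<in> S \<and> (fst p)\<^sup>2 - (norm (snd p))\<^sup>2 \<le> 1)
     \<in> measurable (borel \<Otimes>\<^sub>M borel) (count_space UNIV)" by measurable
  then have "{p \<in> space (borel \<Otimes>\<^sub>M borel). fst p > 0 \<and> snd p /\<^sub>R fst p \<in> S \<and> (fst p)\<^sup>2 - (norm (snd p))\<^sup>2 \<le> 1}
     \<in> sets (borel \<Otimes>\<^sub>M borel :: (real \<times> 'a) measure)" by (rule predE)
  then show ?thesis 
    unfolding klein_cone_def borel_prod[symmetric] by (simp add: space_pair_measure)
qed

section \<open>Measure of the cone over a set\<close>

lemma nn_integral_lborel_scaleR:
  fixes f :: "'a::euclidean_space \<Rightarrow> ennreal"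
  assumes [measurable]: "f \<in> borel_measurable borel" and t: "t > 0"
  shows "(\<integral>\<^sup>+x. f x \<partial>lborel) = ennreal (t ^ DIM('a)) * (\<integral>\<^sup>+x. f (t *\<^sub>R x) \<partial>lborel)"
proof -
  have "(\<integral>\<^sup>+x. f x \<partial>lborel) = (\<integral>\<^sup>+x. f x \<partial>density (distr lborel borel (\<lambda>x. 0 + t *\<^sub>R x)) (\<lambda>_. ennreal (\<bar>t\<bar> ^ DIM('a))))"
    using lborel_affine[of t "0::'a"] t by simp
  also have "\<dots> = ennreal (t ^ DIM('a)) * (\<integral>\<^sup>+x. f (t *\<^sub>R x) \<partial>lborel)"
    using t by (simp add: nn_integral_density nn_integral_distr nn_integral_cmult)
  finally show ?thesis .
qed

text \<open>With \<open>q = 1 - (norm x)\<^sup>2\<close> the ray over \<open>x\<close> stays below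
  the hyperboloid up to height \<open>q powr (-1/2)\<close>. The integral of \<open>t ^ d\<close> up
  to this height is the origin of the exponent in the hyperbolic density.\<close>

lemma nn_integral_power_below:
  assumes q: "0 < q"
  shows "(\<integral>\<^sup>+t. ennreal (t ^ d) * indicator {t. 0 < t \<and> t\<^sup>2 * q \<le> 1} t \<partial>lborel)
    = ennreal (q powr (- (real d + 1) / 2) / (real d + 1))"
proof -
  define b where "b = q powr (-1/2)"
  have b: "b > 0" using q by (simp add: b_def)
  have b2: "b\<^sup>2 * q = 1"
  proof -
    have "b\<^sup>2 = b powr 2" using b by (simp add: powr_numeral)
    also have "\<dots> = q powr (-1)" by (simp add: b_def powr_powr)
    finally show ?thesis using q by (simp add: powr_minus field_simps)
  qed
  have iff: "t\<^sup>2 * q \<le> 1 \<longleftrightarrow> t \<le> b" if "t > 0" for t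
  proof -
    have "t\<^sup>2 * q \<le> 1 \<longleftrightarrow> t\<^sup>2 * q \<le> b\<^sup>2 * q" by (simp add: b2)
    also have "\<dots> \<longleftrightarrow> t\<^sup>2 \<le> b\<^sup>2" using q by simp
    also have "\<dots> \<longleftrightarrow> t \<le> b" using b that by (simp add: abs_le_square_iff[symmetric])
    finally show ?thesis .
  qed
  have "(\<integral>\<^sup>+t. ennreal (t ^ d) * indicator {t. 0 < t \<and> t\<^sup>2 * q \<le> 1} t \<partial>lborel)
    = (\<integral>\<^sup>+t. ennreal (t ^ d) * indicator {0..b} t \<partial>lborel)"
  proof (rule nn_integral_cong_AE)
    have "AE t in lborel. t \<noteq> (0::real)" by (rule AE_lborel_singleton)
    then show "AE t in lborel. ennreal (t ^ d) * indicator {t. 0 < t \<and> t\<^sup>2 * q \<le> 1} t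
        = ennreal (t ^ d) * indicator {0..b} t"
      by eventually_elim (auto simp: indicator_def iff)
  qed
  also have "\<dots> = ennreal (b ^ (d + 1) / (real d + 1) - 0 ^ (d + 1) / (real d + 1))"
  proof (rule nn_integral_FTC_Icc)
    show "((\<lambda>t. t ^ (d + 1) / (real d + 1)) has_real_derivative x ^ d) (at x)" for x
    proof -
      have "((\<lambda>t. t ^ (d + 1)) has_real_derivative real (d + 1) * x ^ d) (at x)"
        using DERIV_pow[of "d + 1" x UNIV] by simp
      moreover have "real (d + 1) * x ^ d / (real d + 1) = x ^ d"
        using nonzero_mult_div_cancel_left[of "real d + 1" "x ^ d"] by (simp add: add.commute)
      ultimately show ?thesis using DERIV_cdivide[of _ _ _ _ "real d + 1"] by metis
    qed
  qed (use b in auto)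
  also have "b ^ (d + 1) = q powr (- (real d + 1) / 2)"
  proof -
    have "b ^ (d + 1) = b powr (real (d + 1))" by (rule powr_realpow[OF b, symmetric])
    also have "\<dots> = q powr ((-1/2) * real (d + 1))" unfolding b_def by (simp only: powr_powr)
    also have "(-1/2) * real (d + 1) = - (real d + 1) / 2" by (simp add: field_simps)
    finally show ?thesis .
  qed
  finally show ?thesis by simp
qed

text \<open>The slice at height \<open>t\<close> is rescaled by \<open>t\<close>, at the cost of the
  Jacobian \<open>t ^ d\<close>. After the integrals are exchanged, the inner one runs along the ray
  over \<open>x\<close> and gives the density up to the factor \<open>d + 1\<close>.\<close>

lemma emeasure_klein_cone:
  fixes S :: "'a::euclidean_space set"
  assumes [measurable]: "S \<in> sets borel" and S: "S \<subseteq> {x. norm x < 1}"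
  shows "mass (weight True) S = ennreal (real DIM('a) + 1) * emeasure lborel (klein_cone S)"
proof -
  define d where "d = DIM('a)"
  have "emeasure lborel (klein_cone S) = (\<integral>\<^sup>+p. indicator (klein_cone S) p \<partial>(lborel \<Otimes>\<^sub>M lborel))"
    by (simp add: lborel_prod)
  also have "\<dots> = (\<integral>\<^sup>+t. (\<integral>\<^sup>+z. indicator (klein_cone S) (t, z) \<partial>lborel) \<partial>lborel)"
    by (rule lborel.nn_integral_fst[symmetric]) (simp add: lborel_prod)
  also have "\<dots> = (\<integral>\<^sup>+t. (\<integral>\<^sup>+x. indicator S x * (ennreal (t ^ d) * indicator {t. 0 < t \<and> t\<^sup>2 * (1 - (norm x)\<^sup>2) \<le> 1} t) \<partial>lborel) \<partial>lborel)"
  proof (rule nn_integral_cong)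
    fix t :: real
    show "(\<integral>\<^sup>+z. indicator (klein_cone S) (t, z) \<partial>lborel)
      = (\<integral>\<^sup>+x. indicator S x * (ennreal (t ^ d) * indicator {t. 0 < t \<and> t\<^sup>2 * (1 - (norm x)\<^sup>2) \<le> 1} t) \<partial>lborel)"
    proof (cases "t > 0")
      case False
      then show ?thesis by (simp add: klein_cone_def indicator_def)
    next
      case True
      have [measurable]: "(\<lambda>z. indicator (klein_cone S) (t, z) :: ennreal) \<in> borel_measurable borel"
        by (rule measurable_compose[of "\<lambda>z. (t, z)" _ "borel"]) measurable
      have "(\<integral>\<^sup>+z. indicator (klein_cone S) (t, z) \<partial>lborel)
         = ennreal (t ^ d) * (\<integral>\<^sup>+x. indicator (klein_cone S) (t, t *\<^sub>R x) \<partial>lborel)"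
        unfolding d_def by (rule nn_integral_lborel_scaleR[OF _ True]) measurable
      also have "\<dots> = (\<integral>\<^sup>+x. ennreal (t ^ d) * indicator (klein_cone S) (t, t *\<^sub>R x) \<partial>lborel)"
        by (rule nn_integral_cmult[symmetric])
          (rule measurable_compose[of "\<lambda>x. t *\<^sub>R x" _ borel]; measurable)
      also have "\<dots> = (\<integral>\<^sup>+x. indicator S x * (ennreal (t ^ d) * indicator {t. 0 < t \<and> t\<^sup>2 * (1 - (norm x)\<^sup>2) \<le> 1} t) \<partial>lborel)"
        using True by (intro nn_integral_cong)
          (auto simp: klein_cone_def indicator_def power_mult_distrib algebra_simps)
      finally show ?thesis .
    qed
  qed
  also have "\<dots> = (\<integral>\<^sup>+x. (\<integral>\<^sup>+t. indicator S x * (ennreal (t ^ d) * indicator {t. 0 < t \<and> t\<^sup>2 * (1 - (norm x)\<^sup>2) \<le> 1} t) \<partial>lborel) \<partial>lborel)"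
    by (rule lborel_pair.Fubini') (simp add: indicator_def, measurable)
  also have "\<dots> = (\<integral>\<^sup>+x. indicator S x * ennreal ((1 - (norm x)\<^sup>2) powr (- (real d + 1) / 2) / (real d + 1)) \<partial>lborel)"
  proof (rule nn_integral_cong)
    fix x :: 'a
    show "(\<integral>\<^sup>+t. indicator S x * (ennreal (t ^ d) * indicator {t. 0 < t \<and> t\<^sup>2 * (1 - (norm x)\<^sup>2) \<le> 1} t) \<partial>lborel)
      = indicator S x * ennreal ((1 - (norm x)\<^sup>2) powr (- (real d + 1) / 2) / (real d + 1))"
    proof (cases "x \<in> S")
      case True
      then have "0 < 1 - (norm x)\<^sup>2" using S by (auto simp: abs_square_less_1)
      from nn_integral_power_below[OF this] True show ?thesis by simp
    qed simp
  qed
  finally have *: "emeasure lborel (klein_cone S)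
    = (\<integral>\<^sup>+x. indicator S x * ennreal ((1 - (norm x)\<^sup>2) powr (- (real d + 1) / 2) / (real d + 1)) \<partial>lborel)" .
  have "ennreal (real d + 1) * emeasure lborel (klein_cone S)
    = (\<integral>\<^sup>+x. ennreal (real d + 1) * (indicator S x * ennreal ((1 - (norm x)\<^sup>2) powr (- (real d + 1) / 2) / (real d + 1))) \<partial>lborel)"
    unfolding * by (rule nn_integral_cmult[symmetric]) measurable
  also have "\<dots> = mass (weight True) S"
  proof (rule nn_integral_cong)
    fix x :: 'a
    show "ennreal (real d + 1) * (indicator S x * ennreal ((1 - (norm x)\<^sup>2) powr (- (real d + 1) / 2) / (real d + 1))) = weight True x * indicator S x"
    proof (cases "x \<in> S")
      case True
      have "ennreal (real d + 1) * ennreal ((1 - (norm x)\<^sup>2) powr (- (real d + 1) / 2) / (real d + 1))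
         = ennreal ((1 - (norm x)\<^sup>2) powr (- (real d + 1) / 2))"
        by (subst ennreal_mult[symmetric]) auto
      then show ?thesis using True S by (auto simp: weight_def d_def)
    qed simp
  qed
  finally show ?thesis by (simp add: d_def)
qed

section \<open>Invariance of hyperbolic volume and of orthogonality\<close>

context klein
begin

text \<open>The second vector is the mirror vector \<open>(1, 0) - (1, c) / s\<close> of the Lorentz
  reflection. The first represents, in the Euclidean inner product, minus twice the Lorentz product
  with this vector divided by its Lorentz square.\<close>

definition G :: "real \<times> 'a \<Rightarrow> real \<times> 'a" where
  "G p = p + ((- 1, c /\<^sub>R (1 - s)) \<bullet> p) *\<^sub>R (- (1 / s - 1), - (c /\<^sub>R s))"

lemma G_cone: "G (t, t *\<^sub>R y) = (t * D y, (t * D y) *\<^sub>R H y)" if "D y \<noteq> 0"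
proof -
  define m where "m = (- 1, c /\<^sub>R (1 - s)) \<bullet> (t, t *\<^sub>R y)"
  have "m = t * ((y \<bullet> c) / (1 - s) - 1)"
    by (simp add: m_def inner_prod_def inner_commute divide_inverse algebra_simps)
  then have m: "m = t * ((1 - s * D y) / (1 - s) - 1)" unfolding inner_c .
  have s1: "1 - s \<noteq> 0" "s \<noteq> 0" using s by auto
  have m2: "m = t * s * (1 - D y) / (1 - s)"
    unfolding m using s1 by (simp add: field_simps)
  have "t + m * (1 - 1 / s) = t * D y"
    unfolding m2 using s1 by (simp add: field_simps)
  moreover have "t *\<^sub>R y - m *\<^sub>R (c /\<^sub>R s) = (t * D y) *\<^sub>R H y"
  proof -
    have "(t * D y) *\<^sub>R H y = t *\<^sub>R y + (t * ((D y - 1) / (1 - s))) *\<^sub>R c"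
    proof -
      have "(t * D y) *\<^sub>R H y = t *\<^sub>R (D y *\<^sub>R H y)" by simp
      then show ?thesis unfolding D_scaleR_H[OF that] by (simp add: scaleR_right_distrib)
    qed
    moreover have "m * inverse s = - (t * ((D y - 1) / (1 - s)))"
      unfolding m2 using s1 by (simp add: field_simps)
    ultimately show ?thesis by simp
  qed
  ultimately show ?thesis unfolding G_def m_def[symmetric] by simp
qed

lemma emeasure_G: "B \<in> sets borel \<Longrightarrow> emeasure lborel (G ` B) = emeasure lborel B"
proof -
  assume B: "B \<in> sets borel"
  have cc: "c \<bullet> c = (1 - s) * (1 + s)" unfolding s(3) by (simp add: power2_eq_square algebra_simps)
  have "(- 1, c /\<^sub>R (1 - s)) \<bullet> (- (1 / s - 1), - (c /\<^sub>R s)) = (1 / s - 1) - inverse (1 - s) * (inverse s * (c \<bullet> c))"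
    by (simp add: inner_prod_def)
  also have "\<dots> = -2" unfolding cc using s by (simp add: field_simps)
  finally have *: "1 + (- 1, c /\<^sub>R (1 - s)) \<bullet> (- (1 / s - 1), - (c /\<^sub>R s)) = -1" by simp
  show ?thesis
    using emeasure_rank_one_image[OF B, of "(- 1, c /\<^sub>R (1 - s))" "(- (1 / s - 1), - (c /\<^sub>R s))"]
    unfolding * by (simp add: G_def[abs_def])
qed

text \<open>The linear map \<open>G\<close> preserves the difference
  \<open>t\<^sup>2 - (norm z)\<^sup>2\<close> on the cone and induces \<open>H\<close> on its rays,
  so it carries the truncated cone over a set to that over the image.\<close>

lemma klein_cone_H:
  assumes S: "S \<subseteq> {x. norm x < 1}" shows "klein_cone (H ` S) = G ` klein_cone S"
proof -
  have form: "(t * D y)\<^sup>2 - (norm ((t * D y) *\<^sub>R H y))\<^sup>2 = t\<^sup>2 - (norm (t *\<^sub>R y))\<^sup>2" if "D y > 0" for t y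
  proof -
    have "(t * D y)\<^sup>2 - (norm ((t * D y) *\<^sub>R H y))\<^sup>2 = (t * D y)\<^sup>2 * (1 - H y \<bullet> H y)"
      by (simp add: power_mult_distrib power2_norm_eq_inner[symmetric] algebra_simps)
    also have "\<dots> = t\<^sup>2 * (1 - y \<bullet> y)" using that by (simp add: inner_H power_mult_distrib power2_eq_square[of "D y"])
    also have "\<dots> = t\<^sup>2 - (norm (t *\<^sub>R y))\<^sup>2"
      by (simp add: power_mult_distrib power2_norm_eq_inner[symmetric] algebra_simps)
    finally show ?thesis .
  qed
  show ?thesis
  proof (intro set_eqI iffI)
    fix p assume "p \<in> G ` klein_cone S"
    then obtain q where q: "q \<in> klein_cone S" "p = G q" by auto
    define t y where "t = fst q" and "y = snd q /\<^sub>R t"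
    have t: "t > 0" "y \<in> S" using q by (auto simp: klein_cone_def t_def y_def)
    have qt: "q = (t, t *\<^sub>R y)" using t(1) by (auto simp: y_def t_def prod_eq_iff)
    have d: "D y > 0" using D_pos S t by auto
    have p: "p = (t * D y, (t * D y) *\<^sub>R H y)" unfolding q(2) qt using d by (intro G_cone) simp
    have "t\<^sup>2 - (norm (t *\<^sub>R y))\<^sup>2 \<le> 1" using q(1) unfolding qt by (simp add: klein_cone_def power_mult_distrib)
    then have "(t * D y)\<^sup>2 - (norm ((t * D y) *\<^sub>R H y))\<^sup>2 \<le> 1" using form[OF d, of t] by simp
    moreover have "(t * D y) *\<^sub>R H y /\<^sub>R (t * D y) = H y"
    proof -
      have "r *\<^sub>R v /\<^sub>R r = v" if "r \<noteq> 0" for r and v :: 'a using that by simp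
      moreover have "t * D y \<noteq> 0" using t(1) d by simp
      ultimately show ?thesis by blast
    qed
    ultimately show "p \<in> klein_cone (H ` S)"
      unfolding p klein_cone_def mem_Collect_eq fst_conv snd_conv using t d by auto
  next
    fix p assume p: "p \<in> klein_cone (H ` S)"
    define r where "r = fst p"
    have r: "r > 0" using p by (auto simp: klein_cone_def r_def)
    obtain y where y: "y \<in> S" "snd p /\<^sub>R r = H y" using p by (auto simp: klein_cone_def r_def)
    have d: "D y > 0" using D_pos S y by auto
    define t where "t = r / D y"
    have rt: "r = t * D y" using d by (simp add: t_def)
    have "snd p = r *\<^sub>R H y" unfolding y(2)[symmetric] using r by simp
    then have pr: "p = (t * D y, (t * D y) *\<^sub>R H y)" by (auto simp: rt[symmetric] r_def prod_eq_iff)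
    have t0: "t > 0" using r d by (simp add: t_def)
    have "(t * D y)\<^sup>2 - (norm ((t * D y) *\<^sub>R H y))\<^sup>2 \<le> 1" using p unfolding pr by (simp add: klein_cone_def power_mult_distrib)
    then have "t\<^sup>2 - (norm (t *\<^sub>R y))\<^sup>2 \<le> 1" using form[OF d, of t] by simp
    then have "(t, t *\<^sub>R y) \<in> klein_cone S" using t0 y(1) by (simp add: klein_cone_def power_mult_distrib)
    moreover have "p = G (t, t *\<^sub>R y)" unfolding pr using d by (intro G_cone[symmetric]) simp
    ultimately show "p \<in> G ` klein_cone S" by blast
  qed
qed

lemma mvol_H:
  assumes S: "compact S" "S \<subseteq> Mpts True" "compact (H ` S)"
  shows "mvol True (H ` S) = mvol True S"
proof -
  have sub: "S \<subseteq> {x. norm x < 1}" "H ` S \<subseteq> {x. norm x < 1}"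
    using S(2) norm_H_lt by (auto simp: Mpts_def)
  have M: "H ` S \<subseteq> Mpts True" using sub by (simp add: Mpts_def)
  have bor: "S \<in> sets borel" "H ` S \<in> sets borel" using S by (auto intro: borel_compact)
  have "emeasure lborel (klein_cone (H ` S)) = emeasure lborel (klein_cone S)"
    unfolding klein_cone_H[OF sub(1)] by (rule emeasure_G) (rule klein_cone_measurable[OF bor(1)])
  then have "ennreal (mvol True (H ` S)) = ennreal (mvol True S)"
    unfolding mvol_eq_nn_integral(1)[OF S(1,2)] mvol_eq_nn_integral(1)[OF S(3) M]
      emeasure_klein_cone[OF bor(1) sub(1)] emeasure_klein_cone[OF bor(2) sub(2)] by (rule arg_cong)
  then show ?thesis
    by (rule ennreal_inj[OF mvol_eq_nn_integral(2)[OF S(3) M] mvol_eq_nn_integral(2)[OF S(1,2)], THEN iffD1])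
qed

definition E :: "'a \<Rightarrow> 'a" where "E w = w - ((w \<bullet> c) / (1 - s)) *\<^sub>R c"

lemma linear_E: "linear E"
  by (rule linearI) (auto simp: E_def inner_add_left add_divide_distrib algebra_simps)

lemma inner_c_E: "c \<bullet> E u = - s * (c \<bullet> u)"
proof -
  have "c \<bullet> E u = c \<bullet> u - (c \<bullet> u) * (c \<bullet> c / (1 - s))"
    by (simp add: E_def inner_diff_right inner_commute)
  also have "c \<bullet> c / (1 - s) = 1 + s" unfolding s(3) using s by (simp add: field_simps power2_eq_square)
  finally show ?thesis by (simp add: algebra_simps)
qed

lemma inj_E: "inj E"
proof -
  have "u = 0" if "E u = 0" for u
  proof -
    have "c \<bullet> u = 0" using inner_c_E[of u] that s by simp
    then show ?thesis using that by (simp add: E_def inner_commute)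
  qed
  then show ?thesis using linear_injective_0[OF linear_E] by blast
qed

text \<open>For orthogonal \<open>u\<close> and \<open>v\<close> the product
  \<open>E u \<bullet> E v\<close> is \<open>- (c \<bullet> u) * (c \<bullet> v)\<close>, while
  \<open>inner_c_E\<close> contributes \<open>s\<^sup>2 * (c \<bullet> u) * (c \<bullet> v)\<close>
  through the second term of the Klein metric. As \<open>1 - (norm c)\<^sup>2 = s\<^sup>2\<close>,
  the two terms cancel.\<close>

lemma morth_E:
  assumes "u \<bullet> v = 0" shows "morth True c (E u) (E v)"
proof -
  have n: "1 - (norm c)\<^sup>2 = s\<^sup>2" using s(3) by (simp add: power2_norm_eq_inner)
  have "E u \<bullet> E v = u \<bullet> E v - (u \<bullet> c) / (1 - s) * (c \<bullet> E v)" by (simp add: E_def[of u] inner_diff_left)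
  also have "u \<bullet> E v = - (u \<bullet> c) * (c \<bullet> v) / (1 - s)"
    using assms by (simp add: E_def inner_diff_right inner_commute)
  also have "- (u \<bullet> c) * (c \<bullet> v) / (1 - s) - (u \<bullet> c) / (1 - s) * (c \<bullet> E v) = - (c \<bullet> u) * (c \<bullet> v)"
  proof -
    have "- a * b / (1 - s) - a / (1 - s) * (- s * b) = - a * b" for a b :: real
    proof -
      have "- a * b / (1 - s) - a / (1 - s) * (- s * b) = (- a * b) * (1 - s) / (1 - s)"
        by (simp add: divide_inverse algebra_simps)
      then show ?thesis using s by simp
    qed
    then show ?thesis unfolding inner_c_E by (simp add: inner_commute)
  qed
  finally have "E u \<bullet> E v = - (c \<bullet> u) * (c \<bullet> v)" .
  then show ?thesis unfolding morth_def n inner_c_E by (simp add: power2_eq_square)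
qed

text \<open>Geodesics through \<open>0\<close> are mapped to geodesics through \<open>c\<close>, so
  \<open>H w - c\<close> is a multiple of a linear image of \<open>w\<close>. This is how subspaces
  through \<open>0\<close> turn into subspaces through \<open>c\<close>.\<close>

lemma H_eq_E: assumes "D w \<noteq> 0" shows "H w = c + (1 / D w) *\<^sub>R E w"
proof -
  have k: "(D w - 1) / (1 - s) = D w - (w \<bullet> c) / (1 - s)"
    unfolding inner_c using s by (simp add: field_simps)
  have "D w *\<^sub>R H w = w + (D w - (w \<bullet> c) / (1 - s)) *\<^sub>R c" unfolding D_scaleR_H[OF assms] k ..
  also have "\<dots> = D w *\<^sub>R (c + (1 / D w) *\<^sub>R E w)"
    using assms by (simp add: E_def scaleR_right_distrib scaleR_left_diff_distrib)
  finally show ?thesis using assms by simp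
qed

lemma model_isometry_H: "model_isometry True c H H E"
proof -
  have M: "x \<in> Mpts True \<longleftrightarrow> norm x < 1" for x :: 'a by (simp add: Mpts_def)
  have D0: "D x \<noteq> 0" if "x \<in> Mpts True" for x using D_pos that M by force
  have T: "H x \<in> Mpts True" if "x \<in> Mpts True" for x using norm_H_lt that M by simp
  have HH: "H (H x) = x" if "x \<in> Mpts True" for x using H_H[OF D0[OF that]] .
  have hull: "H ` (convex hull A) = convex hull (H ` A)" if A: "finite A" "A \<subseteq> Mpts True" for A
  proof
    show "H ` (convex hull A) \<subseteq> convex hull (H ` A)"
      using H_hull_subset[OF A(1)] A(2) M by blast
    have HA: "finite (H ` A)" "H ` A \<subseteq> Mpts True" using A T by auto
    \<comment> \<open>The reverse inclusion is the first one for the image of \<open>A\<close>,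
      since \<open>H\<close> is an involution.\<close>
    have "H ` H ` A = A" using A(2) HH by (force simp: image_image)
    then have sub: "H ` (convex hull (H ` A)) \<subseteq> convex hull A"
    proof -
      have "H y \<in> convex hull (H ` H ` A)" if "y \<in> convex hull (H ` A)" for y
        using H_hull_subset[OF HA(1) _ that] HA(2) M by blast
      then show ?thesis using \<open>H ` H ` A = A\<close> by auto
    qed
    have hM: "convex hull (H ` A) \<subseteq> Mpts True" using hull_minimal[of _ "Mpts True" convex] convex_Mpts HA(2) by blast
    show "convex hull (H ` A) \<subseteq> H ` (convex hull A)"
    proof
      fix z assume z: "z \<in> convex hull (H ` A)"
      then have "H z \<in> convex hull A" using sub by blast
      moreover have "z = H (H z)" using HH[of z] hM z by auto
      ultimately show "z \<in> H ` (convex hull A)" by blast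
    qed
  qed
  have H0: "H 0 = c"
    using H_eq_E[of 0] D_pos[of 0] by (simp add: E_def)
  have dep: "affine_dependent A" if "finite A" "A \<subseteq> Mpts True" "affine_dependent (H ` A)" for A
    using affine_dependent_H[OF that(1) _ that(3)] that(2) M by blast
  have HE: "\<exists>r. H w = c + r *\<^sub>R E w" if "w \<in> Mpts True" for w using H_eq_E[OF D0[OF that]] by blast
  have md: "mdist True (H x) (H y) = mdist True x y" if "x \<in> Mpts True" "y \<in> Mpts True" for x y
    using mdist_H that M by blast
  have z: "(0::'a) \<in> Mpts True" by (simp add: Mpts_def)
  show ?thesis
    by (rule model_isometry.intro) (fact T HH md hull dep mvol_H z H0 linear_E inj_E HE morth_E)+
qed

end

lemma exists_model_isometry:
  assumes "c \<in> Mpts hyp"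
  shows "\<exists>T T' E. model_isometry hyp c T T' E"
proof (cases hyp)
  case False
  then have h: "hyp = False" by simp
  show ?thesis unfolding h using model_isometry_translation by blast
next
  case True
  then have h: "hyp = True" by simp
  show ?thesis
  proof (cases "c = 0")
    case True
    then show ?thesis using model_isometry_id by blast
  next
    case False
    then interpret klein c "sqrt (1 - (norm c)\<^sup>2)"
      using assms h by unfold_locales (auto simp: Mpts_def)
    show ?thesis unfolding h using model_isometry_H by blast
  qed
qed

section \<open>Comparison of volumes\<close>

text \<open>The orthonormal vectors extracted from the given configuration are distributed anew,
  \<open>m\<close> of them to the first simplex and the rest to the second. Both volumes are then
  multiples of the same corner volume, and only the coefficients have to be compared. The bound
  \<open>d * R\<close> on the vertices serves to keep the new polytope inside the Klein model when
  the ball is small.\<close>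

lemma exists_better_cross_config:
  fixes a :: "'i \<Rightarrow> 'a::euclidean_space" and b :: "'j \<Rightarrow> 'a"
  assumes cfg: "cross_config I J a b \<alpha> \<gamma>" and R: "R > 0" "cball 0 R \<subseteq> convex hull (a ` I \<union> b ` J)"
    and m: "1 \<le> m" "m < DIM('a)"
  shows "\<exists>(I'::'a set) (J'::'a set) (a'::'a \<Rightarrow> 'a) (b'::'a \<Rightarrow> 'a) \<alpha>' \<gamma>'. cross_config I' J' a' b' \<alpha>' \<gamma>' \<and> card I' = m + 1 \<and>
    cball 0 R \<subseteq> convex hull (a' ` I' \<union> b' ` J') \<and> (\<forall>x\<in>a' ` I' \<union> b' ` J'. norm x \<le> real DIM('a) * R) \<and>
    ennreal (sqrt (psi DIM('a) (card I - 1) / psi DIM('a) m)) * emeasure lborel (convex hull (a' ` I' \<union> b' ` J'))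
      \<le> emeasure lborel (convex hull (a ` I \<union> b ` J))"
proof -
  interpret c: cross I J a b \<alpha> \<gamma> "real (card I) - 1" "real (card J) - 1"
    using cfg by unfold_locales auto
  interpret cf: cross J I b a \<gamma> \<alpha> "real (card J) - 1" "real (card I) - 1" by (rule c.flip)
  define d where "d = DIM('a)"
  have "I \<noteq> {}" "J \<noteq> {}" using c.basic(3,4) by auto
  then obtain i0 j0 where ij0: "i0 \<in> I" "j0 \<in> J" by auto
  define G1 where "G1 = c.frame i0 ` (I - {i0})"
  define G2 where "G2 = cf.frame j0 ` (J - {j0})"
  define F where "F = G1 \<union> G2"
  have finG: "finite G1" "finite G2" using c.basic(1,2) by (auto simp: G1_def G2_def)
  have oG: "orthonormal G1" "orthonormal G2" "card G1 = card I - 1" "card G2 = card J - 1"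
    unfolding G1_def G2_def using c.frame_orthonormal[OF ij0(1)] cf.frame_orthonormal[OF ij0(2)] by auto
  have perp: "x \<bullet> y = 0" if "x \<in> G1" "y \<in> G2" for x y
    using that ij0 by (auto simp: G1_def G2_def c.frame_def cf.frame_def inner_diff_left inner_diff_right c.inner_ab)
  have "G1 \<inter> G2 = {}"
  proof -
    have False if "x \<in> G1" "x \<in> G2" for x using perp[OF that] oG(1) that(1) unfolding orthonormal_def by (metis zero_neq_one)
    then show ?thesis by blast
  qed
  then have "card F = card G1 + card G2" unfolding F_def using finG by (intro card_Un_disjoint)
  then have cF: "card F = d" using oG(3,4) c.cIJ c.basic(3,4) by (simp add: d_def)
  have finF: "finite F" using finG by (simp add: F_def)
  have "x \<bullet> y = (if x = y then 1 else 0)" if xy: "x \<in> F" "y \<in> F" for x y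
  proof -
    have xG: "x \<in> G1 \<or> x \<in> G2" and yG: "y \<in> G1 \<or> y \<in> G2" using xy by (auto simp: F_def)
    have p2: "y \<in> G1 \<Longrightarrow> x \<in> G2 \<Longrightarrow> x \<bullet> y = 0" using perp[of y x] by (simp add: inner_commute)
    show ?thesis using xG yG
      by (elim disjE) (use oG(1,2) perp[of x y] p2 \<open>G1 \<inter> G2 = {}\<close> in \<open>auto simp: orthonormal_def\<close>)
  qed
  then have oF: "orthonormal F" by (simp add: orthonormal_def)
  \<comment> \<open>Any \<open>m\<close> vectors will do, since the corner is spanned by all of
    \<open>F\<close> however it is split.\<close>
  obtain F1 where F1: "F1 \<subseteq> F" "card F1 = m" using m cF obtain_subset_with_card_n[of m F] by (auto simp: d_def)
  define F2 where "F2 = F - F1"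
  have fin: "finite F1" "finite F2" using F1 finF by (auto simp: F2_def finite_subset)
  have cF2: "card F2 = d - m" unfolding F2_def using F1 finF cF by (simp add: card_Diff_subset finite_subset)
  have o12: "orthonormal F1" "orthonormal F2"
    using oF F1(1) unfolding orthonormal_def F2_def by blast+
  have perp12: "x \<bullet> y = 0" if "x \<in> F1" "y \<in> F2" for x y using oF F1(1) that unfolding orthonormal_def F2_def by (metis DiffE subsetD)
  define l where "l = d - m"
  have l1: "l \<ge> 1" using m by (simp add: l_def d_def)
  have d0: "d \<ge> 1" using m by (simp add: d_def)
  \<comment> \<open>The equality case of the comparison of means: \<open>\<alpha>' / m\<close> and
    \<open>\<gamma>' / l\<close> both equal \<open>d * R\<^sup>2\<close>, and the inradius comes out
    as exactly \<open>R\<close>.\<close>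
  define \<alpha>' where "\<alpha>' = real m * real d * R\<^sup>2"
  define \<gamma>' where "\<gamma>' = real l * real d * R\<^sup>2"
  have ag: "\<alpha>' > 0" "\<gamma>' > 0" using m l1 d0 R by (auto simp: \<alpha>'_def \<gamma>'_def)
  define a' where "a' = simplex_of_frame F1 \<alpha>'"
  define b' where "b' = simplex_of_frame F2 \<gamma>'"
  define I' where "I' = insert 0 F1"
  define J' where "J' = insert 0 F2"
  have cm: "card F1 \<ge> 1" "card F2 \<ge> 1" using F1(2) cF2 m l1 by (auto simp: l_def)
  note s1 = simplex_of_frame[OF fin(1) o12(1) cm(1) ag(1)]
  note s2 = simplex_of_frame[OF fin(2) o12(2) cm(2) ag(2)]
  have cI': "card I' = m + 1" "card J' = l + 1" using s1(2) s2(2) F1(2) cF2 by (auto simp: I'_def J'_def l_def)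
  have "a' p \<bullet> b' q = 0" if "p \<in> I'" "q \<in> J'" for p q
    unfolding a'_def
  proof (rule s1(5))
    show "p \<in> insert 0 F1" using that(1) by (simp add: I'_def)
    fix f assume f: "f \<in> F1"
    have "b' q \<bullet> f = 0"
      unfolding b'_def
    proof (rule s2(5))
      show "q \<in> insert 0 F2" using that(2) by (simp add: J'_def)
      show "f' \<bullet> f = 0" if "f' \<in> F2" for f' using perp12[OF f that] by (simp add: inner_commute)
    qed
    then show "f \<bullet> b' q = 0" by (simp add: inner_commute)
  qed
  then have cfg': "cross_config I' J' a' b' \<alpha>' \<gamma>'"
    using s1(1) s2(1) cI' m by (auto simp: cross_config_def I'_def J'_def a'_def b'_def l_def d_def)
  interpret q: cross I' J' a' b' \<alpha>' \<gamma>' "real m" "real l"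
    using cfg' cI' by unfold_locales auto
  interpret qf: cross J' I' b' a' \<gamma>' \<alpha>' "real l" "real m" by (rule q.flip)
  have kl: "(real m)\<^sup>2 / \<alpha>' + (real l)\<^sup>2 / \<gamma>' = 1 / R\<^sup>2"
  proof -
    have "(real m)\<^sup>2 / \<alpha>' = real m / (real d * R\<^sup>2)" "(real l)\<^sup>2 / \<gamma>' = real l / (real d * R\<^sup>2)"
      using m l1 by (auto simp: \<alpha>'_def \<gamma>'_def power2_eq_square)
    moreover have "real m + real l = real d" using m by (simp add: l_def d_def)
    ultimately show ?thesis using d0 by (simp flip: add_divide_distrib)
  qed
  have ball: "cball 0 R \<subseteq> convex hull (a' ` I' \<union> b' ` J')"
    using q.cball_subset_Q[OF R(1)] R(1) kl by (simp add: q.Q_def)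
  have norm: "norm x \<le> real d * R" if "x \<in> a' ` I' \<union> b' ` J'" for x
  proof -
    have "x \<bullet> x = \<alpha>' \<or> x \<bullet> x = \<gamma>'" using that q.inner_aa q.inner_bb by auto
    then have x: "(norm x)\<^sup>2 = \<alpha>' \<or> (norm x)\<^sup>2 = \<gamma>'" by (simp only: power2_norm_eq_inner)
    have "real n * real d * R\<^sup>2 \<le> (real d * R)\<^sup>2" if "n \<le> d" for n
    proof -
      have "real n * (real d * R\<^sup>2) \<le> real d * (real d * R\<^sup>2)" using that by (intro mult_right_mono) auto
      then show ?thesis by (simp add: power_mult_distrib power2_eq_square mult_ac)
    qed
    from this[of m] this[of l] have "\<alpha>' \<le> (real d * R)\<^sup>2" "\<gamma>' \<le> (real d * R)\<^sup>2"
      unfolding \<alpha>'_def \<gamma>'_def using m by (auto simp only: l_def d_def diff_le_self less_imp_le)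
    with x have le: "(norm x)\<^sup>2 \<le> (real d * R)\<^sup>2" by (elim disjE) (simp_all only:)
    show ?thesis by (rule power2_le_imp_le[OF le]) (use R(1) in simp)
  qed
  define VF where "VF = emeasure lborel (convex hull (insert 0 F))"
  define c1 where "c1 = cross.r (real (card I) - 1) * cross.r (real (card J) - 1) *
    cross.\<sigma> \<alpha> (real (card I) - 1) ^ (card I - 1) * cross.\<sigma> \<gamma> (real (card J) - 1) ^ (card J - 1)"
  define c2 where "c2 = cross.r (real m) * cross.r (real l) *
    cross.\<sigma> \<alpha>' (real m) ^ (card I' - 1) * cross.\<sigma> \<gamma>' (real l) ^ (card J' - 1)"
  have v1: "emeasure lborel (convex hull (a ` I \<union> b ` J)) = ennreal c1 * VF"
    using c.emeasure_Q_frame[OF ij0] by (simp add: c.Q_def c1_def VF_def F_def G1_def G2_def)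
  have fr1: "q.frame 0 p = p" if "p \<in> F1" for p
    using s1(4)[OF that, folded a'_def] unfolding q.frame_def q.r_def q.\<sigma>_def F1(2) .
  have fr2: "qf.frame 0 p = p" if "p \<in> F2" for p
    using s2(4)[OF that, folded b'_def] unfolding qf.frame_def qf.r_def qf.\<sigma>_def cF2[folded l_def] .
  have im: "I' - {0} = F1" "J' - {0} = F2" using s1(3) s2(3) by (auto simp: I'_def J'_def)
  have fr: "q.frame 0 ` (I' - {0}) = F1" "qf.frame 0 ` (J' - {0}) = F2"
    unfolding im using fr1 fr2 by force+
  have z: "0 \<in> I'" "0 \<in> J'" and F12: "F1 \<union> F2 = F" using F1(1) by (auto simp: I'_def J'_def F2_def)
  have v2: "emeasure lborel (convex hull (a' ` I' \<union> b' ` J')) = ennreal c2 * VF"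
    using q.emeasure_Q_frame[OF z] unfolding fr F12 q.Q_def c2_def VF_def .
  have c1p: "c1 \<ge> 0" using c.r(1) cf.r(1) c.\<sigma>(1) cf.\<sigma>(1) by (simp add: c1_def)
  have c2p: "c2 \<ge> 0" using q.r(1) qf.r(1) q.\<sigma>(1) qf.\<sigma>(1) by (simp add: c2_def)
  define X where "X = (R\<^sup>2 * real d) ^ d"
  have X0: "X > 0" using R(1) d0 by (simp add: X_def)
  have "c1\<^sup>2 \<ge> psi d (card I - 1) * X"
    unfolding c1_def c.coefficient_square d_def[symmetric] X_def
    using c.coefficient_lower_bound[OF R(1)] c.inradius_le[OF R(1)] R(2) psi_pos[of d "card I - 1"]
    by (intro mult_left_mono) (auto simp: c.Q_def d_def)
  moreover have "c2\<^sup>2 = psi d m * X"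
  proof -
    have "\<alpha>' / real m = R\<^sup>2 * real d" "\<gamma>' / real l = R\<^sup>2 * real d" using m l1 by (auto simp: \<alpha>'_def \<gamma>'_def)
    moreover have "(card I' - 1) + (card J' - 1) = d" using cI' m by (simp add: l_def d_def)
    ultimately have "(\<alpha>' / real m) ^ (card I' - 1) * (\<gamma>' / real l) ^ (card J' - 1) = X"
      by (simp add: X_def flip: power_add)
    then show ?thesis unfolding c2_def q.coefficient_square d_def[symmetric] using cI' by simp
  qed
  ultimately have "(sqrt (psi d (card I - 1) / psi d m) * c2)\<^sup>2 \<le> c1\<^sup>2"
    using psi_pos[of d m] psi_pos[of d "card I - 1"] by (simp add: power_mult_distrib less_imp_le)
  then have le: "sqrt (psi d (card I - 1) / psi d m) * c2 \<le> c1" using c1p by (rule power2_le_imp_le)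
  have "ennreal (sqrt (psi d (card I - 1) / psi d m)) * emeasure lborel (convex hull (a' ` I' \<union> b' ` J'))
     = ennreal (sqrt (psi d (card I - 1) / psi d m) * c2) * VF"
    using c2p psi_pos[of d m] psi_pos[of d "card I - 1"] by (simp add: v2 ennreal_mult mult.assoc less_imp_le)
  also have "\<dots> \<le> emeasure lborel (convex hull (a ` I \<union> b ` J))"
    unfolding v1 using le by (intro mult_right_mono ennreal_leI) auto
  finally show ?thesis
    using cfg' cI'(1) ball norm unfolding d_def by blast
qed

text \<open>Seen from the origin, both the Euclidean and the hyperbolic distance of two vertices are
  functions of Gram entries, so the Gram encoding makes the simplices regular in either geometry. At
  \<open>0\<close> the Riemannian orthogonality is the Euclidean one.\<close>

lemma cross_config_orth_simplex_config:
  fixes a :: "'i \<Rightarrow> 'a::euclidean_space"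
  assumes cfg: "cross_config I J a b \<alpha> \<gamma>" and M: "a ` I \<union> b ` J \<subseteq> Mpts hyp"
    and ball: "mball hyp 0 r \<subseteq> convex hull (a ` I \<union> b ` J)"
  shows "orth_simplex_config hyp 0 r (card I - 1) (a ` I) (b ` J)"
proof -
  have cI: "centred_simplex I a \<alpha>" and cJ: "centred_simplex J b \<gamma>" and cIJ: "card I + card J = DIM('a) + 2"
    and perp: "\<And>i j. i \<in> I \<Longrightarrow> j \<in> J \<Longrightarrow> a i \<bullet> b j = 0"
    using cfg by (auto simp: cross_config_def)
  have reg: "regular_simplex hyp (card I - 1) (a ` I)" if cI: "centred_simplex I a \<alpha>" and M: "a ` I \<subseteq> Mpts hyp"
    for I :: "'k set" and a :: "'k \<Rightarrow> 'a" and \<alpha>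
  proof -
    have b: "finite I" "card I \<ge> 2" using cI by (auto simp: centred_simplex_def)
    define \<beta> where "\<beta> = - \<alpha> / (real (card I) - 1)"
    define e where "e = (if hyp then arcosh ((1 - \<beta>) / sqrt ((1 - \<alpha>) * (1 - \<alpha>))) else sqrt (2 * \<alpha> - 2 * \<beta>))"
    have "mdist hyp (a i) (a j) = e" if ij: "i \<in> I" "j \<in> I" "a i \<noteq> a j" for i j
    proof -
      have ne: "i \<noteq> j" using ij by auto
      have n: "(norm (a i))\<^sup>2 = \<alpha>" "(norm (a j))\<^sup>2 = \<alpha>" "a i \<bullet> a j = \<beta>"
        using centred_simplex_inner[OF cI] ij ne by (simp_all add: power2_norm_eq_inner \<beta>_def)
      have "(dist (a i) (a j))\<^sup>2 = 2 * \<alpha> - 2 * \<beta>"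
        unfolding dist_norm power2_norm_eq_inner using n
        by (simp add: inner_diff_left inner_diff_right inner_commute power2_norm_eq_inner)
      then have "dist (a i) (a j) = sqrt (2 * \<alpha> - 2 * \<beta>)" by (metis real_sqrt_unique zero_le_dist)
      then show ?thesis by (simp add: mdist_def e_def n)
    qed
    then have "\<forall>x\<in>a ` I. \<forall>y\<in>a ` I. x \<noteq> y \<longrightarrow> mdist hyp x y = e" by auto
    then show ?thesis
      unfolding regular_simplex_def
      using b M centred_simplex_not_affine_dependent[OF cI] by (auto simp: card_image)
  qed
  have "card J - 1 = DIM('a) - (card I - 1)"
    using cIJ cI cJ by (auto simp: centred_simplex_def)
  moreover have "\<forall>u\<in>span (a ` I). \<forall>v\<in>span (b ` J). morth hyp 0 u v"
  proof (intro ballI)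
    fix u v assume uv: "u \<in> span (a ` I)" "v \<in> span (b ` J)"
    have "orthogonal v x" if "x \<in> a ` I" for x
    proof -
      have o: "orthogonal x y" if "y \<in> b ` J" for y using that \<open>x \<in> a ` I\<close> perp by (auto simp: orthogonal_def)
      have "orthogonal x v" by (rule orthogonal_to_span[OF uv(2)]) (rule o)
      then show ?thesis by (simp add: orthogonal_commute)
    qed
    then have "orthogonal v u" using orthogonal_to_span[OF uv(1)] by blast
    then show "morth hyp 0 u v" by (simp add: morth_def orthogonal_def inner_commute)
  qed
  moreover have "a ` I \<subseteq> span (a ` I)" "b ` J \<subseteq> span (b ` J)" by (auto intro: span_base)
  ultimately show ?thesis
    unfolding orth_simplex_config_def
    using reg[OF cI] reg[OF cJ] M ball centred_simplex_dim[OF cI] centred_simplex_dim[OF cJ]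
    by (intro conjI exI[of _ "span (a ` I)"] exI[of _ "span (b ` J)"]) auto
qed

lemma mball_zero:
  assumes "r > 0" shows "mball hyp (0::'a::euclidean_space) r = cball 0 (if hyp then tanh r else r)"
  using mball_hyp_zero[OF assms] mball_euclidean[of "0::'a" r] by (cases hyp) simp_all

lemma polytope_in_Mpts:
  assumes "finite S" "S \<subseteq> Mpts hyp"
  shows "compact (convex hull S)" "convex hull S \<subseteq> Mpts hyp"
proof -
  show "compact (convex hull S)" using assms(1) by (rule finite_imp_compact_convex_hull)
  show "convex hull S \<subseteq> Mpts hyp" by (simp add: subset_hull[of convex] convex_Mpts assms(2))
qed

lemma exists_cross_config_at_origin:
  fixes A :: "'a::euclidean_space set"
  assumes d: "DIM('a) \<ge> 2" and r: "r > 0"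
    and A: "finite A" "card A \<le> DIM('a) + 2" "A \<subseteq> Mpts hyp" "mball hyp 0 r \<subseteq> convex hull A"
  shows "\<exists>(I::nat set) J (a::nat \<Rightarrow> 'a) \<alpha> \<gamma>. cross_config I J a a \<alpha> \<gamma> \<and> card I \<le> card J \<and> a ` I \<union> a ` J \<subseteq> Mpts hyp \<and>
    mball hyp 0 r \<subseteq> convex hull (a ` I \<union> a ` J) \<and> mvol hyp (convex hull (a ` I \<union> a ` J)) \<le> mvol hyp (convex hull A)"
proof -
  define R where "R = (if hyp then tanh r else r)"
  have R: "R > 0" "mball hyp (0::'a) r = cball 0 R" using r by (simp_all only: R_def mball_zero[OF r]) simp
  have ball: "cball 0 R \<subseteq> convex hull A" using A(4) R by simp
  then have "A \<noteq> {}" using R by auto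
  \<comment> \<open>The largest vertex norm is below \<open>1\<close> in the hyperbolic case, and
    since the new vertices obey the same bound they remain in the open model.\<close>
  define M where "M = Max (norm ` A)"
  have M: "norm x \<le> M" if "x \<in> A" for x using A(1) that by (simp add: M_def)
  have M1: "M < 1" if hyp using A(1,3) \<open>A \<noteq> {}\<close> that by (auto simp: M_def Mpts_def)
  obtain I J :: "nat set" and a :: "nat \<Rightarrow> 'a" and \<alpha> \<gamma> where c: "cross_config I J a a \<alpha> \<gamma>" "card I \<le> card J"
    "\<forall>v\<in>I \<union> J. norm (a v) \<le> M" "cball 0 R \<subseteq> convex hull (a ` I \<union> a ` J)"
    "mass (weight hyp) (convex hull (a ` I \<union> a ` J))
      \<le> mass (weight hyp) (convex hull A)"
    using exists_cross_config[OF d A(1,2) M R(1) ball borel_measurable_weight weight_mono] by blast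
  have fin: "finite (a ` I \<union> a ` J)" using c(1) by (auto simp: cross_config_def centred_simplex_def)
  have sub: "a ` I \<union> a ` J \<subseteq> Mpts hyp"
  proof
    fix x assume "x \<in> a ` I \<union> a ` J"
    then have "norm x \<le> M" using c(3) by auto
    then show "x \<in> Mpts hyp" using M1 by (auto simp: Mpts_def)
  qed
  note hull = polytope_in_Mpts
  have "mvol hyp (convex hull (a ` I \<union> a ` J)) \<le> mvol hyp (convex hull A)"
    by (rule mvol_le[OF hull[OF fin sub] hull[OF A(1,3)] c(5)])
  then show ?thesis using c(1,2,4) sub R(2) by blast
qed

text \<open>As \<open>r\<close> tends to \<open>0\<close>, the density at Euclidean distance
  \<open>d * tanh r\<close> tends to \<open>1\<close>, while the volume ratios for the finitely many
  \<open>k < m\<close> are fixed numbers above \<open>1\<close>.\<close>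

lemma exists_small_radius:
  assumes "2 * m \<le> d"
  shows "\<exists>\<epsilon>>0. \<forall>r>0. r \<le> \<epsilon> \<longrightarrow> real d * tanh r < 1 \<and>
    (\<forall>k<m. (1 - (real d * tanh r)\<^sup>2) powr (- (real d + 1) / 2) \<le> sqrt (psi d k / psi d m))"
proof -
  have "((\<lambda>r. real d * tanh r) \<longlongrightarrow> real d * tanh 0) (at_right 0)"
    by (intro tendsto_intros) simp_all
  then have e1: "eventually (\<lambda>r. real d * tanh r < 1) (at_right 0)"
    by (rule order_tendstoD) simp
  have "((\<lambda>r. (1 - (real d * tanh r)\<^sup>2) powr (- (real d + 1) / 2)) \<longlongrightarrow> (1 - (real d * tanh 0)\<^sup>2) powr (- (real d + 1) / 2)) (at_right 0)"
    by (intro tendsto_intros) simp_all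
  then have lim: "((\<lambda>r. (1 - (real d * tanh r)\<^sup>2) powr (- (real d + 1) / 2)) \<longlongrightarrow> 1) (at_right 0)" by simp
  have "\<forall>k\<in>{..<m}. eventually (\<lambda>r. (1 - (real d * tanh r)\<^sup>2) powr (- (real d + 1) / 2) < sqrt (psi d k / psi d m)) (at_right 0)"
  proof
    fix k assume "k \<in> {..<m}"
    then have "psi d m < psi d k" using assms by (intro psi_strict) auto
    then have "1 < sqrt (psi d k / psi d m)" using psi_pos[of d m] by simp
    with lim show "eventually (\<lambda>r. (1 - (real d * tanh r)\<^sup>2) powr (- (real d + 1) / 2) < sqrt (psi d k / psi d m)) (at_right 0)"
      by (rule order_tendstoD)
  qed
  then have "eventually (\<lambda>r. \<forall>k\<in>{..<m}. (1 - (real d * tanh r)\<^sup>2) powr (- (real d + 1) / 2) < sqrt (psi d k / psi d m)) (at_right 0)"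
    by (simp add: eventually_ball_finite)
  with e1 have "eventually (\<lambda>r. real d * tanh r < 1 \<and>
      (\<forall>k\<in>{..<m}. (1 - (real d * tanh r)\<^sup>2) powr (- (real d + 1) / 2) < sqrt (psi d k / psi d m))) (at_right 0)"
    by (rule eventually_conj)
  then obtain b where b: "b > 0" "\<And>r. 0 < r \<Longrightarrow> r < b \<Longrightarrow> real d * tanh r < 1 \<and>
      (\<forall>k\<in>{..<m}. (1 - (real d * tanh r)\<^sup>2) powr (- (real d + 1) / 2) < sqrt (psi d k / psi d m))"
    unfolding eventually_at_right_field by blast
  show ?thesis
  proof (intro exI[of _ "b / 2"] conjI allI impI)
    fix r :: real assume r: "0 < r" "r \<le> b / 2"
    then have "r < b" using b(1) by simp
    note * = b(2)[OF r(1) this]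
    show "real d * tanh r < 1" using * by blast
    show "(1 - (real d * tanh r)\<^sup>2) powr (- (real d + 1) / 2) \<le> sqrt (psi d k / psi d m)" if "k < m" for k
      using * that by (simp add: less_imp_le)
  qed (use b in simp)
qed

lemma origin_first_part:
  fixes A :: "'a::euclidean_space set"
  assumes d: "DIM('a) \<ge> 2" and r: "r > 0"
    and A: "finite A" "card A \<le> DIM('a) + 2" "A \<subseteq> Mpts hyp" "mball hyp 0 r \<subseteq> convex hull A"
  shows "\<exists>k A1 (A2::'a set). (1 \<le> k \<and> 2 * k \<le> DIM('a)) \<and> orth_simplex_config hyp 0 r k A1 A2 \<and>
    mvol hyp (convex hull A) \<ge> mvol hyp (convex hull (A1 \<union> A2))"
proof -
  obtain I J :: "nat set" and a :: "nat \<Rightarrow> 'a" and \<alpha> \<gamma> where c: "cross_config I J a a \<alpha> \<gamma>" "card I \<le> card J" "a ` I \<union> a ` J \<subseteq> Mpts hyp"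
    "mball hyp 0 r \<subseteq> convex hull (a ` I \<union> a ` J)" "mvol hyp (convex hull (a ` I \<union> a ` J)) \<le> mvol hyp (convex hull A)"
    using exists_cross_config_at_origin[OF d r A] by blast
  have "card I \<ge> 2" "card I + card J = DIM('a) + 2" using c(1) by (auto simp: cross_config_def centred_simplex_def)
  then have k: "1 \<le> card I - 1 \<and> 2 * (card I - 1) \<le> DIM('a)" using c(2) by auto
  show ?thesis
    by (rule exI[of _ "card I - 1"], rule exI[of _ "a ` I"], rule exI[of _ "a ` J"])
      (intro conjI k[THEN conjunct1] k[THEN conjunct2] cross_config_orth_simplex_config[OF c(1,3,4)] c(5))
qed

text \<open>If the dimension \<open>k\<close> found is below \<open>m\<close>, the density is at
  most \<open>\<theta>\<close> on the competitor \<open>Q'\<close> and at least \<open>1\<close> on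
  \<open>Q\<close>. The mass of \<open>Q'\<close> is thus at most \<open>\<theta>\<close> times its
  Lebesgue measure, which is at most the Lebesgue measure of \<open>Q\<close> and hence at most its
  mass.\<close>

lemma origin_second_part:
  fixes A :: "'a::euclidean_space set"
  assumes d: "DIM('a) \<ge> 2" and r: "r > 0"
    and A: "finite A" "card A \<le> DIM('a) + 2" "A \<subseteq> Mpts hyp" "mball hyp 0 r \<subseteq> convex hull A"
    and small: "hyp \<Longrightarrow> real DIM('a) * tanh r < 1"
      "\<And>k. hyp \<Longrightarrow> k < DIM('a) div 2 \<Longrightarrow>
         (1 - (real DIM('a) * tanh r)\<^sup>2) powr (- (real DIM('a) + 1) / 2) \<le> sqrt (psi DIM('a) k / psi DIM('a) (DIM('a) div 2))"
  shows "\<exists>k A1 (A2::'a set). k = DIM('a) div 2 \<and> orth_simplex_config hyp 0 r k A1 A2 \<and>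
    mvol hyp (convex hull A) \<ge> mvol hyp (convex hull (A1 \<union> A2))"
proof -
  define m where "m = DIM('a) div 2"
  have m: "1 \<le> m" "m < DIM('a)" "2 * m \<le> DIM('a)" using d by (auto simp: m_def)
  define R where "R = (if hyp then tanh r else r)"
  have R: "R > 0" "mball hyp (0::'a) r = cball 0 R" using r by (simp_all only: R_def mball_zero[OF r]) simp
  obtain I J :: "nat set" and a :: "nat \<Rightarrow> 'a" and \<alpha> \<gamma> where c: "cross_config I J a a \<alpha> \<gamma>" "card I \<le> card J" "a ` I \<union> a ` J \<subseteq> Mpts hyp"
    "mball hyp 0 r \<subseteq> convex hull (a ` I \<union> a ` J)" "mvol hyp (convex hull (a ` I \<union> a ` J)) \<le> mvol hyp (convex hull A)"
    using exists_cross_config_at_origin[OF d r A] by blast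
  define k where "k = card I - 1"
  have "card I \<ge> 2" "card I + card J = DIM('a) + 2" using c(1) by (auto simp: cross_config_def centred_simplex_def)
  then have km: "k \<le> m" using c(2) by (auto simp: k_def m_def)
  show ?thesis
  proof (cases "k = m")
    case True
    show ?thesis
      by (rule exI[of _ k], rule exI[of _ "a ` I"], rule exI[of _ "a ` J"])
        (use True cross_config_orth_simplex_config[OF c(1,3,4)] c(5) in \<open>simp add: k_def m_def\<close>)
  next
    case False
    then have km: "k < m" using km by simp
    define \<theta> where "\<theta> = sqrt (psi DIM('a) k / psi DIM('a) m)"
    have "psi DIM('a) m < psi DIM('a) k" using km m(3) by (rule psi_strict)
    then have \<theta>1: "\<theta> \<ge> 1" using psi_pos[of "DIM('a)" m] by (simp add: \<theta>_def)
    have ball: "cball 0 R \<subseteq> convex hull (a ` I \<union> a ` J)" using c(4) R(2) by simp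
    obtain I' J' :: "'a set" and a' b' :: "'a \<Rightarrow> 'a" and \<alpha>' \<gamma>' where q: "cross_config I' J' a' b' \<alpha>' \<gamma>'" "card I' = m + 1"
      "cball 0 R \<subseteq> convex hull (a' ` I' \<union> b' ` J')" "\<forall>x\<in>a' ` I' \<union> b' ` J'. norm x \<le> real DIM('a) * R"
      "ennreal \<theta> * emeasure lborel (convex hull (a' ` I' \<union> b' ` J')) \<le> emeasure lborel (convex hull (a ` I \<union> a ` J))"
      using exists_better_cross_config[OF c(1) R(1) ball m(1,2)] unfolding k_def[symmetric] \<theta>_def[symmetric]
      by (elim exE conjE) (rule that)
    define Q where "Q = convex hull (a ` I \<union> a ` J)"
    define Q' where "Q' = convex hull (a' ` I' \<union> b' ` J')"
    have fin: "finite (a ` I \<union> a ` J)" "finite (a' ` I' \<union> b' ` J')"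
      using c(1) q(1) by (auto simp: cross_config_def centred_simplex_def)
    have sub': "a' ` I' \<union> b' ` J' \<subseteq> Mpts hyp"
    proof
      fix x assume "x \<in> a' ` I' \<union> b' ` J'"
      then have "norm x \<le> real DIM('a) * R" using q(4) by blast
      then show "x \<in> Mpts hyp" using small(1) by (auto simp: Mpts_def R_def)
    qed
    note hull = polytope_in_Mpts
    have cQ: "compact Q" "Q \<subseteq> Mpts hyp" "compact Q'" "Q' \<subseteq> Mpts hyp"
      unfolding Q_def Q'_def using hull[OF fin(1) c(3)] hull[OF fin(2) sub'] by auto
    have [measurable]: "Q \<in> sets borel" "Q' \<in> sets borel" using cQ by (auto intro: borel_compact)
    have Q'n: "norm x \<le> real DIM('a) * R" if "x \<in> Q'" for x
    proof -
      have "Q' \<subseteq> cball 0 (real DIM('a) * R)" unfolding Q'_def using q(4) by (intro hull_minimal) auto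
      then show ?thesis using that by auto
    qed
    have w': "weight hyp x \<le> ennreal \<theta>" if "x \<in> Q'" for x
    proof (cases hyp)
      case True
      have lt: "real DIM('a) * R < 1" using small(1) True by (simp add: R_def)
      \<comment> \<open>An arbitrary point at the largest distance allowed for \<open>Q'\<close>; by
        radial monotonicity the density there bounds the density on \<open>Q'\<close>.\<close>
      define y where "y = (real DIM('a) * R) *\<^sub>R (SOME b::'a. b \<in> Basis)"
      have ny: "norm y = real DIM('a) * R" using R(1) by (simp add: y_def norm_Basis[OF SOME_Basis])
      have "weight hyp x \<le> weight hyp y" using Q'n[OF that] ny by (intro weight_mono) simp
      also have "weight hyp y = ennreal ((1 - (real DIM('a) * R)\<^sup>2) powr (- (real DIM('a) + 1) / 2))"
        using True lt by (simp add: weight_def ny)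
      also have "\<dots> \<le> ennreal \<theta>"
        using small(2)[OF True] km True by (intro ennreal_leI) (simp add: \<theta>_def m_def R_def)
      finally show ?thesis .
    next
      case False
      then show ?thesis using \<theta>1 by (simp add: weight_def)
    qed
    have w: "1 \<le> weight hyp x" if "x \<in> Q" for x
    proof -
      have "weight hyp (0::'a) \<le> weight hyp x" by (rule weight_mono) simp
      moreover have "weight hyp (0::'a) = 1" by (simp add: weight_def)
      ultimately show ?thesis by simp
    qed
    have "mass (weight hyp) Q' \<le> (\<integral>\<^sup>+x. ennreal \<theta> * indicator Q' x \<partial>lborel)"
      using w' by (intro nn_integral_mono) (auto simp: indicator_def)
    also have "\<dots> = ennreal \<theta> * emeasure lborel Q'" by (rule nn_integral_cmult_indicator) simp
    also have "\<dots> \<le> emeasure lborel Q" using q(5) by (simp add: Q_def Q'_def)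
    also have "\<dots> = (\<integral>\<^sup>+x. indicator Q x \<partial>lborel)" by simp
    also have "\<dots> \<le> mass (weight hyp) Q"
      using w by (intro nn_integral_mono) (auto simp: indicator_def)
    finally have "mvol hyp Q' \<le> mvol hyp Q" by (rule mvol_le[OF cQ(3,4,1,2)])
    then have v: "mvol hyp (convex hull (a' ` I' \<union> b' ` J')) \<le> mvol hyp (convex hull A)"
      using c(5) by (simp add: Q_def Q'_def)
    have "mball hyp 0 r \<subseteq> convex hull (a' ` I' \<union> b' ` J')" using q(3) R(2) by simp
    from cross_config_orth_simplex_config[OF q(1) sub' this]
    have "orth_simplex_config hyp 0 r m (a' ` I') (b' ` J')" using q(2) by simp
    then show ?thesis using v unfolding m_def by blast
  qed
qed

theorem mainTheorem7:
  assumes "DIM('a::euclidean_space) \<ge> 2"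
  shows "(\<forall>hyp (c::'a) r A.
            c \<in> Mpts hyp \<and> r > 0 \<and> finite A \<and> card A \<le> DIM('a) + 2 \<and> A \<subseteq> Mpts hyp \<and>
            mball hyp c r \<subseteq> convex hull A \<longrightarrow>
            (\<exists>k A1 A2. 1 \<le> k \<and> 2 * k \<le> DIM('a) \<and> orth_simplex_config hyp c r k A1 A2 \<and>
               mvol hyp (convex hull A) \<ge> mvol hyp (convex hull (A1 \<union> A2))))
       \<and> (\<exists>\<epsilon>>0. \<forall>hyp (c::'a) r A.
            c \<in> Mpts hyp \<and> r > 0 \<and> finite A \<and> card A \<le> DIM('a) + 2 \<and> A \<subseteq> Mpts hyp \<and>
            mball hyp c r \<subseteq> convex hull A \<and> (\<not> hyp \<or> r \<le> \<epsilon>) \<longrightarrow>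
            (\<exists>k A1 A2. (k = DIM('a) div 2 \<or> (DIM('a) = 4 \<and> k = 1)) \<and>
               1 \<le> k \<and> 2 * k \<le> DIM('a) \<and> orth_simplex_config hyp c r k A1 A2 \<and>
               mvol hyp (convex hull A) \<ge> mvol hyp (convex hull (A1 \<union> A2))))"
proof (intro conjI allI impI)
  fix hyp and c :: 'a and r A
  assume "c \<in> Mpts hyp \<and> r > 0 \<and> finite A \<and> card A \<le> DIM('a) + 2 \<and> A \<subseteq> Mpts hyp \<and> mball hyp c r \<subseteq> convex hull A"
  then have h: "c \<in> Mpts hyp" "r > 0" "finite A" "card A \<le> DIM('a) + 2" "A \<subseteq> Mpts hyp" "mball hyp c r \<subseteq> convex hull A"
    by auto
  obtain T T' E where "model_isometry hyp c T T' E" using exists_model_isometry[OF h(1)] by blast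
  moreover have "\<exists>k A1 (A2::'a set). (1 \<le> k \<and> 2 * k \<le> DIM('a)) \<and> orth_simplex_config hyp 0 r k A1 A2 \<and>
      mvol hyp (convex hull A) \<ge> mvol hyp (convex hull (A1 \<union> A2))"
    if "finite A" "card A \<le> DIM('a) + 2" "A \<subseteq> Mpts hyp" "mball hyp 0 r \<subseteq> convex hull A" for A :: "'a set"
    by (rule origin_first_part[OF assms h(2) that])
  ultimately have "\<exists>k A1 A2. (1 \<le> k \<and> 2 * k \<le> DIM('a)) \<and> orth_simplex_config hyp c r k A1 A2 \<and>
      mvol hyp (convex hull A) \<ge> mvol hyp (convex hull (A1 \<union> A2))"
    by (rule model_isometry.transfer_from_origin[OF _ _ h(3-6)])
  then
  show "\<exists>k A1 A2. 1 \<le> k \<and> 2 * k \<le> DIM('a) \<and> orth_simplex_config hyp c r k A1 A2 \<and>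
     mvol hyp (convex hull A) \<ge> mvol hyp (convex hull (A1 \<union> A2))"
    by (elim exE conjE) (intro exI conjI)
next
  define m where "m = DIM('a) div 2"
  \<comment> \<open>Here \<open>m\<close> is fixed by the dimension, so one radius bound serves all
    centres and all polytopes.\<close>
  obtain \<epsilon> where \<epsilon>: "\<epsilon> > 0" and small: "\<And>r. r > 0 \<Longrightarrow> r \<le> \<epsilon> \<Longrightarrow> real DIM('a) * tanh r < 1 \<and>
    (\<forall>k<m. (1 - (real DIM('a) * tanh r)\<^sup>2) powr (- (real DIM('a) + 1) / 2) \<le> sqrt (psi DIM('a) k / psi DIM('a) m))"
    using exists_small_radius[of m "DIM('a)"] by (auto simp: m_def)
  show "\<exists>\<epsilon>>0. \<forall>hyp (c::'a) r A.
            c \<in> Mpts hyp \<and> r > 0 \<and> finite A \<and> card A \<le> DIM('a) + 2 \<and> A \<subseteq> Mpts hyp \<and>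
            mball hyp c r \<subseteq> convex hull A \<and> (\<not> hyp \<or> r \<le> \<epsilon>) \<longrightarrow>
            (\<exists>k A1 A2. (k = DIM('a) div 2 \<or> (DIM('a) = 4 \<and> k = 1)) \<and>
               1 \<le> k \<and> 2 * k \<le> DIM('a) \<and> orth_simplex_config hyp c r k A1 A2 \<and>
               mvol hyp (convex hull A) \<ge> mvol hyp (convex hull (A1 \<union> A2)))"
  proof (rule exI[of _ \<epsilon>], intro conjI \<epsilon> allI impI)
    fix hyp and c :: 'a and r A
    assume "c \<in> Mpts hyp \<and> r > 0 \<and> finite A \<and> card A \<le> DIM('a) + 2 \<and> A \<subseteq> Mpts hyp \<and>
      mball hyp c r \<subseteq> convex hull A \<and> (\<not> hyp \<or> r \<le> \<epsilon>)"
    then have h: "c \<in> Mpts hyp" "r > 0" "finite A" "card A \<le> DIM('a) + 2" "A \<subseteq> Mpts hyp" "mball hyp c r \<subseteq> convex hull A"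
      and re: "hyp \<Longrightarrow> r \<le> \<epsilon>"
      by auto
    have s1: "real DIM('a) * tanh r < 1" if hyp using small[OF h(2) re[OF that]] by blast
    have s2: "(1 - (real DIM('a) * tanh r)\<^sup>2) powr (- (real DIM('a) + 1) / 2) \<le> sqrt (psi DIM('a) k / psi DIM('a) (DIM('a) div 2))"
      if hyp "k < DIM('a) div 2" for k using small[OF h(2) re[OF that(1)]] that(2) unfolding m_def by blast
    obtain T T' E where iso: "model_isometry hyp c T T' E" using exists_model_isometry[OF h(1)] by blast
    have o: "\<exists>k A1 (A2::'a set). k = DIM('a) div 2 \<and> orth_simplex_config hyp 0 r k A1 A2 \<and>
        mvol hyp (convex hull A) \<ge> mvol hyp (convex hull (A1 \<union> A2))"
      if "finite A" "card A \<le> DIM('a) + 2" "A \<subseteq> Mpts hyp" "mball hyp 0 r \<subseteq> convex hull A" for A :: "'a set"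
      by (rule origin_second_part[OF assms h(2) that s1 s2])
    have "1 \<le> DIM('a) div 2" "2 * (DIM('a) div 2) \<le> DIM('a)" using assms by auto
    moreover have "\<exists>k A1 A2. k = DIM('a) div 2 \<and> orth_simplex_config hyp c r k A1 A2 \<and>
        mvol hyp (convex hull A) \<ge> mvol hyp (convex hull (A1 \<union> A2))"
      by (rule model_isometry.transfer_from_origin[OF iso o h(3-6)])
    then obtain k A1 A2 where "k = DIM('a) div 2" "orth_simplex_config hyp c r k A1 A2"
        "mvol hyp (convex hull A) \<ge> mvol hyp (convex hull (A1 \<union> A2))"
      by (elim exE conjE) (rule that)
    ultimately show "\<exists>k A1 A2. (k = DIM('a) div 2 \<or> (DIM('a) = 4 \<and> k = 1)) \<and>
       1 \<le> k \<and> 2 * k \<le> DIM('a) \<and> orth_simplex_config hyp c r k A1 A2 \<and>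
       mvol hyp (convex hull A) \<ge> mvol hyp (convex hull (A1 \<union> A2))"
      by (intro exI[of _ k] exI[of _ A1] exI[of _ A2] conjI disjI1) simp_all
  qed
qed

end
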